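(* Let $m\ge 1$. As formal power series in $x$ with coefficients in the polynomial ring $\mathbb{Z}[p_1,\ldots,p_m,q_1,\ldots,q_m]$, $$-G_{\mathbf{p};-\mathbf{q}}(-x) = -1 + (p_1+p_2+\cdots+p_m)\,x + \mathrm{TopFact}_{\mathbf{p};\mathbf{q}}(x).$$ That is, for every $k\ge 1$, the sum of the terms of highest total degree in $(-1)^kF_k(\mathbf{p};-\mathbf{q})$ equals $$\sum_{\substack{(\alpha,\psi)\in\mathfrak{S}_k^{(m)}\\ \kappa(\alpha)+\kappa(\alpha\omega_k)=k+1}} \mathbf{p}^{\kappa^{(m)}(\alpha,\psi)}\,\mathbf{q}^{\kappa^{(m)}((\alpha,\psi)\circ\omega_k)} .$$
   Context: Permutations are multiplied from right to left; $\kappa(\alpha)$ is the number of cycles of a permutation $\alpha$ (fixed points included); $[m]=\{1,\ldots,m\}$; $\mathbf{p}=(p_1,\ldots,p_m)$, $\mathbf{q}=(q_1,\ldots,q_m)$ are indeterminates and $-\mathbf{q}=(-q_1,\ldots,-q_m)$. Normalized characters. For partitions $\omega,\lambda$ of $n$, $\chi_\omega(\lambda)$ is the value of the irreducible character of the symmetric group $\mathfrak{S}_n$ indexed by $\omega$ on the conjugacy class of cycle type $\lambda$. For a partition $\mu$ of $k\le n$, $\widehat{\chi}_\omega(\mu\,1^{n-k})=n(n-1)\cdots(n-k+1)\,\dfrac{\chi_\omega(\mu\,1^{n-k})}{\chi_\omega(1^n)}$. Stanley's character polynomials. For positive integers $p_1,\ldots,p_m$ and $q_1\ge q_2\ge\cdots\ge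 q_m$, $\mathbf{p}\times\mathbf{q}$ denotes the partition of $n=\sum_i p_iq_i$ with $p_i$ parts of size $q_i$, $i=1,\ldots,m$. For $k\ge1$, $F_k(\mathbf{p};\mathbf{q})$ is the (known to exist) polynomial in the indeterminates $p_1,\ldots,p_m,q_1,\ldots,q_m$ whose value at every shape $\mathbf{p}\times\mathbf{q}$ that is a partition of some $n\ge k$ is $\widehat{\chi}_{\mathbf{p}\times\mathbf{q}}(k\,1^{n-k})$. For $k\ge 1$, $G_k(\mathbf{p};\mathbf{q})$ is the sum of the terms of highest total degree in $F_k(\mathbf{p};\mathbf{q})$ (this degree is $k+1$), and by convention $G_0(\mathbf{p};\mathbf{q})=p_1+\cdots+p_m$. Put $G_{\mathbf{p};\mathbf{q}}(x)=1+\sum_{k\ge0}G_k(\mathbf{p};\mathbf{q})x^{k+1}$. The series $G_{\mathbf{p};-\mathbf{q}}(-x)$ is obtained by replacing each $q_i$ by $-q_i$ and $x$ by $-x$. Coloured permutations. $\mathfrak{S}_k^{(m)}$ is the set of pairs $(\alpha,\psi)$ where $\alpha\in\mathfrak{S}_k$ and $\psi$ is a function from the set of cycles of $\alpha$ to $[m]$. For $(\alpha,\psi)\in\mathfrak{S}_k^{(m)}$ and $\beta\in\mathfrak{S}_k$, define $(\alpha,\psi)\circ\beta=(\gamma,\nu)\in\mathfrak{S}_k^{(m)}$ by $\gamma=\alpha\beta$ and, for each cycle $u$ of $\gamma$, $\nu(u)=\max\psi(w)$ over all cycles $w$ of $\alpha$ having an element in common with $u$. Let $\kappa_i^{(m)}(\alpha,\psi)$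 be the number of cycles of $\alpha$ coloured $i$, and $\mathbf{p}^{\kappa^{(m)}(\alpha,\psi)}=\prod_{i=1}^m p_i^{\kappa_i^{(m)}(\alpha,\psi)}$, and similarly for $\mathbf{q}$. Top factorizations. Let $\omega_k=(1\,2\,\cdots\,k)\in\mathfrak{S}_k$. Define $$\mathrm{TopFact}_{\mathbf{p};\mathbf{q}}(x)=\sum_{k\ge1}x^{k+1}\sum_{\substack{(\alpha,\psi)\in\mathfrak{S}_k^{(m)}\\ \kappa(\alpha)+\kappa(\alpha\omega_k)=k+1}}\mathbf{p}^{\kappa^{(m)}(\alpha,\psi)}\,\mathbf{q}^{\kappa^{(m)}((\alpha,\psi)\circ\omega_k)}.$$ *)

theory Defs
  imports
    Complex_Main
    "HOL-Library.Multiset"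
    "HOL-Library.FuncSet"
    "HOL-Library.Poly_Mapping"
    "HOL-Library.Function_Algebras"
    "HOL-Combinatorics.Permutations"
    "HOL-Combinatorics.Cycles"
    "HOL-Combinatorics.Orbits"
    "HOL-Computational_Algebra.Formal_Power_Series"
begin

section \<open>Cycles of permutations\<close>

text \<open>
  Permutations of a set \<open>A\<close> are functions that permute \<open>A\<close> and are the identity elsewhere;
  the product \<open>\<alpha>\<beta>\<close> is \<open>\<alpha> \<circ> \<beta>\<close>. A cycle of a given permutation is represented by its set of
  elements; a fixed point in \<open>A\<close> contributes a singleton.
\<close>

definition cycles_on :: "'a set \<Rightarrow> ('a \<Rightarrow> 'a) \<Rightarrow> 'a set set" where
  "cycles_on A \<alpha> = orbit \<alpha> ` A"

definition cycle_type_on :: "'a set \<Rightarrow> ('a \<Rightarrow> 'a) \<Rightarrow> nat multiset" where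
  "cycle_type_on A \<alpha> = image_mset card (mset_set (cycles_on A \<alpha>))"


section \<open>Irreducible characters of the symmetric groups\<close>

text \<open>
  The irreducible complex representation of the symmetric group on \<open>{1..n}\<close> indexed by a
  partition \<open>\<omega>\<close> of \<open>n\<close> (a weakly decreasing list of positive integers) is the left ideal of the
  group algebra generated by the Young symmetrizer of the tableau of shape \<open>\<omega>\<close> that is filled
  with \<open>1, \<dots>, n\<close> row by row. With this convention the partition with one part gives the
  trivial representation. Rows and columns are numbered from 0.
\<close>

definition tableau_entry :: "nat list \<Rightarrow> nat \<Rightarrow> nat \<Rightarrow> nat" where
  "tableau_entry \<omega> i j = sum_list (take i \<omega>) + j + 1"

definition tableau_row :: "nat list \<Rightarrow> nat \<Rightarrow> nat set" where
  "tableau_row \<omega> i = {tableau_entry \<omega> i j | j. i < length \<omega> \<and> j < \<omega> ! i}"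

definition tableau_column :: "nat list \<Rightarrow> nat \<Rightarrow> nat set" where
  "tableau_column \<omega> j = {tableau_entry \<omega> i j | i. i < length \<omega> \<and> j < \<omega> ! i}"

definition row_group :: "nat list \<Rightarrow> (nat \<Rightarrow> nat) set" where
  "row_group \<omega> = {g. g permutes {1..sum_list \<omega>} \<and> (\<forall>i. g ` tableau_row \<omega> i = tableau_row \<omega> i)}"

definition column_group :: "nat list \<Rightarrow> (nat \<Rightarrow> nat) set" where
  "column_group \<omega> =
     {g. g permutes {1..sum_list \<omega>} \<and> (\<forall>j. g ` tableau_column \<omega> j = tableau_column \<omega> j)}"

text \<open>
  An element \<open>\<Sum>g. f g \<cdot> g\<close> of the group algebra is represented by its coefficient function \<open>f\<close>,
  which vanishes on all functions that do not permute \<open>{1..n}\<close>.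
\<close>

definition young_symmetrizer :: "nat list \<Rightarrow> (nat \<Rightarrow> nat) \<Rightarrow> complex" where
  "young_symmetrizer \<omega> x =
     (\<Sum>(a, b) \<in> {(a, b) \<in> row_group \<omega> \<times> column_group \<omega>. a \<circ> b = x}. of_int (sign b))"

definition left_mult :: "(nat \<Rightarrow> nat) \<Rightarrow> ((nat \<Rightarrow> nat) \<Rightarrow> complex) \<Rightarrow> ((nat \<Rightarrow> nat) \<Rightarrow> complex)" where
  "left_mult g f = (\<lambda>x. f (inv g \<circ> x))"

global_interpretation cfun: vector_space "\<lambda>(c::complex) (f :: 'a \<Rightarrow> complex) x. c * f x"
  by unfold_locales (auto simp: fun_eq_iff algebra_simps)

definition specht_module :: "nat list \<Rightarrow> ((nat \<Rightarrow> nat) \<Rightarrow> complex) set" where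
  "specht_module \<omega> =
     cfun.span {left_mult g (young_symmetrizer \<omega>) | g. g permutes {1..sum_list \<omega>}}"

text \<open>
  The trace of a linear operator that maps the finite-dimensional subspace \<open>V\<close> to itself;
  the value does not depend on the basis chosen.
\<close>

definition trace_on :: "('a \<Rightarrow> complex) set \<Rightarrow> (('a \<Rightarrow> complex) \<Rightarrow> ('a \<Rightarrow> complex)) \<Rightarrow> complex" where
  "trace_on V T =
     (let B = (SOME B. \<not> cfun.dependent B \<and> cfun.span B = V)
      in \<Sum>b\<in>B. cfun.representation B (T b) b)"

text \<open>\<open>irr_char \<omega> \<rho>\<close> is \<open>\<chi>\<^sub>\<omega>(\<rho>)\<close>; the cycle type \<open>\<rho>\<close> is given as a multiset of parts.\<close>

definition irr_char :: "nat list \<Rightarrow> nat multiset \<Rightarrow> complex" where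
  "irr_char \<omega> \<rho> =
     trace_on (specht_module \<omega>)
       (left_mult (SOME g. g permutes {1..sum_list \<omega>} \<and> cycle_type_on {1..sum_list \<omega>} g = \<rho>))"

text \<open>\<open>norm_char \<omega> \<mu>\<close> is the normalized character at \<open>\<mu> 1\<^sup>n\<^sup>-\<^sup>k\<close>, for \<open>\<mu>\<close> a partition of \<open>k \<le> n\<close>.\<close>

definition norm_char :: "nat list \<Rightarrow> nat multiset \<Rightarrow> complex" where
  "norm_char \<omega> \<mu> =
     (let n = sum_list \<omega>; k = sum_mset \<mu>
      in (\<Prod>i<k. of_nat (n - i)) *
         (irr_char \<omega> (\<mu> + replicate_mset (n - k) 1) / irr_char \<omega> (replicate_mset n 1)))"


section \<open>Polynomials in the indeterminates \<open>p\<^sub>i\<close>, \<open>q\<^sub>i\<close>\<close>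

datatype indet = PVar nat | QVar nat

type_synonym pq_poly = "(indet \<Rightarrow>\<^sub>0 nat) \<Rightarrow>\<^sub>0 int"

definition var :: "indet \<Rightarrow> pq_poly" where
  "var v = Poly_Mapping.single (Poly_Mapping.single v 1) 1"

definition pq_polys :: "nat \<Rightarrow> pq_poly set" where
  "pq_polys m =
     {F. \<forall>t \<in> Poly_Mapping.keys F. Poly_Mapping.keys t \<subseteq> PVar ` {1..m} \<union> QVar ` {1..m}}"

definition subst :: "(indet \<Rightarrow> 'b::comm_ring_1) \<Rightarrow> pq_poly \<Rightarrow> 'b" where
  "subst f F =
     (\<Sum>t \<in> Poly_Mapping.keys F. of_int (Poly_Mapping.lookup F t) *
        (\<Prod>v \<in> Poly_Mapping.keys t. f v ^ Poly_Mapping.lookup t v))"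

definition eval_pq :: "(nat \<Rightarrow> nat) \<Rightarrow> (nat \<Rightarrow> nat) \<Rightarrow> pq_poly \<Rightarrow> complex" where
  "eval_pq p q = subst (\<lambda>v. case v of PVar i \<Rightarrow> of_nat (p i) | QVar i \<Rightarrow> of_nat (q i))"

text \<open>The substitution \<open>F(p; q) \<mapsto> F(p; -q)\<close>.\<close>

definition neg_q :: "pq_poly \<Rightarrow> pq_poly" where
  "neg_q = subst (\<lambda>v. case v of PVar i \<Rightarrow> var (PVar i) | QVar i \<Rightarrow> - var (QVar i))"

definition monom_degree :: "(indet \<Rightarrow>\<^sub>0 nat) \<Rightarrow> nat" where
  "monom_degree t = (\<Sum>v \<in> Poly_Mapping.keys t. Poly_Mapping.lookup t v)"

definition total_degree :: "pq_poly \<Rightarrow> nat" where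
  "total_degree F = Max (insert 0 (monom_degree ` Poly_Mapping.keys F))"

definition top_terms :: "pq_poly \<Rightarrow> pq_poly" where
  "top_terms F =
     (\<Sum>t \<in> {t \<in> Poly_Mapping.keys F. monom_degree t = total_degree F}.
        Poly_Mapping.single t (Poly_Mapping.lookup F t))"


section \<open>Stanley's character polynomials\<close>

definition shape :: "nat \<Rightarrow> (nat \<Rightarrow> nat) \<Rightarrow> (nat \<Rightarrow> nat) \<Rightarrow> nat list" where
  "shape m p q = concat (map (\<lambda>i. replicate (p i) (q i)) [1..<Suc m])"

definition is_stanley_poly :: "nat \<Rightarrow> nat \<Rightarrow> pq_poly \<Rightarrow> bool" where
  "is_stanley_poly m k F \<longleftrightarrow>
     F \<in> pq_polys m \<and>
     (\<forall>p q. (\<forall>i\<in>{1..m}. p i \<ge> 1 \<and> q i \<ge> 1) \<longrightarrow>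
            (\<forall>i\<in>{1..m}. \<forall>j\<in>{1..m}. i \<le> j \<longrightarrow> q j \<le> q i) \<longrightarrow>
            k \<le> (\<Sum>i=1..m. p i * q i) \<longrightarrow>
            eval_pq p q F = norm_char (shape m p q) {#k#})"

definition stanley_F :: "nat \<Rightarrow> nat \<Rightarrow> pq_poly" where
  "stanley_F m k = (THE F. is_stanley_poly m k F)"

definition stanley_G :: "nat \<Rightarrow> nat \<Rightarrow> pq_poly" where
  "stanley_G m k = (if k = 0 then \<Sum>i=1..m. var (PVar i) else top_terms (stanley_F m k))"

definition G_series :: "nat \<Rightarrow> pq_poly fps" where
  "G_series m = 1 + Abs_fps (\<lambda>j. if j = 0 then 0 else stanley_G m (j - 1))"

text \<open>The series obtained from \<open>G_series m\<close> by replacing each \<open>q\<^sub>i\<close> by \<open>-q\<^sub>i\<close> and \<open>x\<close> by \<open>-x\<close>.\<close>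

definition G_series_neg :: "nat \<Rightarrow> pq_poly fps" where
  "G_series_neg m = fps_compose (Abs_fps (\<lambda>j. neg_q (fps_nth (G_series m) j))) (- fps_X)"


section \<open>Coloured permutations and top factorizations\<close>

type_synonym coloured_perm = "(nat \<Rightarrow> nat) \<times> (nat set \<Rightarrow> nat)"

text \<open>Colourings are extensional functions, so that every coloured permutation occurs once.\<close>

definition coloured_perms :: "nat \<Rightarrow> nat \<Rightarrow> coloured_perm set" where
  "coloured_perms m k =
     {(\<alpha>, \<psi>). \<alpha> permutes {1..k} \<and> \<psi> \<in> cycles_on {1..k} \<alpha> \<rightarrow>\<^sub>E {1..m}}"

definition coloured_mult :: "nat \<Rightarrow> coloured_perm \<Rightarrow> (nat \<Rightarrow> nat) \<Rightarrow> coloured_perm" where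
  "coloured_mult k = (\<lambda>(\<alpha>, \<psi>) \<beta>.
     (\<alpha> \<circ> \<beta>,
      \<lambda>u \<in> cycles_on {1..k} (\<alpha> \<circ> \<beta>). Max (\<psi> ` {w \<in> cycles_on {1..k} \<alpha>. w \<inter> u \<noteq> {}})))"

definition colour_count :: "nat \<Rightarrow> coloured_perm \<Rightarrow> nat \<Rightarrow> nat" where
  "colour_count k = (\<lambda>(\<alpha>, \<psi>) i. card {w \<in> cycles_on {1..k} \<alpha>. \<psi> w = i})"

definition colour_monom :: "nat \<Rightarrow> nat \<Rightarrow> (nat \<Rightarrow> indet) \<Rightarrow> coloured_perm \<Rightarrow> pq_poly" where
  "colour_monom m k V c = (\<Prod>i=1..m. var (V i) ^ colour_count k c i)"

text \<open>The permutation \<open>(1 2 \<dots> k)\<close>.\<close>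

definition long_cycle :: "nat \<Rightarrow> nat \<Rightarrow> nat" where
  "long_cycle k = cycle_of_list [1..<Suc k]"

definition top_fact_coeff :: "nat \<Rightarrow> nat \<Rightarrow> pq_poly" where
  "top_fact_coeff m k =
     (\<Sum>c \<in> {(\<alpha>, \<psi>) \<in> coloured_perms m k.
              card (cycles_on {1..k} \<alpha>) + card (cycles_on {1..k} (\<alpha> \<circ> long_cycle k)) = k + 1}.
        colour_monom m k PVar c * colour_monom m k QVar (coloured_mult k c (long_cycle k)))"

definition TopFact :: "nat \<Rightarrow> pq_poly fps" where
  "TopFact m = Abs_fps (\<lambda>j. if j \<ge> 2 then top_fact_coeff m (j - 1) else 0)"

end

theory Submission
  imports Defs "HOL-Computational_Algebra.Polynomial"
begin

text \<open>
  Let \<open>c\<close> be the Young symmetrizer. Since \<open>c\<^sup>2\<close> is a multiple of \<open>c\<close>, the ratio \<open>\<chi>(\<pi>)/\<chi>(1)\<close>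
  is the average of \<open>c(g\<inverse> \<pi>\<inverse> g)\<close> over all \<open>g\<close>. Expanding \<open>c\<close> into products of row and column
  permutations gives, following Feray and Sniady, a signed sum over \<open>\<alpha> \<in> S\<^sub>k\<close> of the number of maps from
  \<open>{1..k}\<close> to the boxes of the diagram whose row is constant on the cycles of \<open>\<alpha>\<close> and whose column is
  constant on those of \<open>\<alpha> (1 2 \<dots> k)\<close>. For the shape \<open>p \<times> q\<close> a cycle of \<open>\<alpha>\<close> chooses a block \<open>i\<close> and one of
  its \<open>p\<^sub>i\<close> rows, and a cycle of \<open>\<alpha> (1 2 \<dots> k)\<close> chooses one of \<open>q\<^sub>j\<close> columns, \<open>j\<close> being the largest block
  it meets; so these numbers are the evaluations of coloured monomials. The sign of a permutation with
  \<open>l\<close> cycles is \<open>(-1)\<^bsup>k-l\<^esup>\<close>, so after the substitution \<open>q \<mapsto> -q\<close> all coefficients have the same sign and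
  nothing cancels; the monomials of top degree are those with \<open>k + 1\<close> cycles in total.
\<close>

section \<open>Young symmetrizers\<close>

text \<open>Four obstacles shape the proof. The trace uses a basis and a permutation that are both
  chosen by \<open>SOME\<close>; only the defining property of each choice is available, and the
  permutation has to be conjugated to the long cycle. The scalar in the relation between
  \<open>c\<^sup>2\<close> and \<open>c\<close> is never computed: it multiplies the trace at
  \<open>\<pi>\<close> and the trace at the identity alike and drops out of their quotient, and the
  identity, where the sum is n!, shows that it is nonzero. Restricting permutations of the diagram
  to \<open>{1..k}\<close> gives injective maps, whose number does not factor over cycles; the
  signed contribution of every non-injective map is zero, by a sign-reversing involution, so that
  all maps may be counted. Finally \<open>stanley_F\<close> is a definite description, so the
  polynomial found must also be the only one with the prescribed values, although these are given
  only for positive arguments with weakly decreasing q. That the top degree is k + 1 rests on two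
  facts: the long cycle is transitive, which bounds the number of cycles, and the identity
  permutation attains the bound.\<close>

lemma permutes_inv_comp_left [simp]: "g permutes A \<Longrightarrow> inv g (g x) = x"
  and permutes_inv_comp_right [simp]: "g permutes A \<Longrightarrow> g (inv g x) = x"
  by (simp_all add: permutes_inverses)

lemma permutes_comp_iff_left:
  assumes "g permutes A"
  shows "g \<circ> x permutes A \<longleftrightarrow> x permutes A"
proof
  assume "g \<circ> x permutes A"
  then have "inv g \<circ> (g \<circ> x) permutes A"
    using assms by (metis permutes_compose permutes_inv)
  moreover have "inv g \<circ> (g \<circ> x) = x"
    using assms by (auto simp: fun_eq_iff)
  ultimately show "x permutes A" by (simp only:)
qed (use assms permutes_compose in blast)

lemma permutes_inv_of_comp:
  "f permutes A \<Longrightarrow> g permutes A \<Longrightarrow> inv (f \<circ> g) = inv g \<circ> inv f"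
  by (rule o_inv_distrib) (auto intro: permutes_bij)

text \<open>The maximum of a set of \<open>n + 1\<close> numbers is at least \<open>n\<close>;
  removing it gives the bound by induction, and equality forces the maximum to be exactly
  \<open>n\<close> at every stage.\<close>

lemma sum_lessThan_card_le:
  fixes S :: "nat set"
  assumes "finite S"
  shows "(\<Sum>i<card S. i) \<le> \<Sum>S \<and> (\<Sum>S = (\<Sum>i<card S. i) \<longrightarrow> S = {..<card S})"
  using assms
proof (induction "card S" arbitrary: S)
  case 0
  then show ?case by simp
next
  case (Suc n)
  define x where "x = Max S"
  have ne: "S \<noteq> {}" using Suc.hyps(2) by auto
  have x: "x \<in> S" "\<forall>y\<in>S. y \<le> x"
    unfolding x_def using ne Suc.prems by auto
  have c: "card (S - {x}) = n"
    using Suc.hyps(2) x(1) Suc.prems by simp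
  have IH: "(\<Sum>i<n. i) \<le> \<Sum>(S - {x}) \<and> (\<Sum>(S - {x}) = (\<Sum>i<n. i) \<longrightarrow> S - {x} = {..<n})"
    using Suc.hyps(1)[of "S - {x}"] c Suc.prems by auto
  have sm: "\<Sum>S = x + \<Sum>(S - {x})"
    using x(1) Suc.prems by (simp add: sum.remove)
  have "S \<subseteq> {..x}" using x by auto
  then have "card S \<le> Suc x" by (metis card_atMost card_mono finite_atMost)
  then have nx: "n \<le> x" using Suc.hyps(2) by simp
  have l: "(\<Sum>i<Suc n. i) = n + (\<Sum>i<n. i)" by simp
  have "S = {..<Suc n}" if "\<Sum>S = (\<Sum>i<Suc n. i)"
  proof -
    have "x = n" "\<Sum>(S - {x}) = (\<Sum>i<n. i)"
      using that l sm nx IH by linarith+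
    then have "S - {n} = {..<n}" "n \<in> S" using IH x by auto
    then have "S = insert n {..<n}" by blast
    then show ?thesis by auto
  qed
  then show ?case using Suc.hyps(2)[symmetric] l sm nx IH by auto
qed

text \<open>
  A filling of a Young diagram is encoded by the row and column numbers of the elements of \<open>A\<close>.
\<close>

locale young_filling =
  fixes A :: "'a set" and r c :: "'a \<Rightarrow> nat"
  assumes fin: "finite A"
    and inj: "\<And>x y. x \<in> A \<Longrightarrow> y \<in> A \<Longrightarrow> r x = r y \<Longrightarrow> c x = c y \<Longrightarrow> x = y"
    and diagram: "\<And>x i j. x \<in> A \<Longrightarrow> i \<le> r x \<Longrightarrow> j \<le> c x \<Longrightarrow> \<exists>y\<in>A. r y = i \<and> c y = j"
begin

definition row_perms :: "('a \<Rightarrow> 'a) set" where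
  "row_perms = {g. g permutes A \<and> (\<forall>x. r (g x) = r x)}"

definition col_perms :: "('a \<Rightarrow> 'a) set" where
  "col_perms = {g. g permutes A \<and> (\<forall>x. c (g x) = c x)}"

definition symmetrizer :: "('a \<Rightarrow> 'a) \<Rightarrow> complex" where
  "symmetrizer x =
     (\<Sum>(a, b) \<in> {(a, b) \<in> row_perms \<times> col_perms. a \<circ> b = x}. of_int (sign b))"

lemma row_permsD: "a \<in> row_perms \<Longrightarrow> a permutes A" "a \<in> row_perms \<Longrightarrow> r (a x) = r x"
  by (auto simp: row_perms_def)

lemma col_permsD: "a \<in> col_perms \<Longrightarrow> a permutes A" "a \<in> col_perms \<Longrightarrow> c (a x) = c x"
  by (auto simp: col_perms_def)

lemma row_perms_comp: "a \<in> row_perms \<Longrightarrow> a' \<in> row_perms \<Longrightarrow> a \<circ> a' \<in> row_perms"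
  by (auto simp: row_perms_def permutes_compose)

lemma col_perms_comp: "a \<in> col_perms \<Longrightarrow> a' \<in> col_perms \<Longrightarrow> a \<circ> a' \<in> col_perms"
  by (auto simp: col_perms_def permutes_compose)

lemma row_perms_inv:
  assumes "a \<in> row_perms" shows "inv a \<in> row_perms"
proof -
  have "r (inv a x) = r x" for x
    using row_permsD(2)[OF assms, of "inv a x"] row_permsD(1)[OF assms] by simp
  then show ?thesis using row_permsD(1)[OF assms] by (auto simp: row_perms_def permutes_inv)
qed

lemma col_perms_inv:
  assumes "a \<in> col_perms" shows "inv a \<in> col_perms"
proof -
  have "c (inv a x) = c x" for x
    using col_permsD(2)[OF assms, of "inv a x"] col_permsD(1)[OF assms] by simp
  then show ?thesis using col_permsD(1)[OF assms] by (auto simp: col_perms_def permutes_inv)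
qed

lemma id_row_perms: "id \<in> row_perms" and id_col_perms: "id \<in> col_perms"
  by (auto simp: row_perms_def col_perms_def permutes_id)

lemma row_col_perms_disjoint:
  assumes "a \<in> row_perms" "a \<in> col_perms" shows "a = id"
proof
  fix x
  show "a x = id x"
  proof (cases "x \<in> A")
    case True
    then have "a x \<in> A" using row_permsD(1)[OF assms(1)] by (simp add: permutes_in_image)
    then show ?thesis using inj[of "a x" x] True row_permsD(2)[OF assms(1)] col_permsD(2)[OF assms(2)] by simp
  next
    case False
    then show ?thesis using row_permsD(1)[OF assms(1)] by (simp add: permutes_not_in)
  qed
qed

text \<open>The permutation \<open>inv a' \<circ> a = b' \<circ> inv b\<close> lies in both groups,
  which meet only in the identity. Hence the sum that defines \<open>symmetrizer\<close> never has
  more than one term.\<close>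

lemma row_col_decomposition_unique:
  assumes "a \<in> row_perms" "b \<in> col_perms" "a' \<in> row_perms" "b' \<in> col_perms" "a \<circ> b = a' \<circ> b'"
  shows "a = a' \<and> b = b'"
proof -
  note P = row_permsD(1)[OF assms(1)] row_permsD(1)[OF assms(3)] col_permsD(1)[OF assms(2)] col_permsD(1)[OF assms(4)]
  have "a (b x) = a' (b' x)" for x using assms(5) by (simp add: fun_eq_iff)
  then have ab: "inv a' (a x) = b' (inv b x)" for x
    using P by (metis permutes_inv_comp_left permutes_inv_comp_right)
  have "inv a' \<circ> a = id"
  proof (rule row_col_perms_disjoint)
    show "inv a' \<circ> a \<in> row_perms" using assms by (intro row_perms_comp row_perms_inv)
    have "inv a' \<circ> a = b' \<circ> inv b" using ab by auto
    then show "inv a' \<circ> a \<in> col_perms" using assms by (auto intro: col_perms_comp col_perms_inv)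
  qed
  then have "inv a' (a x) = x" for x by (simp add: fun_eq_iff)
  then have a: "a x = a' x" for x using P by (metis permutes_inv_comp_right)
  then have "b x = b' x" for x
    using \<open>\<And>x. a (b x) = a' (b' x)\<close> P by (metis permutes_inv_comp_left)
  then show ?thesis using a by auto
qed

lemma symmetrizer_row_col:
  assumes "a \<in> row_perms" "b \<in> col_perms"
  shows "symmetrizer (a \<circ> b) = of_int (sign b)"
proof -
  have "{(a', b') \<in> row_perms \<times> col_perms. a' \<circ> b' = a \<circ> b} = {(a, b)}"
    using row_col_decomposition_unique assms by fastforce
  then show ?thesis by (simp add: symmetrizer_def)
qed

lemma symmetrizer_eq_0:
  assumes "\<And>a b. a \<in> row_perms \<Longrightarrow> b \<in> col_perms \<Longrightarrow> x \<noteq> a \<circ> b"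
  shows "symmetrizer x = 0"
proof -
  have "{(a', b') \<in> row_perms \<times> col_perms. a' \<circ> b' = x} = {}"
    using assms by blast
  then show ?thesis unfolding symmetrizer_def by (simp only: sum.empty)
qed

lemma symmetrizer_id: "symmetrizer id = 1"
  using symmetrizer_row_col[OF id_row_perms id_col_perms] by simp

lemma permutation_col_perms: "b \<in> col_perms \<Longrightarrow> permutation b"
  using col_permsD(1) fin permutation_permutes by blast

lemma symmetrizer_row_invariant:
  assumes "a \<in> row_perms"
  shows "symmetrizer (a \<circ> x) = symmetrizer x"
proof (cases "\<exists>a'\<in>row_perms. \<exists>b\<in>col_perms. x = a' \<circ> b")
  case True
  then obtain a' b where ab: "a' \<in> row_perms" "b \<in> col_perms" "x = a' \<circ> b" by blast
  then have "a \<circ> x = (a \<circ> a') \<circ> b" by auto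
  then show ?thesis using symmetrizer_row_col row_perms_comp ab assms by metis
next
  case False
  have "a \<circ> x \<noteq> a' \<circ> b" if "a' \<in> row_perms" "b \<in> col_perms" for a' b
  proof
    assume "a \<circ> x = a' \<circ> b"
    then have "inv a \<circ> (a \<circ> x) = (inv a \<circ> a') \<circ> b" by auto
    then have "x = (inv a \<circ> a') \<circ> b" using row_permsD(1)[OF assms] by (simp add: fun_eq_iff)
    then show False using False that row_perms_comp row_perms_inv assms by blast
  qed
  then show ?thesis using False symmetrizer_eq_0 by metis
qed

lemma symmetrizer_col_sign:
  assumes "b \<in> col_perms"
  shows "symmetrizer (x \<circ> b) = of_int (sign b) * symmetrizer x"
proof (cases "\<exists>a\<in>row_perms. \<exists>b'\<in>col_perms. x = a \<circ> b'")
  case True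
  then obtain a b' where ab: "a \<in> row_perms" "b' \<in> col_perms" "x = a \<circ> b'" by blast
  then have "x \<circ> b = a \<circ> (b' \<circ> b)" by auto
  then have "symmetrizer (x \<circ> b) = of_int (sign (b' \<circ> b))"
    using symmetrizer_row_col col_perms_comp ab assms by metis
  then show ?thesis using ab assms
    by (simp add: sign_compose permutation_col_perms symmetrizer_row_col)
next
  case False
  have "x \<circ> b \<noteq> a \<circ> b'" if "a \<in> row_perms" "b' \<in> col_perms" for a b'
  proof
    assume "x \<circ> b = a \<circ> b'"
    then have "(x \<circ> b) \<circ> inv b = a \<circ> (b' \<circ> inv b)" by auto
    then have "x = a \<circ> (b' \<circ> inv b)" using col_permsD(1)[OF assms] by (simp add: fun_eq_iff)
    then show False using False that col_perms_comp col_perms_inv assms by blast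
  qed
  then show ?thesis using False symmetrizer_eq_0 by (metis mult_zero_right)
qed

text \<open>
  Among the sets of row numbers of given size, the one that a column of the diagram occupies has the
  smallest sum. The rows of the elements that \<open>g\<close> sends to a given column form a set of the same
  size, and summed over all columns both give the sum of \<open>r\<close> over \<open>A\<close>; hence they are equal.
\<close>

lemma exists_box_of_row_and_image_col:
  assumes g: "g permutes A"
    and inj': "\<And>x y. x \<in> A \<Longrightarrow> y \<in> A \<Longrightarrow> r x = r y \<Longrightarrow> c (g x) = c (g y) \<Longrightarrow> x = y"
    and x: "x \<in> A"
  shows "\<exists>y\<in>A. r y = r x \<and> c y = c (g x)"
proof -
  define S where "S j = r ` {x \<in> A. c x = j}" for j
  define S' where "S' j = r ` {x \<in> A. c (g x) = j}" for j
  have injS: "inj_on r {x \<in> A. c x = j}" for j using inj by (auto simp: inj_on_def)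
  have injS': "inj_on r {x \<in> A. c (g x) = j}" for j using inj' by (auto simp: inj_on_def)
  have gA: "g y \<in> A \<longleftrightarrow> y \<in> A" for y using g by (simp add: permutes_in_image)
  have "bij_betw g {x \<in> A. c (g x) = j} {x \<in> A. c x = j}" for j
  proof (rule bij_betw_byWitness[where f' = "inv g"])
    show "inv g ` {x \<in> A. c x = j} \<subseteq> {x \<in> A. c (g x) = j}"
      using permutes_in_image[OF permutes_inv[OF g]] g by auto
  qed (use g gA in auto)
  then have cards: "card (S' j) = card (S j)" for j
    unfolding S_def S'_def card_image[OF injS] card_image[OF injS'] by (rule bij_betw_same_card)
  have finS: "finite (S j)" "finite (S' j)" for j using fin by (auto simp: S_def S'_def)
  \<comment> \<open>Columns of a diagram have no gaps, so the rows that a column occupies form an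
    initial segment, the unique minimiser in \<open>sum_lessThan_card_le\<close>.\<close>
  have S: "S j = {..<card (S j)}" for j
  proof -
    have "i \<in> S j" if ii: "i' \<in> S j" "i \<le> i'" for i i'
    proof -
      obtain y where y: "y \<in> A" "c y = j" "r y = i'" using ii(1) by (auto simp: S_def)
      obtain z where "z \<in> A" "r z = i" "c z = j" using diagram[of y i j] y ii(2) by auto
      then show ?thesis by (auto simp: S_def)
    qed
    then have dc: "\<forall>i\<in>S j. {..i} \<subseteq> S j" by (meson atMost_iff subsetI)
    have "S j \<subseteq> {..<card (S j)}"
    proof
      fix i assume "i \<in> S j"
      then have "card {..i} \<le> card (S j)" using dc finS by (intro card_mono) auto
      then show "i \<in> {..<card (S j)}" by simp
    qed
    then show ?thesis by (intro card_subset_eq) auto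
  qed
  define J where "J = c ` A"
  have finJ: "finite J" using fin by (simp add: J_def)
  have gJ: "(\<lambda>x. c (g x)) ` A \<subseteq> J" using gA by (auto simp: J_def)
  have 1: "(\<Sum>x\<in>A. r x) = (\<Sum>j\<in>J. \<Sum>(S j))"
  proof -
    have "(\<Sum>x\<in>A. r x) = (\<Sum>j\<in>J. \<Sum>x\<in>{x \<in> A. c x = j}. r x)"
      by (rule sum.group[OF fin finJ, symmetric]) (simp add: J_def)
    then show ?thesis using injS by (simp add: S_def sum.reindex)
  qed
  have 2: "(\<Sum>x\<in>A. r x) = (\<Sum>j\<in>J. \<Sum>(S' j))"
  proof -
    have "(\<Sum>x\<in>A. r x) = (\<Sum>j\<in>J. \<Sum>x\<in>{x \<in> A. c (g x) = j}. r x)"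
      by (rule sum.group[OF fin finJ gJ, symmetric])
    then show ?thesis using injS' by (simp add: S'_def sum.reindex)
  qed
  have le: "\<Sum>(S j) \<le> \<Sum>(S' j)" for j
    using sum_lessThan_card_le[OF finS(2)[of j]] cards[of j] S[of j] by simp
  have "\<Sum>(S j) = \<Sum>(S' j)" if "j \<in> J" for j
  proof (rule ccontr)
    assume "\<Sum>(S j) \<noteq> \<Sum>(S' j)"
    then have "\<Sum>(S j) < \<Sum>(S' j)" using le[of j] by simp
    then have "(\<Sum>j\<in>J. \<Sum>(S j)) < (\<Sum>j\<in>J. \<Sum>(S' j))"
      using le that finJ by (intro sum_strict_mono_ex1) blast+
    then show False using 1 2 by simp
  qed
  moreover have "c (g x) \<in> J" using gJ x by auto
  ultimately have "S' (c (g x)) = S (c (g x))"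
    using sum_lessThan_card_le[OF finS(2)] cards S by metis
  moreover have "r x \<in> S' (c (g x))" using x by (auto simp: S'_def)
  ultimately show ?thesis by (auto simp: S_def)
qed

text \<open>The combinatorial core of the theory of Young symmetrizers: either \<open>x\<close> is a
  product of a row and a column permutation, or two entries of one row come from one column, which
  will supply a pair of transpositions that forces invariants to vanish at \<open>x\<close>.\<close>

lemma young_dichotomy:
  assumes x: "x permutes A"
  shows "(\<exists>a\<in>row_perms. \<exists>b\<in>col_perms. x = a \<circ> b) \<or>
    (\<exists>y\<in>A. \<exists>z\<in>A. y \<noteq> z \<and> r y = r z \<and> c (inv x y) = c (inv x z))"
proof (rule disjCI)
  assume "\<not> (\<exists>y\<in>A. \<exists>z\<in>A. y \<noteq> z \<and> r y = r z \<and> c (inv x y) = c (inv x z))"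
  then have inj': "y = z" if "y \<in> A" "z \<in> A" "r y = r z" "c (inv x y) = c (inv x z)" for y z
    using that by blast
  have ix: "inv x permutes A" using x by (rule permutes_inv)
  \<comment> \<open>\<open>t\<close> moves \<open>y\<close> within its row to the box in the column
    of \<open>inv x y\<close>. Then \<open>t\<close> preserves rows, \<open>t \<circ> x\<close>
    preserves columns, and \<open>x = inv t \<circ> (t \<circ> x)\<close> is the decomposition
    sought.\<close>
  define t where "t y = (if y \<in> A then SOME z. z \<in> A \<and> r z = r y \<and> c z = c (inv x y) else y)" for y
  have t: "t y \<in> A" "r (t y) = r y" "c (t y) = c (inv x y)" if y: "y \<in> A" for y
  proof -
    have "\<exists>z\<in>A. r z = r y \<and> c z = c (inv x y)"
      by (rule exists_box_of_row_and_image_col[OF ix _ y]) (rule inj')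
    then have "\<exists>z. z \<in> A \<and> r z = r y \<and> c z = c (inv x y)" by blast
    from someI_ex[OF this] show "t y \<in> A" "r (t y) = r y" "c (t y) = c (inv x y)"
      using y by (simp_all add: t_def)
  qed
  have "inj_on t A"
  proof (rule inj_onI)
    fix y z assume yz: "y \<in> A" "z \<in> A" "t y = t z"
    show "y = z"
    proof (rule inj'[OF yz(1,2)])
      show "r y = r z" using t(2)[OF yz(1)] t(2)[OF yz(2)] yz(3) by simp
      show "c (inv x y) = c (inv x z)" using t(3)[OF yz(1)] t(3)[OF yz(2)] yz(3) by simp
    qed
  qed
  moreover have "t ` A \<subseteq> A" using t(1) by blast
  ultimately have "bij_betw t A A"
    using fin endo_inj_surj unfolding bij_betw_def by blast
  moreover have t_out: "t y = y" if "y \<notin> A" for y using that by (simp add: t_def)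
  ultimately have tp: "t permutes A"
    by (intro bij_imp_permutes)
  have "r (t y) = r y" for y using t(2) t_out by (cases "y \<in> A") simp_all
  with tp have tr: "t \<in> row_perms" by (simp add: row_perms_def)
  have "t \<circ> x \<in> col_perms"
  proof -
    have "c (t (x y)) = c y" for y
    proof (cases "y \<in> A")
      case True
      then have "x y \<in> A" using x by (simp add: permutes_in_image)
      then show ?thesis using t(3) x by simp
    next
      case False
      then show ?thesis using x by (simp add: t_out permutes_not_in)
    qed
    then show ?thesis using tp x by (auto simp: col_perms_def permutes_compose)
  qed
  moreover have "x = inv t \<circ> (t \<circ> x)" using tp by (auto simp: fun_eq_iff)
  ultimately show "\<exists>a\<in>row_perms. \<exists>b\<in>col_perms. x = a \<circ> b"
    using row_perms_inv[OF tr] by blast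
qed

lemma transpose_row_perms: "y \<in> A \<Longrightarrow> z \<in> A \<Longrightarrow> r y = r z \<Longrightarrow> Transposition.transpose y z \<in> row_perms"
  by (auto simp: row_perms_def permutes_swap_id Transposition.transpose_def)

lemma transpose_col_perms: "y \<in> A \<Longrightarrow> z \<in> A \<Longrightarrow> c y = c z \<Longrightarrow> Transposition.transpose y z \<in> col_perms"
  by (auto simp: col_perms_def permutes_swap_id Transposition.transpose_def)

text \<open>On products \<open>a \<circ> b\<close> the two symmetries determine \<open>f\<close>
  from \<open>f id\<close>. At every other \<open>x\<close> a row transposition on the left equals a
  column transposition on the right, so \<open>f x = - f x\<close>.\<close>

lemma von_neumann:
  assumes row: "\<And>a x. a \<in> row_perms \<Longrightarrow> f (a \<circ> x) = f x"
    and col: "\<And>b x. b \<in> col_perms \<Longrightarrow> f (x \<circ> b) = of_int (sign b) * f x"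
    and x: "x permutes A"
  shows "f x = (f id :: complex) * symmetrizer x"
  using young_dichotomy[OF x]
proof
  assume "\<exists>a\<in>row_perms. \<exists>b\<in>col_perms. x = a \<circ> b"
  then obtain a b where ab: "a \<in> row_perms" "b \<in> col_perms" "x = a \<circ> b" by blast
  have "f x = f (id \<circ> b)" using row[OF ab(1), of b] ab(3) by simp
  also have "\<dots> = of_int (sign b) * f id" using col[OF ab(2), of id] .
  finally show ?thesis using ab by (simp add: symmetrizer_row_col)
next
  assume "\<exists>y\<in>A. \<exists>z\<in>A. y \<noteq> z \<and> r y = r z \<and> c (inv x y) = c (inv x z)"
  then obtain y z where yz: "y \<in> A" "z \<in> A" "y \<noteq> z" "r y = r z" "c (inv x y) = c (inv x z)"
    by blast
  let ?t = "Transposition.transpose y z" and ?s = "Transposition.transpose (inv x y) (inv x z)"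
  have inA: "inv x y \<in> A" "inv x z \<in> A"
    using yz permutes_in_image[OF permutes_inv[OF x]] by auto
  have ne: "inv x y \<noteq> inv x z" using yz(3) x by (metis permutes_inv_comp_right)
  have t: "?t \<in> row_perms" using yz by (intro transpose_row_perms)
  have s: "?s \<in> col_perms" using yz inA by (intro transpose_col_perms)
  have tx: "?t \<circ> x = x \<circ> ?s"
    using x by (auto simp: fun_eq_iff Transposition.transpose_def)
  have vanish: "h x = 0" if "h (?t \<circ> x) = h x" "h (x \<circ> ?s) = of_int (sign ?s) * h x" for h :: "_ \<Rightarrow> complex"
    using that ne unfolding tx by (simp add: sign_swap_id)
  have "f x = 0" using row[OF t] col[OF s] by (rule vanish)
  moreover have "symmetrizer x = 0"
    using symmetrizer_row_invariant[OF t] symmetrizer_col_sign[OF s] by (rule vanish)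
  ultimately show ?thesis by simp
qed

text \<open>The convolution square inherits row invariance from its left factor and the column sign
  from its right factor, so \<open>von_neumann\<close> makes it a multiple of the symmetrizer, the
  scalar being its value at \<open>id\<close>.\<close>

lemma symmetrizer_conv:
  assumes x: "x permutes A"
  shows "(\<Sum>g | g permutes A. symmetrizer g * symmetrizer (inv g \<circ> x)) =
    (\<Sum>g | g permutes A. symmetrizer g * symmetrizer (inv g)) * symmetrizer x"
proof -
  define f where "f x = (\<Sum>g | g permutes A. symmetrizer g * symmetrizer (inv g \<circ> x))" for x
  have "f x = f id * symmetrizer x"
  proof (rule von_neumann[OF _ _ x])
    fix a x assume a: "a \<in> row_perms"
    have ap: "a permutes A" using row_permsD(1)[OF a] .
    have "f (a \<circ> x) = (\<Sum>g | g permutes A. symmetrizer (a \<circ> g) * symmetrizer (inv (a \<circ> g) \<circ> (a \<circ> x)))"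
      unfolding f_def by (rule setum_permutations_compose_left[OF ap])
    also have "\<dots> = f x"
      unfolding f_def
    proof (rule sum.cong[OF refl])
      fix g assume "g \<in> {g. g permutes A}"
      then have "inv (a \<circ> g) \<circ> (a \<circ> x) = inv g \<circ> x"
        using ap by (auto simp: permutes_inv_of_comp fun_eq_iff)
      then show "symmetrizer (a \<circ> g) * symmetrizer (inv (a \<circ> g) \<circ> (a \<circ> x)) =
          symmetrizer g * symmetrizer (inv g \<circ> x)"
        by (simp add: symmetrizer_row_invariant[OF a])
    qed
    finally show "f (a \<circ> x) = f x" .
  next
    fix b x assume "b \<in> col_perms"
    then show "f (x \<circ> b) = of_int (sign b) * f x"
      unfolding f_def comp_assoc[symmetric]
      by (simp add: symmetrizer_col_sign sum_distrib_left mult_ac)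
  qed
  then show ?thesis by (simp add: f_def)
qed

end

section \<open>The trace on a Specht module\<close>

lemma sum_fun_apply: "(\<Sum>s\<in>S. F s) x = (\<Sum>s\<in>S. F s x :: 'b :: comm_monoid_add)"
  by (induction S rule: infinite_finite_induct) auto

lemma left_mult_comp:
  assumes "g permutes A" "h permutes A"
  shows "left_mult g (left_mult h f) = left_mult (g \<circ> h) f"
  using assms by (simp add: left_mult_def permutes_inv_of_comp comp_assoc)

text \<open>
  The trace is read off the expansion of a basis \<open>B\<close> of \<open>V\<close> in the spanning family
  \<open>v\<^sub>g = left_mult g c\<close>: one has \<open>\<alpha> b = \<Sum>g. b(g) v\<^sub>g\<close> for \<open>b \<in> B\<close>, and
  \<open>\<Sum>b\<in>B. v\<^sub>h\<^sup>b b(g) = v\<^sub>h(g)\<close> for the coordinates \<open>v\<^sub>h\<^sup>b\<close> of \<open>v\<^sub>h\<close>.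
\<close>

lemma trace_on_left_ideal:
  fixes c :: "(nat \<Rightarrow> nat) \<Rightarrow> complex"
  assumes fin: "finite A"
    and supp: "\<And>x. \<not> x permutes A \<Longrightarrow> c x = 0"
    and idem: "\<And>x. x permutes A \<Longrightarrow> (\<Sum>g | g permutes A. c g * c (inv g \<circ> x)) = \<alpha> * c x"
    and V: "V = cfun.span {left_mult g c | g. g permutes A}"
    and \<pi>: "\<pi> permutes A"
  shows "\<alpha> * trace_on V (left_mult \<pi>) = (\<Sum>g | g permutes A. c (inv g \<circ> inv \<pi> \<circ> g))"
proof -
  let ?G = "{g. g permutes A}"
  have finG: "finite ?G" using fin by (rule finite_permutations)
  define v where "v g = left_mult g c" for g
  have Vv: "V = cfun.span (v ` ?G)"
    unfolding V v_def by (rule arg_cong[where f = cfun.span]) auto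
  \<comment> \<open>By linearity only the spanning vectors \<open>v h\<close> matter; for these the
    substitution \<open>g \<mapsto> h \<circ> g\<close> reduces the claim to
    \<open>idem\<close>.\<close>
  have expand: "(\<Sum>g\<in>?G. w g * v g x) = \<alpha> * w x" if "w \<in> V" for w x
    using that unfolding Vv
  proof (induction w arbitrary: x rule: cfun.span_induct_alt)
    case base
    then show ?case by simp
  next
    case (step s w y)
    then obtain h where h: "h permutes A" "w = v h" by auto
    have "(\<Sum>g\<in>?G. v h g * v g x) = \<alpha> * v h x"
    proof (cases "x permutes A")
      case True
      have "(\<Sum>g\<in>?G. v h g * v g x) = (\<Sum>g\<in>?G. v h (h \<circ> g) * v (h \<circ> g) x)"
        by (rule setum_permutations_compose_left[OF h(1)])
      also have "\<dots> = (\<Sum>g\<in>?G. c g * c (inv g \<circ> (inv h \<circ> x)))"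
      proof (rule sum.cong[OF refl])
        fix g assume "g \<in> ?G"
        then have "inv h \<circ> (h \<circ> g) = g" "inv (h \<circ> g) \<circ> x = inv g \<circ> (inv h \<circ> x)"
          using h(1) by (auto simp: permutes_inv_of_comp fun_eq_iff)
        then show "v h (h \<circ> g) * v (h \<circ> g) x = c g * c (inv g \<circ> (inv h \<circ> x))"
          by (simp only: v_def left_mult_def)
      qed
      also have "\<dots> = \<alpha> * c (inv h \<circ> x)"
        by (rule idem[OF permutes_compose[OF True permutes_inv[OF h(1)]]])
      finally show ?thesis by (simp add: v_def left_mult_def)
    next
      case False
      then have "v g x = 0" if "g permutes A" for g
        using supp permutes_comp_iff_left[OF permutes_inv[OF that], of x] by (simp add: v_def left_mult_def)
      then show ?thesis using h(1) by simp
    qed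
    then have "(\<Sum>g\<in>?G. (s * v h g + y g) * v g x) = s * (\<alpha> * v h x) + (\<Sum>g\<in>?G. y g * v g x)"
      by (simp add: distrib_right sum.distrib sum_distrib_left mult.assoc flip: \<open>(\<Sum>g\<in>?G. v h g * v g x) = \<alpha> * v h x\<close>)
    also have "\<dots> = \<alpha> * (s * v h x + y x)" using step.IH[of x] by (simp add: distrib_left mult.left_commute)
    finally show ?case by (simp add: h(2))
  qed
  \<comment> \<open>Until a basis is known to exist, nothing can be said about the
    \<open>SOME\<close> in \<open>trace_on\<close>.\<close>
  have "\<exists>B. \<not> cfun.dependent B \<and> cfun.span B = V"
  proof -
    obtain B where B: "B \<subseteq> V" "\<not> cfun.dependent B" "V \<subseteq> cfun.span B"
      by (rule cfun.maximal_independent_subset[of V])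
    have "cfun.subspace V" unfolding Vv by (rule cfun.subspace_span)
    then have "cfun.span B \<subseteq> V" using cfun.span_minimal[OF B(1)] by simp
    then show ?thesis using B by (intro exI[of _ B]) simp
  qed
  from someI_ex[OF this] obtain B where B: "\<not> cfun.dependent B" "cfun.span B = V"
    and B_def: "B = (SOME B. \<not> cfun.dependent B \<and> cfun.span B = V)"
    by blast
  have finB: "finite B"
  proof -
    have "B \<subseteq> cfun.span (v ` ?G)" using cfun.span_superset[of B] B(2) Vv by simp
    then show ?thesis using cfun.independent_span_bound[OF finite_imageI[OF finG] B(1)] by simp
  qed
  have vV: "v g \<in> V" if "g permutes A" for g
    unfolding Vv using that by (intro cfun.span_base) auto
  have lin: "(\<lambda>x. \<alpha> * left_mult \<pi> b x) = (\<Sum>g\<in>?G. (\<lambda>x. b g * v (\<pi> \<circ> g) x))" if "b \<in> V" for b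
  proof
    fix x
    have "\<alpha> * left_mult \<pi> b x = (\<Sum>g\<in>?G. b g * v g (inv \<pi> \<circ> x))"
      using expand[OF that] by (simp add: left_mult_def)
    also have "\<dots> = (\<Sum>g\<in>?G. b g * v (\<pi> \<circ> g) x)"
      using \<pi> by (intro sum.cong refl) (simp add: v_def left_mult_def permutes_inv_of_comp comp_assoc)
    finally show "\<alpha> * left_mult \<pi> b x = (\<Sum>g\<in>?G. (\<lambda>x. b g * v (\<pi> \<circ> g) x)) x"
      by (simp add: sum_fun_apply)
  qed
  have \<pi>V: "left_mult \<pi> b \<in> V" if "b \<in> V" for b
    using that unfolding Vv
  proof (induction b rule: cfun.span_induct_alt)
    case base
    have "left_mult \<pi> 0 = 0" by (auto simp: left_mult_def)
    then show ?case by (simp only: cfun.span_zero)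
  next
    case (step s w y)
    then obtain h where h: "h permutes A" "w = v h" by auto
    have "left_mult \<pi> ((\<lambda>x. s * w x) + y) = (\<lambda>x. s * v (\<pi> \<circ> h) x) + left_mult \<pi> y"
      using h \<pi> left_mult_comp[OF \<pi> h(1), of c] by (simp add: v_def left_mult_def fun_eq_iff)
    then show ?case using step.IH vV[of "\<pi> \<circ> h"] h(1) \<pi> Vv
      by (metis cfun.span_add cfun.span_scale permutes_compose)
  qed
  \<comment> \<open>\<open>\<alpha>\<close> stays a factor on the left: that it is nonzero is
    deduced only later, from this very identity at \<open>\<pi> = id\<close>.\<close>
  have "\<alpha> * trace_on V (left_mult \<pi>) = (\<Sum>b\<in>B. \<alpha> * cfun.representation B (left_mult \<pi> b) b)"
    unfolding trace_on_def B_def[symmetric] Let_def by (rule sum_distrib_left)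
  also have "\<dots> = (\<Sum>b\<in>B. \<Sum>g\<in>?G. b g * cfun.representation B (v (\<pi> \<circ> g)) b)"
  proof (rule sum.cong[OF refl])
    fix b assume "b \<in> B"
    then have b: "b \<in> V" using B(2) cfun.span_base by blast
    have inV: "v (\<pi> \<circ> g) \<in> cfun.span B" if "g \<in> ?G" for g
      using vV[of "\<pi> \<circ> g"] that \<pi> permutes_compose B(2) by blast
    have "\<alpha> * cfun.representation B (left_mult \<pi> b) b = cfun.representation B (\<lambda>x. \<alpha> * left_mult \<pi> b x) b"
      using cfun.representation_scale[OF B(1), of "left_mult \<pi> b" \<alpha>] \<pi>V[OF b] B(2) by (simp add: fun_eq_iff)
    also have "\<dots> = (\<Sum>g\<in>?G. cfun.representation B (\<lambda>x. b g * v (\<pi> \<circ> g) x) b)"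
      unfolding lin[OF b]
      using cfun.representation_sum[OF B(1), of ?G "\<lambda>g x. b g * v (\<pi> \<circ> g) x"] inV
      by (simp add: cfun.span_scale sum_fun_apply)
    also have "\<dots> = (\<Sum>g\<in>?G. b g * cfun.representation B (v (\<pi> \<circ> g)) b)"
      using cfun.representation_scale[OF B(1) inV] by (intro sum.cong refl) (simp add: fun_eq_iff)
    finally show "\<alpha> * cfun.representation B (left_mult \<pi> b) b = (\<Sum>g\<in>?G. b g * cfun.representation B (v (\<pi> \<circ> g)) b)" .
  qed
  also have "\<dots> = (\<Sum>g\<in>?G. \<Sum>b\<in>B. b g * cfun.representation B (v (\<pi> \<circ> g)) b)"
    by (rule sum.swap)
  also have "\<dots> = (\<Sum>g\<in>?G. v (\<pi> \<circ> g) g)"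
  proof (rule sum.cong[OF refl])
    fix g assume "g \<in> ?G"
    then have "v (\<pi> \<circ> g) \<in> cfun.span B"
      using vV[of "\<pi> \<circ> g"] \<pi> permutes_compose B(2) by blast
    then have "(\<Sum>b\<in>B. (\<lambda>x. cfun.representation B (v (\<pi> \<circ> g)) b * b x)) = v (\<pi> \<circ> g)"
      using cfun.sum_representation_eq[OF B(1) _ finB] by blast
    from fun_cong[OF this, of g]
    show "(\<Sum>b\<in>B. b g * cfun.representation B (v (\<pi> \<circ> g)) b) = v (\<pi> \<circ> g) g"
      by (simp add: sum_fun_apply mult.commute)
  qed
  also have "\<dots> = (\<Sum>g\<in>?G. c (inv g \<circ> inv \<pi> \<circ> g))"
    using \<pi> by (intro sum.cong refl) (simp add: v_def left_mult_def permutes_inv_of_comp)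
  finally show ?thesis .
qed

section \<open>The row-by-row tableau as a Young filling\<close>

lemma tableau_entry_surj:
  "(\<lambda>(i, j). tableau_entry \<omega> i j) ` (SIGMA i:{..<length \<omega>}. {..<\<omega> ! i}) = {1..sum_list \<omega>}"
proof (induction \<omega>)
  case Nil
  then show ?case by simp
next
  case (Cons a \<omega>)
  have e0: "tableau_entry (a # \<omega>) 0 j = Suc j" and eS: "tableau_entry (a # \<omega>) (Suc i) j = a + tableau_entry \<omega> i j" for i j
    by (simp_all add: tableau_entry_def)
  have D: "(SIGMA i:{..<length (a # \<omega>)}. {..<(a # \<omega>) ! i}) =
      (\<lambda>j. (0, j)) ` {..<a} \<union> (\<lambda>(i, j). (Suc i, j)) ` (SIGMA i:{..<length \<omega>}. {..<\<omega> ! i})"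
    (is "?L = ?R")
  proof (intro equalityI subsetI)
    fix z assume "z \<in> ?L"
    then show "z \<in> ?R" by (cases z; cases "fst z") (auto simp: image_iff)
  qed auto
  have "(\<lambda>(i, j). tableau_entry (a # \<omega>) i j) ` (SIGMA i:{..<length (a # \<omega>)}. {..<(a # \<omega>) ! i}) =
      Suc ` {..<a} \<union> (\<lambda>x. a + x) ` ((\<lambda>(i, j). tableau_entry \<omega> i j) ` (SIGMA i:{..<length \<omega>}. {..<\<omega> ! i}))"
    unfolding D by (simp add: image_Un image_image case_prod_unfold e0 eS)
  also have "\<dots> = {1..a} \<union> {a + 1..a + sum_list \<omega>}"
    unfolding Cons.IH by (simp add: image_Suc_lessThan add.commute)
  also have "\<dots> = {1..sum_list (a # \<omega>)}" by auto
  finally show ?case .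
qed

text \<open>Injectivity follows from surjectivity, since there are exactly
  \<open>sum_list \<omega>\<close> boxes.\<close>

lemma tableau_entry_bij:
  "bij_betw (\<lambda>(i, j). tableau_entry \<omega> i j) (SIGMA i:{..<length \<omega>}. {..<\<omega> ! i}) {1..sum_list \<omega>}"
proof -
  have "inj_on (\<lambda>(i, j). tableau_entry \<omega> i j) (SIGMA i:{..<length \<omega>}. {..<\<omega> ! i})"
    by (rule eq_card_imp_inj_on)
      (simp_all add: tableau_entry_surj card_SigmaI sum_list_sum_nth atLeast0LessThan)
  then show ?thesis using tableau_entry_surj by (simp add: bij_betw_def)
qed

text \<open>Inverts the row-by-row numbering. Outside \<open>{1..sum_list \<omega>}\<close> the
  value is unspecified, which is harmless because the permutations considered fix those
  points.\<close>

definition entry_row :: "nat list \<Rightarrow> nat \<Rightarrow> nat" where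
  "entry_row \<omega> x = fst (inv_into (SIGMA i:{..<length \<omega>}. {..<\<omega> ! i}) (\<lambda>(i, j). tableau_entry \<omega> i j) x)"

definition entry_col :: "nat list \<Rightarrow> nat \<Rightarrow> nat" where
  "entry_col \<omega> x = snd (inv_into (SIGMA i:{..<length \<omega>}. {..<\<omega> ! i}) (\<lambda>(i, j). tableau_entry \<omega> i j) x)"

lemma entry_row_col:
  assumes "i < length \<omega>" "j < \<omega> ! i"
  shows "entry_row \<omega> (tableau_entry \<omega> i j) = i" "entry_col \<omega> (tableau_entry \<omega> i j) = j"
    "tableau_entry \<omega> i j \<in> {1..sum_list \<omega>}"
proof -
  have D: "(i, j) \<in> (SIGMA i:{..<length \<omega>}. {..<\<omega> ! i})" using assms by simp
  show "entry_row \<omega> (tableau_entry \<omega> i j) = i" "entry_col \<omega> (tableau_entry \<omega> i j) = j"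
    using bij_betw_inv_into_left[OF tableau_entry_bij D] by (simp_all add: entry_row_def entry_col_def)
  show "tableau_entry \<omega> i j \<in> {1..sum_list \<omega>}"
    using bij_betwE[OF tableau_entry_bij] D by fastforce
qed

lemma entry_in_box:
  assumes "x \<in> {1..sum_list \<omega>}"
  shows "entry_row \<omega> x < length \<omega>" "entry_col \<omega> x < \<omega> ! entry_row \<omega> x"
    "tableau_entry \<omega> (entry_row \<omega> x) (entry_col \<omega> x) = x"
proof -
  obtain i j where "i < length \<omega>" "j < \<omega> ! i" "x = tableau_entry \<omega> i j"
    using assms unfolding tableau_entry_surj[symmetric] by auto
  then show "entry_row \<omega> x < length \<omega>" "entry_col \<omega> x < \<omega> ! entry_row \<omega> x"
    "tableau_entry \<omega> (entry_row \<omega> x) (entry_col \<omega> x) = x"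
    using entry_row_col by auto
qed

text \<open>Weakly decreasing row lengths make the set of boxes closed under lowering either
  coordinate.\<close>

lemma tableau_filling:
  assumes "sorted_wrt (\<ge>) \<omega>"
  shows "young_filling {1..sum_list \<omega>} (entry_row \<omega>) (entry_col \<omega>)"
proof
  fix x y assume "x \<in> {1..sum_list \<omega>}" "y \<in> {1..sum_list \<omega>}"
    "entry_row \<omega> x = entry_row \<omega> y" "entry_col \<omega> x = entry_col \<omega> y"
  then show "x = y" using entry_in_box(3) by metis
next
  fix x i j assume x: "x \<in> {1..sum_list \<omega>}" and ij: "i \<le> entry_row \<omega> x" "j \<le> entry_col \<omega> x"
  note b = entry_in_box[OF x]
  have "\<omega> ! entry_row \<omega> x \<le> \<omega> ! i"
    using assms ij b by (cases "i = entry_row \<omega> x") (auto simp: sorted_wrt_iff_nth_less)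
  then have "i < length \<omega>" "j < \<omega> ! i" using ij b by auto
  then show "\<exists>y\<in>{1..sum_list \<omega>}. entry_row \<omega> y = i \<and> entry_col \<omega> y = j"
    using entry_row_col by blast
qed simp

text \<open>Translates the setwise stabilisers in \<open>row_group\<close> and
  \<open>column_group\<close> into the pointwise conditions of \<open>row_perms\<close> and
  \<open>col_perms\<close>.\<close>

lemma image_fibre_eq_iff:
  assumes g: "g permutes A" and fin: "finite A"
  shows "(\<forall>i. g ` {x \<in> A. f x = i} = {x \<in> A. f x = i}) \<longleftrightarrow> (\<forall>x. f (g x) = f x)"
proof
  assume L: "\<forall>i. g ` {x \<in> A. f x = i} = {x \<in> A. f x = i}"
  show "\<forall>x. f (g x) = f x"
  proof
    fix x
    show "f (g x) = f x"
    proof (cases "x \<in> A")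
      case True
      then have "g x \<in> g ` {y \<in> A. f y = f x}" by blast
      then show ?thesis unfolding L[rule_format] by simp
    next
      case False
      then show ?thesis using g by (simp add: permutes_not_in)
    qed
  qed
next
  assume R: "\<forall>x. f (g x) = f x"
  show "\<forall>i. g ` {x \<in> A. f x = i} = {x \<in> A. f x = i}"
  proof (intro allI endo_inj_surj)
    fix i
    show "finite {x \<in> A. f x = i}" using fin by simp
    show "g ` {x \<in> A. f x = i} \<subseteq> {x \<in> A. f x = i}" using R g by (auto simp: permutes_in_image)
    show "inj_on g {x \<in> A. f x = i}" using permutes_inj_on[OF g] .
  qed
qed

lemma tableau_row_eq: "tableau_row \<omega> i = {x \<in> {1..sum_list \<omega>}. entry_row \<omega> x = i}"
proof (intro equalityI subsetI)
  fix x assume "x \<in> tableau_row \<omega> i"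
  then show "x \<in> {x \<in> {1..sum_list \<omega>}. entry_row \<omega> x = i}"
    using entry_row_col unfolding tableau_row_def by blast
next
  fix x assume "x \<in> {x \<in> {1..sum_list \<omega>}. entry_row \<omega> x = i}"
  then show "x \<in> tableau_row \<omega> i"
    using entry_in_box[of x \<omega>] by (auto simp: tableau_row_def intro!: exI[of _ "entry_col \<omega> x"])
qed

lemma tableau_column_eq: "tableau_column \<omega> j = {x \<in> {1..sum_list \<omega>}. entry_col \<omega> x = j}"
proof (intro equalityI subsetI)
  fix x assume "x \<in> tableau_column \<omega> j"
  then show "x \<in> {x \<in> {1..sum_list \<omega>}. entry_col \<omega> x = j}"
    using entry_row_col unfolding tableau_column_def by blast
next
  fix x assume "x \<in> {x \<in> {1..sum_list \<omega>}. entry_col \<omega> x = j}"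
  then show "x \<in> tableau_column \<omega> j"
    using entry_in_box[of x \<omega>] by (auto simp: tableau_column_def intro!: exI[of _ "entry_row \<omega> x"])
qed

lemma row_group_eq: "row_group \<omega> = {g. g permutes {1..sum_list \<omega>} \<and> (\<forall>x. entry_row \<omega> (g x) = entry_row \<omega> x)}"
  unfolding row_group_def tableau_row_eq using image_fibre_eq_iff[of _ "{1..sum_list \<omega>}" "entry_row \<omega>"] by auto

lemma column_group_eq: "column_group \<omega> = {g. g permutes {1..sum_list \<omega>} \<and> (\<forall>x. entry_col \<omega> (g x) = entry_col \<omega> x)}"
  unfolding column_group_def tableau_column_eq using image_fibre_eq_iff[of _ "{1..sum_list \<omega>}" "entry_col \<omega>"] by auto

lemma tableau_symmetrizer:
  assumes "sorted_wrt (\<ge>) \<omega>"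
  shows "young_filling.symmetrizer {1..sum_list \<omega>} (entry_row \<omega>) (entry_col \<omega>) = young_symmetrizer \<omega>"
proof -
  interpret young_filling "{1..sum_list \<omega>}" "entry_row \<omega>" "entry_col \<omega>"
    using assms by (rule tableau_filling)
  have "row_perms = row_group \<omega>" "col_perms = column_group \<omega>"
    unfolding row_perms_def col_perms_def row_group_eq column_group_eq by (rule refl)+
  then show ?thesis by (intro ext) (simp only: symmetrizer_def young_symmetrizer_def)
qed

text \<open>Both traces carry the same scalar \<open>\<alpha>\<close> from
  \<open>symmetrizer_conv\<close>, which cancels.\<close>

lemma character_quotient:
  assumes \<omega>: "sorted_wrt (\<ge>) \<omega>" and \<pi>: "\<pi> permutes {1..sum_list \<omega>}"
  shows "trace_on (specht_module \<omega>) (left_mult \<pi>) / trace_on (specht_module \<omega>) (left_mult id) =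
    (\<Sum>g | g permutes {1..sum_list \<omega>}. young_symmetrizer \<omega> (inv g \<circ> inv \<pi> \<circ> g)) / of_nat (fact (sum_list \<omega>))"
proof -
  let ?A = "{1..sum_list \<omega>}"
  interpret young_filling ?A "entry_row \<omega>" "entry_col \<omega>" using \<omega> by (rule tableau_filling)
  note sym = tableau_symmetrizer[OF \<omega>]
  define \<alpha> where "\<alpha> = (\<Sum>g | g permutes ?A. symmetrizer g * symmetrizer (inv g))"
  have tr: "\<alpha> * trace_on (specht_module \<omega>) (left_mult \<pi>) =
      (\<Sum>g | g permutes ?A. symmetrizer (inv g \<circ> inv \<pi> \<circ> g))" if "\<pi> permutes ?A" for \<pi>
  proof (rule trace_on_left_ideal[OF _ _ _ _ that])
    show "symmetrizer x = 0" if "\<not> x permutes ?A" for x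
      using that row_permsD(1) col_permsD(1) by (intro symmetrizer_eq_0) (metis permutes_compose)
    show "(\<Sum>g | g permutes ?A. symmetrizer g * symmetrizer (inv g \<circ> x)) = \<alpha> * symmetrizer x"
      if "x permutes ?A" for x using symmetrizer_conv[OF that] by (simp add: \<alpha>_def)
    show "specht_module \<omega> = cfun.span {left_mult g symmetrizer |g. g permutes ?A}"
      unfolding specht_module_def sym by (rule refl)
  qed simp
  \<comment> \<open>At the identity each summand is \<open>symmetrizer id = 1\<close>, so the sum
    counts all permutations; in particular \<open>\<alpha>\<close> cannot vanish.\<close>
  have "\<alpha> * trace_on (specht_module \<omega>) (left_mult id) = of_nat (fact (sum_list \<omega>))"
  proof -
    have "symmetrizer (inv g \<circ> inv id \<circ> g) = 1" if "g permutes ?A" for g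
      using that symmetrizer_id by (simp add: permutes_inv_o)
    then show ?thesis using tr[OF permutes_id] by (simp add: card_permutations[OF refl])
  qed
  moreover have "of_nat (fact (sum_list \<omega>)) \<noteq> (0 :: complex)" by simp
  ultimately have "\<alpha> \<noteq> 0" by (metis mult_zero_left)
  have "trace_on (specht_module \<omega>) (left_mult id) = of_nat (fact (sum_list \<omega>)) / \<alpha>"
    using \<open>\<alpha> * trace_on (specht_module \<omega>) (left_mult id) = _\<close> \<open>\<alpha> \<noteq> 0\<close>
    by (simp add: nonzero_eq_divide_eq mult.commute)
  moreover have "trace_on (specht_module \<omega>) (left_mult \<pi>) =
      (\<Sum>g | g permutes ?A. young_symmetrizer \<omega> (inv g \<circ> inv \<pi> \<circ> g)) / \<alpha>"
    using tr[OF \<pi>, unfolded sym] \<open>\<alpha> \<noteq> 0\<close> by (simp add: nonzero_eq_divide_eq mult.commute)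
  ultimately show ?thesis using \<open>\<alpha> \<noteq> 0\<close> by simp
qed

section \<open>Cycles of permutations\<close>

lemma self_in_orbit: "finite A \<Longrightarrow> p permutes A \<Longrightarrow> x \<in> orbit p x"
  by (rule permutation_self_in_orbit) (unfold permutation_permutes, blast)

lemma orbit_eq:
  assumes "finite A" "p permutes A" "y \<in> orbit p x"
  shows "orbit p y = orbit p x"
proof
  show "orbit p y \<subseteq> orbit p x" using orbit_trans[OF _ assms(3)] by (rule subsetI)
  have "x \<in> orbit p y" using orbit_swap[OF self_in_orbit[OF assms(1,2)] assms(3)] .
  from orbit_trans[OF _ this] show "orbit p x \<subseteq> orbit p y" by (rule subsetI)
qed

lemma orbit_apply: "finite A \<Longrightarrow> p permutes A \<Longrightarrow> orbit p (p x) = orbit p x"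
  by (intro orbit_eq orbit.base)

lemma orbit_apply_inv: "finite A \<Longrightarrow> p permutes A \<Longrightarrow> orbit p (inv p x) = orbit p x"
  using orbit_apply[of A p "inv p x"] by simp

lemma orbit_invariant:
  assumes "\<And>x. f (p x) = f x" "y \<in> orbit p x"
  shows "f y = f x"
  using assms(2) by induction (use assms(1) in auto)

text \<open>\<open>p\<close> arises from \<open>q\<close> by inserting \<open>a\<close> directly
  before \<open>b\<close> in its cycle: the point that \<open>q\<close> sends to \<open>b\<close>
  now goes to \<open>a\<close>, and \<open>a\<close> goes to \<open>b\<close>.\<close>

lemma orbit_insert_point:
  assumes p: "p = Transposition.transpose a b \<circ> q" and q: "q permutes F" and a: "a \<notin> F" and b: "b \<in> F"
    and x: "x \<in> F"
  shows "orbit q x = orbit p x - {a}"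
proof (intro equalityI subsetI)
  have ab: "a \<noteq> b" using a b by auto
  have qa: "q a = a" using q a by (simp add: permutes_not_in)
  have pa: "p a = b" using p qa by simp
  have py: "q y \<noteq> b \<Longrightarrow> y \<noteq> a \<Longrightarrow> p y = q y" "q y = b \<Longrightarrow> p y = a" for y
  proof -
    show "q y = b \<Longrightarrow> p y = a" using p by simp
    assume "q y \<noteq> b" "y \<noteq> a"
    moreover have "q y \<noteq> a" using \<open>y \<noteq> a\<close> qa inj_eq[OF permutes_inj[OF q], of y a] by simp
    ultimately show "p y = q y" using p by simp
  qed
  have xa: "x \<noteq> a" using x a by auto
  {
    fix z assume "z \<in> orbit q x"
    then show "z \<in> orbit p x - {a}"
    proof (induction)
      case base
      have "q x \<noteq> a" using permutes_in_image[OF q] x a by metis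
      moreover have "q x \<in> orbit p x"
      proof (cases "q x = b")
        case True
        then have "a \<in> orbit p x" using py(2) orbit.base[of p x] by simp
        then show ?thesis using orbit.step[of a p x] pa True by simp
      next
        case False
        then show ?thesis using py(1)[OF False xa] orbit.base[of p x] by simp
      qed
      ultimately show ?case by simp
    next
      case (step z)
      have "q z \<noteq> a" using step.IH qa inj_eq[OF permutes_inj[OF q], of z a] by simp
      moreover have "q z \<in> orbit p x"
      proof (cases "q z = b")
        case True
        then have "a \<in> orbit p x" using py(2) orbit.step[of z p x] step.IH by simp
        then show ?thesis using orbit.step[of a p x] pa True by simp
      next
        case False
        then show ?thesis using py(1)[OF False] orbit.step[of z p x] step.IH by simp
      qed
      ultimately show ?case by simp
    qed
  next
    fix z assume "z \<in> orbit p x - {a}"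
    \<comment> \<open>The second conjunct carries the induction through the detour: on reaching
      \<open>a\<close> it must be known that the next point \<open>b\<close> lies in the orbit of
      \<open>q\<close>.\<close>
    moreover have "(z \<noteq> a \<longrightarrow> z \<in> orbit q x) \<and> (z = a \<longrightarrow> b \<in> orbit q x)" if "z \<in> orbit p x" for z
      using that
    proof (induction)
      case base
      show ?case
      proof (cases "q x = b")
        case True
        then show ?thesis using py(2) orbit.base[of q x] by simp
      next
        case False
        then show ?thesis
          using py(1)[OF False xa] orbit.base[of q x] permutes_in_image[OF q, of x] x a by auto
      qed
    next
      case (step z)
      show ?case
      proof (cases "z = a")
        case True
        then show ?thesis using step.IH pa ab by simp
      next
        case za: False
        then have z: "q z \<in> orbit q x" using step.IH orbit.step[of z q x] by simp
        show ?thesis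
        proof (cases "q z = b")
          case True
          then show ?thesis using py(2) z by simp
        next
          case False
          have "q z \<noteq> a" using za qa inj_eq[OF permutes_inj[OF q], of z a] by simp
          then show ?thesis using py(1)[OF False za] z by simp
        qed
      qed
    qed
    ultimately show "z \<in> orbit q x" by blast
  }
qed

text \<open>Detaching a point \<open>a\<close> from its cycle changes the left side by a factor -1
  in either case: if \<open>a\<close> is fixed, one cycle is lost and the sign stays; otherwise the
  number of cycles stays and the sign flips.\<close>

lemma sign_times_cycles:
  assumes "finite A" "p permutes A"
  shows "sign p * (- 1) ^ card (cycles_on A p) = (- 1) ^ card A"
  using assms
proof (induction A arbitrary: p rule: finite_induct)
  case empty
  then show ?case by (simp add: cycles_on_def)
next
  case (insert a F p)
  define b where "b = p a"
  define q where "q = Transposition.transpose a b \<circ> p"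
  have b: "b \<in> insert a F" unfolding b_def permutes_in_image[OF insert.prems] by simp
  have q: "q permutes F" unfolding q_def b_def by (rule permutes_insert_lemma[OF insert.prems])
  have p: "p = Transposition.transpose a b \<circ> q" by (simp add: q_def fun_eq_iff)
  have perm: "permutation q" using q insert.hyps(1) permutation_permutes by blast
  have IH: "sign q * (- 1) ^ card (cycles_on F q) = (- 1) ^ card F" using insert.IH[OF q] .
  show ?case
  proof (cases "b = a")
    case True
    then have "p = q" using p by simp
    have qa: "q a = a" using q insert.hyps by (simp add: permutes_not_in)
    have "orbit q x \<subseteq> F" if "x \<in> F" for x using permutes_orbit_subset[OF q that] .
    then have "{a} \<notin> cycles_on F q" using insert.hyps(2) by (auto simp: cycles_on_def)
    moreover have "cycles_on (insert a F) p = insert {a} (cycles_on F q)"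
      using qa by (simp add: cycles_on_def \<open>p = q\<close> orbit_eq_singleton_iff[THEN iffD2])
    ultimately have "card (cycles_on (insert a F) p) = Suc (card (cycles_on F q))"
      using insert.hyps(1) by (simp add: cycles_on_def)
    then show ?thesis using IH insert.hyps \<open>p = q\<close> by simp
  next
    case False
    then have bF: "b \<in> F" using b by simp
    have orb: "orbit q x = orbit p x - {a}" if "x \<in> F" for x
      using orbit_insert_point[OF p q insert.hyps(2) bF that] .
    have fin': "finite (insert a F)" using insert.hyps(1) by simp
    have "p a = b" using p q insert.hyps(2) by (simp add: permutes_not_in)
    then have "orbit p a = orbit p b" using orbit_apply[OF fin' insert.prems, of a] by simp
    then have 1: "cycles_on (insert a F) p = orbit p ` F" using bF by (auto simp: cycles_on_def)
    have 2: "cycles_on F q = (\<lambda>u. u - {a}) ` (orbit p ` F)"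
      unfolding cycles_on_def image_image using orb by (rule image_cong[OF refl])
    have "inj_on (\<lambda>u. u - {a}) (orbit p ` F)"
    proof (rule inj_onI)
      fix u v assume "u \<in> orbit p ` F" "v \<in> orbit p ` F" and eq: "u - {a} = v - {a}"
      then obtain x y where xy: "x \<in> F" "y \<in> F" "u = orbit p x" "v = orbit p y" by blast
      then have "x \<in> v - {a}"
        using eq self_in_orbit[OF fin' insert.prems, of x] insert.hyps(2) by blast
      then show "u = v" using xy orbit_eq[OF fin' insert.prems, of x y] by simp
    qed
    then have "card (cycles_on F q) = card (cycles_on (insert a F) p)"
      unfolding 1 2 by (rule card_image)
    moreover have "sign p = - sign q"
      unfolding p using perm False by (simp add: sign_compose permutation_swap_id sign_swap_id)
    ultimately show ?thesis using IH insert.hyps by simp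
  qed
qed

text \<open>
  Growing a set \<open>S\<close> one point at a time, always inside a cycle that already meets \<open>S\<close>, raises the
  number of cycles of \<open>\<alpha>\<close> and of \<open>\<gamma>\<close> that meet \<open>S\<close> by at most one in total; this cannot get
  stuck because \<open>\<alpha>\<inverse>\<gamma>\<close> is transitive.
\<close>

lemma cycles_add_cycles_le:
  assumes fin: "finite A" and \<alpha>: "\<alpha> permutes A" and \<gamma>: "\<gamma> permutes A"
    and trans: "\<And>x. x \<in> A \<Longrightarrow> orbit (inv \<alpha> \<circ> \<gamma>) x = A"
  shows "card (cycles_on A \<alpha>) + card (cycles_on A \<gamma>) \<le> card A + 1"
proof (cases "A = {}")
  case True
  then show ?thesis by (simp add: cycles_on_def)
next
  case False
  have "\<exists>S\<subseteq>A. card S = Suc j \<and> card (orbit \<alpha> ` S) + card (orbit \<gamma> ` S) \<le> Suc j + 1"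
    if "Suc j \<le> card A" for j
    using that
  proof (induction j)
    case 0
    obtain x where "x \<in> A" using False by blast
    then show ?case by (intro exI[of _ "{x}"]) simp
  next
    case (Suc j)
    then obtain S where S: "S \<subseteq> A" "card S = Suc j" "card (orbit \<alpha> ` S) + card (orbit \<gamma> ` S) \<le> Suc j + 1"
      by (meson Suc_leD)
    have finS: "finite S" using S(1) fin finite_subset by blast
    have "\<exists>y\<in>A - S. orbit \<alpha> y \<in> orbit \<alpha> ` S \<or> orbit \<gamma> y \<in> orbit \<gamma> ` S"
    proof (rule ccontr)
      assume stuck: "\<not> ?thesis"
      \<comment> \<open>\<open>\<gamma>\<close> moves a point within a cycle of
        \<open>\<gamma>\<close>, \<open>inv \<alpha>\<close> within a cycle of
        \<open>\<alpha>\<close>. If every point whose cycle meets \<open>S\<close> is in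
        \<open>S\<close> already, both moves stay in \<open>S\<close>, and transitivity gives
        \<open>S = A\<close>.\<close>
      have cl: "inv \<alpha> (\<gamma> x) \<in> S" if "x \<in> S" for x
      proof -
        have "\<gamma> x \<in> A" using that S(1) \<gamma> by (auto simp: permutes_in_image)
        moreover have "orbit \<gamma> (\<gamma> x) \<in> orbit \<gamma> ` S"
          using that orbit_apply[OF fin \<gamma>] by blast
        ultimately have 1: "\<gamma> x \<in> S" using stuck by blast
        have "inv \<alpha> (\<gamma> x) \<in> A" using 1 S(1) permutes_in_image[OF permutes_inv[OF \<alpha>]] by blast
        moreover have "orbit \<alpha> (inv \<alpha> (\<gamma> x)) \<in> orbit \<alpha> ` S"
          using 1 orbit_apply_inv[OF fin \<alpha>] by blast
        ultimately show ?thesis using stuck by blast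
      qed
      obtain x where x: "x \<in> S" using S(2) by fastforce
      have "orbit (inv \<alpha> \<circ> \<gamma>) x \<subseteq> S"
      proof
        fix y assume "y \<in> orbit (inv \<alpha> \<circ> \<gamma>) x"
        then show "y \<in> S" by induction (use x cl in auto)
      qed
      then have "S = A" using trans[of x] x S(1) by blast
      then show False using S(2) Suc.prems by simp
    qed
    then obtain y where y: "y \<in> A - S" "orbit \<alpha> y \<in> orbit \<alpha> ` S \<or> orbit \<gamma> y \<in> orbit \<gamma> ` S" by blast
    \<comment> \<open>One of the two cycles through \<open>y\<close> already meets \<open>S\<close>,
      so at most one of the two counts grows.\<close>
    have ins: "card (insert z T) \<le> Suc (card T)" "z \<in> T \<Longrightarrow> card (insert z T) = card T" for z and T :: "'a set set"
      by (simp_all add: card_insert_le_m1 insert_absorb card_insert_if)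
    have "card (orbit \<alpha> ` insert y S) + card (orbit \<gamma> ` insert y S) \<le> Suc (Suc j) + 1"
      using y(2) S(3) ins(1)[of "orbit \<alpha> y" "orbit \<alpha> ` S"] ins(1)[of "orbit \<gamma> y" "orbit \<gamma> ` S"]
        ins(2)[of "orbit \<alpha> y" "orbit \<alpha> ` S"] ins(2)[of "orbit \<gamma> y" "orbit \<gamma> ` S"]
      unfolding image_insert by linarith
    then show ?case using y(1) S finS by (intro exI[of _ "insert y S"]) auto
  qed
  moreover obtain j where "card A = Suc j" using False fin by (metis card_0_eq not0_implies_Suc)
  ultimately obtain S where S: "S \<subseteq> A" "card S = card A" "card (orbit \<alpha> ` S) + card (orbit \<gamma> ` S) \<le> card A + 1"
    by (metis order.refl)
  then have "S = A" using fin by (simp add: card_subset_eq)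
  then show ?thesis using S by (simp add: cycles_on_def)
qed

section \<open>The long cycle and its conjugacy class\<close>

lemma long_cycle_permutes: "long_cycle k permutes {1..k}"
  using cycle_permutes[of "[1..<Suc k]"] unfolding long_cycle_def
  unfolding set_upt atLeastLessThanSuc_atLeastAtMost .

lemma long_cycle_apply:
  assumes "1 \<le> x" "x \<le> k"
  shows "long_cycle k x = (if x = k then 1 else x + 1)"
proof -
  let ?cs = "[1..<Suc k]"
  have "map (long_cycle k ^^ 1) ?cs = rotate 1 ?cs"
    unfolding long_cycle_def by (rule cyclic_rotation[OF distinct_upt])
  then have "map (long_cycle k ^^ 1) ?cs ! (x - 1) = rotate 1 ?cs ! (x - 1)" by (rule arg_cong)
  moreover have "map (long_cycle k ^^ 1) ?cs ! (x - 1) = long_cycle k x"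
    using assms by (simp del: upt_Suc)
  moreover have "rotate 1 ?cs ! (x - 1) = ?cs ! ((1 + (x - 1)) mod k)"
    using assms nth_rotate[of "x - 1" ?cs 1] by (simp del: upt_Suc)
  moreover have "(1 + (x - 1)) mod k = (if x = k then 0 else x)" using assms by auto
  ultimately show ?thesis using assms by (simp del: upt_Suc split: if_splits)
qed

lemma orbit_long_cycle:
  assumes "x \<in> {1..k}"
  shows "orbit (long_cycle k) x = {1..k}"
proof -
  have k: "1 \<le> k" using assms by simp
  \<comment> \<open>Starting at \<open>k\<close>, whose image is \<open>1\<close>, an upward
    induction reaches every point.\<close>
  have all: "y \<in> orbit (long_cycle k) k" if "y \<in> {1..k}" for y
  proof -
    have "Suc j \<in> orbit (long_cycle k) k" if "Suc j \<le> k" for j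
      using that
    proof (induction j)
      case 0
      then show ?case using orbit.base[of "long_cycle k" k] long_cycle_apply[of k k] k by simp
    next
      case (Suc j)
      then have "long_cycle k (Suc j) \<in> orbit (long_cycle k) k" by (intro orbit.step) simp
      then show ?case using long_cycle_apply[of "Suc j" k] Suc.prems by simp
    qed
    from this[of "y - 1"] show ?thesis using that by simp
  qed
  have "orbit (long_cycle k) k = {1..k}"
    using all permutes_orbit_subset[OF long_cycle_permutes, of k k] k by auto
  then show ?thesis using orbit_eq[OF finite_atLeastAtMost long_cycle_permutes all[OF assms]] by simp
qed

lemma orbit_long_cycle_fixed: "x \<notin> {1..k} \<Longrightarrow> orbit (long_cycle k) x = {x}"
  using long_cycle_permutes[of k] by (simp add: orbit_eq_singleton_iff permutes_not_in)

lemma cycle_type_long_cycle: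
  assumes "1 \<le> k" "k \<le> n"
  shows "cycle_type_on {1..n} (long_cycle k) = {#k#} + replicate_mset (n - k) 1"
proof -
  have split: "{1..n} = {1..k} \<union> {k<..n}" using assms by auto
  have "orbit (long_cycle k) ` {1..k} = {{1..k}}"
    using orbit_long_cycle[of _ k] assms by (auto simp: image_constant_conv)
  moreover have "orbit (long_cycle k) ` {k<..n} = (\<lambda>x. {x}) ` {k<..n}"
    using orbit_long_cycle_fixed[of _ k] by (intro image_cong) auto
  ultimately have C: "cycles_on {1..n} (long_cycle k) = insert {1..k} ((\<lambda>x. {x}) ` {k<..n})"
    unfolding cycles_on_def split image_Un by simp
  \<comment> \<open>This matters for \<open>k = 1\<close>, when the long cycle is itself a singleton
    and must still be counted separately.\<close>
  have "{1..k} \<notin> (\<lambda>x. {x}) ` {k<..n}"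
  proof
    assume "{1..k} \<in> (\<lambda>x. {x}) ` {k<..n}"
    then obtain x where "{1..k} = {x}" "k < x" by auto
    then show False using assms by (metis atLeastAtMost_iff insertI1 not_less)
  qed
  then have "cycle_type_on {1..n} (long_cycle k) = {#k#} + image_mset card (mset_set ((\<lambda>x. {x}) ` {k<..n}))"
    unfolding cycle_type_on_def C by simp
  also have "image_mset card (mset_set ((\<lambda>x. {x}) ` {k<..n})) = image_mset (\<lambda>x. 1) (mset_set {k<..n})"
    by (simp add: image_mset_mset_set[symmetric] multiset.map_comp comp_def)
  also have "\<dots> = replicate_mset (n - k) 1" by (simp add: image_mset_const_eq)
  finally show ?thesis .
qed

lemma extend_injection_to_permutation:
  assumes "finite A" "K \<subseteq> A" "inj_on f K" "f ` K \<subseteq> A"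
  shows "\<exists>g. g permutes A \<and> (\<forall>x\<in>K. g x = f x)"
proof -
  have finK: "finite K" using assms(1,2) by (rule finite_subset[rotated])
  have "card (A - K) = card A - card (f ` K)"
    unfolding card_image[OF assms(3)] by (rule card_Diff_subset[OF finK assms(2)])
  then have "card (A - K) = card (A - f ` K)"
    unfolding card_Diff_subset[OF finite_imageI[OF finK] assms(4)] .
  then obtain e where e: "bij_betw e (A - K) (A - f ` K)"
    using finite_same_card_bij[OF finite_Diff[OF assms(1)] finite_Diff[OF assms(1)]] by blast
  define g where "g x = (if x \<in> K then f x else if x \<in> A then e x else x)" for x
  have "bij_betw g K (f ` K)"
    using assms(3) by (simp add: bij_betw_def inj_on_def g_def)
  moreover have "bij_betw g (A - K) (A - f ` K)"
    using e by (rule bij_betw_cong[THEN iffD1, rotated]) (simp add: g_def)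
  ultimately have "bij_betw g (K \<union> (A - K)) (f ` K \<union> (A - f ` K))"
    by (rule bij_betw_combine) blast
  moreover have "K \<union> (A - K) = A" "f ` K \<union> (A - f ` K) = A" using assms by blast+
  ultimately have "g permutes A"
    using assms(2) by (intro bij_imp_permutes) (auto simp: g_def)
  then show ?thesis by (intro exI[of _ g]) (simp add: g_def)
qed

text \<open>\<open>irr_char\<close> is evaluated at an unspecified permutation of its cycle type,
  and this brings it to the standard one. Listing the \<open>k\<close>-cycle of \<open>f\<close> as
  successive iterates of a point gives an injection of \<open>{1..k}\<close>; any extension of it to
  a permutation conjugates, because \<open>f\<close> fixes all remaining points.\<close>

lemma conjugate_to_long_cycle:
  assumes f: "f permutes {1..n}" and k: "1 \<le> k" "k \<le> n"
    and ct: "cycle_type_on {1..n} f = {#k#} + replicate_mset (n - k) 1"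
  shows "\<exists>h. h permutes {1..n} \<and> f \<circ> h = h \<circ> long_cycle k"
proof -
  let ?A = "{1..n}" and ?C = "cycles_on {1..n} f"
  have finC: "finite ?C" by (simp add: cycles_on_def)
  have "k \<in># image_mset card (mset_set ?C)" using ct by (simp add: cycle_type_on_def)
  then obtain u where u: "u \<in> ?C" "card u = k" using finC by auto
  \<comment> \<open>Apart from \<open>u\<close> only parts 1 are left, so the other cycles are fixed
    points. Singling out one \<open>u\<close> first also covers \<open>k = 1\<close>.\<close>
  have "mset_set ?C = add_mset u (mset_set (?C - {u}))"
    using u finC by (simp add: mset_set.remove)
  then have rest: "image_mset card (mset_set (?C - {u})) = replicate_mset (n - k) 1"
    using ct u by (simp add: cycle_type_on_def)
  have fixed: "f x = x" if "x \<notin> u" for x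
  proof (cases "x \<in> ?A")
    case True
    have xo: "x \<in> orbit f x" using self_in_orbit[OF _ f] by blast
    then have "orbit f x \<in># mset_set (?C - {u})" using True that finC by (auto simp: cycles_on_def)
    then have "card (orbit f x) \<in># replicate_mset (n - k) 1" using rest by (metis image_eqI set_image_mset)
    then have "card (orbit f x) = 1" by (simp add: in_replicate_mset split: if_splits)
    then show ?thesis using xo orbit.base[of f x] by (metis card_1_singletonE singletonD)
  next
    case False
    then show ?thesis using f by (simp add: permutes_not_in)
  qed
  obtain x0 where x0: "x0 \<in> ?A" "u = orbit f x0" using u(1) by (auto simp: cycles_on_def)
  have x0o: "x0 \<in> orbit f x0" using self_in_orbit[OF _ f] by blast
  have uA: "u \<subseteq> ?A" using permutes_orbit_subset[OF f x0(1)] x0(2) by simp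
  \<comment> \<open>The shift sends \<open>1\<close> to \<open>x0\<close> and \<open>k\<close> to
    the last iterate before the cycle closes.\<close>
  define h0 where "h0 i = (f ^^ (i - 1)) x0" for i
  let ?d = "funpow_dist1 f x0 x0"
  have inj0: "inj_on (\<lambda>n. (f ^^ n) x0) {0..<?d}" using x0o by (rule inj_on_funpow_dist1)
  have u_eq: "u = (\<lambda>n. (f ^^ n) x0) ` {0..<?d}" unfolding x0(2) by (rule orbit_conv_funpow_dist1[OF x0o])
  have dk: "?d = k" using u(2) card_image[OF inj0] u_eq by simp
  have period: "(f ^^ k) x0 = x0" using funpow_dist1_prop[OF x0o] dk by simp
  have inj_h0: "inj_on h0 {1..k}"
  proof (rule inj_onI)
    fix i j assume "i \<in> {1..k}" "j \<in> {1..k}" "h0 i = h0 j"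
    moreover from this have "i - 1 \<in> {0..<?d}" "j - 1 \<in> {0..<?d}" unfolding dk by auto
    ultimately have "i - 1 = j - 1" using inj_onD[OF inj0, of "i - 1" "j - 1"] by (simp add: h0_def)
    then show "i = j" using \<open>i \<in> {1..k}\<close> \<open>j \<in> {1..k}\<close> unfolding atLeastAtMost_iff by arith
  qed
  have sub: "h0 ` {1..k} \<subseteq> u"
  proof
    fix y assume "y \<in> h0 ` {1..k}"
    then obtain i where "i \<in> {1..k}" "y = (f ^^ (i - 1)) x0" by (auto simp: h0_def)
    moreover have "i - 1 \<in> {0..<?d}" using \<open>i \<in> {1..k}\<close> dk by auto
    ultimately show "y \<in> u" using u_eq by blast
  qed
  have img: "h0 ` {1..k} = u"
  proof (rule card_subset_eq[OF _ sub])
    show "finite u" using uA finite_subset by blast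
    show "card (h0 ` {1..k}) = card u" using card_image[OF inj_h0] u(2) by simp
  qed
  obtain h where h: "h permutes ?A" "\<And>x. x \<in> {1..k} \<Longrightarrow> h x = h0 x"
    using extend_injection_to_permutation[of ?A "{1..k}" h0] inj_h0 img uA k by auto
  have "f (h x) = h (long_cycle k x)" for x
  proof (cases "x \<in> {1..k}")
    case True
    have "long_cycle k x \<in> {1..k}" using permutes_in_image[OF long_cycle_permutes] True by blast
    then have "h (long_cycle k x) = h0 (long_cycle k x)" by (rule h(2))
    also have "\<dots> = (if x = k then x0 else (f ^^ x) x0)"
      using True long_cycle_apply[of x k] by (simp add: h0_def)
    also have "\<dots> = (f ^^ x) x0" using period by simp
    also have "\<dots> = f (h x)"
      unfolding h(2)[OF True] h0_def using True by (cases x) simp_all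
    finally show ?thesis by simp
  next
    case False
    have "h x \<notin> u"
    proof
      assume "h x \<in> u"
      then obtain y where "y \<in> {1..k}" "h x = h y" using img h(2) by (metis imageE)
      then show False using False permutes_inj[OF h(1)] by (metis injD)
    qed
    then have "f (h x) = h x" by (rule fixed)
    then show ?thesis using False long_cycle_permutes[of k] by (metis permutes_not_in)
  qed
  then show ?thesis using h(1) by (intro exI[of _ h]) auto
qed

text \<open>Serves the trace formula, in which the inverse of the permutation appears.\<close>

lemma cycle_type_inv:
  assumes "p permutes A" "finite A"
  shows "cycle_type_on A (inv p) = cycle_type_on A p"
proof -
  have "orbit (inv p) x = orbit p x" for x
    by (rule orbit_inv_eq) (use assms in \<open>unfold permutation_permutes, blast\<close>)
  then show ?thesis by (simp add: cycle_type_on_def cycles_on_def)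
qed

section \<open>Polynomials\<close>

definition monom_eval :: "(indet \<Rightarrow> 'b::comm_ring_1) \<Rightarrow> (indet \<Rightarrow>\<^sub>0 nat) \<Rightarrow> 'b" where
  "monom_eval f t = (\<Prod>v \<in> Poly_Mapping.keys t. f v ^ Poly_Mapping.lookup t v)"

lemma monom_eval_superset:
  assumes "finite S" "Poly_Mapping.keys t \<subseteq> S"
  shows "monom_eval f t = (\<Prod>v\<in>S. f v ^ Poly_Mapping.lookup t v)"
  unfolding monom_eval_def using assms
  by (intro prod.mono_neutral_left) (auto simp: in_keys_iff)

lemma monom_eval_add: "monom_eval f (s + t) = monom_eval f s * monom_eval f t"
proof -
  let ?S = "Poly_Mapping.keys s \<union> Poly_Mapping.keys t"
  have "monom_eval f (s + t) = (\<Prod>v\<in>?S. f v ^ Poly_Mapping.lookup (s + t) v)"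
    by (intro monom_eval_superset keys_add) simp
  also have "\<dots> = (\<Prod>v\<in>?S. f v ^ Poly_Mapping.lookup s v) * (\<Prod>v\<in>?S. f v ^ Poly_Mapping.lookup t v)"
    by (simp add: lookup_add power_add prod.distrib)
  also have "\<dots> = monom_eval f s * monom_eval f t"
    by (simp add: monom_eval_superset[of ?S s f] monom_eval_superset[of ?S t f])
  finally show ?thesis .
qed

lemma monom_eval_single: "monom_eval f (Poly_Mapping.single v n) = f v ^ n"
  by (simp add: monom_eval_def)

lemma monom_eval_0: "monom_eval f 0 = 1"
  by (simp add: monom_eval_def)

lemma monom_eval_sum: "monom_eval f (\<Sum>i\<in>I. T i) = (\<Prod>i\<in>I. monom_eval f (T i))"
  by (induction I rule: infinite_finite_induct) (simp_all add: monom_eval_0 monom_eval_add)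

lemma subst_superset:
  assumes "finite S" "Poly_Mapping.keys F \<subseteq> S"
  shows "subst f F = (\<Sum>t\<in>S. of_int (Poly_Mapping.lookup F t) * monom_eval f t)"
  unfolding subst_def monom_eval_def[symmetric] using assms
  by (intro sum.mono_neutral_left) (auto simp: in_keys_iff)

lemma subst_eq: "subst f F = (\<Sum>t\<in>Poly_Mapping.keys F. of_int (Poly_Mapping.lookup F t) * monom_eval f t)"
  by (intro subst_superset) simp_all

lemma subst_add: "subst f (F + G) = subst f F + subst f G"
proof -
  let ?S = "Poly_Mapping.keys F \<union> Poly_Mapping.keys G"
  have "subst f (F + G) = (\<Sum>t\<in>?S. of_int (Poly_Mapping.lookup (F + G) t) * monom_eval f t)"
    by (intro subst_superset keys_add) simp
  also have "\<dots> = (\<Sum>t\<in>?S. of_int (Poly_Mapping.lookup F t) * monom_eval f t)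
      + (\<Sum>t\<in>?S. of_int (Poly_Mapping.lookup G t) * monom_eval f t)"
    by (simp add: lookup_add distrib_right sum.distrib)
  also have "\<dots> = subst f F + subst f G"
    by (simp add: subst_superset[of ?S F f] subst_superset[of ?S G f])
  finally show ?thesis .
qed

lemma subst_0: "subst f 0 = 0"
  by (simp add: subst_def)

lemma subst_uminus: "subst f (- F) = - subst f F"
  using subst_add[of f F "- F"] by (simp add: subst_0 eq_neg_iff_add_eq_0 add.commute)

lemma subst_diff: "subst f (F - G) = subst f F - subst f G"
  using subst_add[of f F "- G"] by (simp add: subst_uminus)

lemma subst_sum: "subst f (\<Sum>i\<in>I. T i) = (\<Sum>i\<in>I. subst f (T i))"
  by (induction I rule: infinite_finite_induct) (simp_all add: subst_0 subst_add)

lemma subst_single: "subst f (Poly_Mapping.single t c) = of_int c * monom_eval f t"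
  by (cases "c = 0") (simp_all add: subst_0 subst_eq)

lemma monom_degree_superset:
  assumes "finite S" "Poly_Mapping.keys t \<subseteq> S"
  shows "monom_degree t = (\<Sum>v\<in>S. Poly_Mapping.lookup t v)"
  unfolding monom_degree_def using assms
  by (intro sum.mono_neutral_left) (auto simp: in_keys_iff)

lemma monom_degree_add: "monom_degree (s + t) = monom_degree s + monom_degree t"
proof -
  let ?S = "Poly_Mapping.keys s \<union> Poly_Mapping.keys t"
  have "monom_degree (s + t) = (\<Sum>v\<in>?S. Poly_Mapping.lookup (s + t) v)"
    by (intro monom_degree_superset keys_add) simp
  also have "\<dots> = monom_degree s + monom_degree t"
    by (simp add: lookup_add sum.distrib monom_degree_superset[of ?S s] monom_degree_superset[of ?S t])
  finally show ?thesis .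
qed

lemma monom_degree_single: "monom_degree (Poly_Mapping.single v n) = n"
  by (simp add: monom_degree_def)

lemma monom_degree_sum: "monom_degree (\<Sum>i\<in>I. T i) = (\<Sum>i\<in>I. monom_degree (T i))"
proof (induction I rule: infinite_finite_induct)
  case (infinite A)
  then show ?case by (simp add: monom_degree_def)
next
  case empty
  then show ?case by (simp add: monom_degree_def)
next
  case (insert x F)
  then show ?case by (simp add: monom_degree_add)
qed

lemma lookup_sum_single:
  assumes "finite S"
  shows "Poly_Mapping.lookup (\<Sum>s\<in>S. Poly_Mapping.single s (g s)) t = (if t \<in> S then g t else 0)"
  using assms by (simp add: lookup_sum lookup_single when_def)

lemma lookup_top_terms:
  "Poly_Mapping.lookup (top_terms F) t =
     (if monom_degree t = total_degree F then Poly_Mapping.lookup F t else 0)"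
  unfolding top_terms_def by (subst lookup_sum_single) (auto simp: in_keys_iff)

text \<open>\<open>monom_eval q_sign t\<close> is the sign that the monomial \<open>t\<close>
  acquires under \<open>neg_q\<close>.\<close>

definition q_sign :: "indet \<Rightarrow> int" where
  "q_sign v = (case v of PVar i \<Rightarrow> 1 | QVar i \<Rightarrow> - 1)"

lemma sum_single_keys: "(\<Sum>v\<in>Poly_Mapping.keys t. Poly_Mapping.single v (Poly_Mapping.lookup t v)) = t"
  by (rule poly_mapping_eqI) (simp add: lookup_sum_single in_keys_iff)

lemma single_power:
  "Poly_Mapping.single (t :: indet \<Rightarrow>\<^sub>0 nat) (a :: int) ^ n = Poly_Mapping.single (\<Sum>i<n. t) (a ^ n)"
  by (induction n) (simp_all add: mult_single add.commute)

lemma prod_single: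
  "(\<Prod>i\<in>I. Poly_Mapping.single (T i :: indet \<Rightarrow>\<^sub>0 nat) (a i :: int)) = Poly_Mapping.single (\<Sum>i\<in>I. T i) (\<Prod>i\<in>I. a i)"
  by (induction I rule: infinite_finite_induct) (simp_all add: mult_single)

lemma sum_const_single: "(\<Sum>i<n. Poly_Mapping.single (v :: indet) (1::nat)) = Poly_Mapping.single v n"
  by (rule poly_mapping_eqI) (simp add: lookup_sum lookup_single when_def)

lemma var_power: "var v ^ n = Poly_Mapping.single (Poly_Mapping.single v n) 1"
  unfolding var_def single_power sum_const_single power_one by (rule refl)

text \<open>Every indeterminate is replaced by plus or minus itself, so the substitution acts
  diagonally on monomials.\<close>

lemma lookup_neg_q: "Poly_Mapping.lookup (neg_q F) t = Poly_Mapping.lookup F t * monom_eval q_sign t"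
proof -
  let ?g = "\<lambda>v. case v of PVar i \<Rightarrow> var (PVar i) | QVar i \<Rightarrow> - var (QVar i)"
  have g: "?g v = Poly_Mapping.single (Poly_Mapping.single v 1) (q_sign v)" for v
    by (cases v) (simp_all add: q_sign_def var_def single_uminus)
  have me: "monom_eval ?g s = Poly_Mapping.single s (monom_eval q_sign s)" for s
    unfolding monom_eval_def g by (simp only: single_power sum_const_single prod_single sum_single_keys)
  have "neg_q F = (\<Sum>s\<in>Poly_Mapping.keys F. Poly_Mapping.single s (Poly_Mapping.lookup F s * monom_eval q_sign s))"
    unfolding neg_q_def subst_eq me
    by (intro sum.cong refl) (simp add: mult_single flip: single_of_int)
  then show ?thesis by (simp add: lookup_sum_single in_keys_iff)
qed

lemma monom_eval_q_sign_neq_0: "monom_eval q_sign t \<noteq> 0"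
  by (auto simp: monom_eval_def q_sign_def split: indet.splits)

lemma keys_neg_q: "Poly_Mapping.keys (neg_q F) = Poly_Mapping.keys F"
  using monom_eval_q_sign_neq_0 by (auto simp: in_keys_iff lookup_neg_q)

text \<open>The signs are nonzero, so the support and with it the total degree are
  preserved.\<close>

lemma neg_q_top_terms: "neg_q (top_terms F) = top_terms (neg_q F)"
proof -
  have "total_degree (neg_q F) = total_degree F" by (simp add: total_degree_def keys_neg_q)
  then show ?thesis
    by (intro poly_mapping_eqI) (simp add: lookup_neg_q lookup_top_terms)
qed

lemma top_terms_uminus: "top_terms (- F) = - top_terms F"
proof -
  have "total_degree (- F) = total_degree F" by (simp add: total_degree_def)
  then show ?thesis
    by (intro poly_mapping_eqI) (simp add: lookup_top_terms)
qed

lemma top_terms_sign: "top_terms ((- 1) ^ k * F) = (- 1) ^ k * top_terms F"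
  by (cases "even k") (simp_all add: top_terms_uminus)

lemma neg_q_sum: "neg_q (\<Sum>i\<in>I. T i) = (\<Sum>i\<in>I. neg_q (T i))"
  by (rule poly_mapping_eqI) (simp add: lookup_neg_q lookup_sum sum_distrib_right)

lemma neg_q_single: "neg_q (Poly_Mapping.single t a) = Poly_Mapping.single t (a * monom_eval q_sign t)"
  by (rule poly_mapping_eqI) (simp add: lookup_neg_q lookup_single when_def)

text \<open>No cancellation can occur in a sum of monomials with coefficient 1.\<close>

lemma top_terms_sum_monomials:
  assumes fin: "finite I" and le: "\<And>i. i \<in> I \<Longrightarrow> monom_degree (E i) \<le> d" and ex: "\<exists>i\<in>I. monom_degree (E i) = d"
  shows "top_terms (\<Sum>i\<in>I. Poly_Mapping.single (E i) (1::int)) =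
    (\<Sum>i\<in>{i \<in> I. monom_degree (E i) = d}. Poly_Mapping.single (E i) 1)"
proof -
  let ?P = "\<Sum>i\<in>I. Poly_Mapping.single (E i) (1::int)"
  have lk: "Poly_Mapping.lookup ?P t = int (card {i \<in> I. E i = t})" for t
    using fin by (auto simp: lookup_sum lookup_single when_def sum.If_cases intro!: arg_cong[where f = card])
  have keys: "Poly_Mapping.keys ?P = E ` I"
    using fin by (auto simp: in_keys_iff lk card_eq_0_iff)
  have "total_degree ?P = d"
    unfolding total_degree_def keys using fin le ex by (intro Max_eqI) auto
  then have "Poly_Mapping.lookup (top_terms ?P) t =
      Poly_Mapping.lookup (\<Sum>i\<in>{i \<in> I. monom_degree (E i) = d}. Poly_Mapping.single (E i) 1) t" for t
  proof (cases "monom_degree t = d")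
    case True
    then have "{i \<in> I. E i = t} = {i \<in> {i \<in> I. monom_degree (E i) = d}. E i = t}" by auto
    then have "Poly_Mapping.lookup (\<Sum>i\<in>{i \<in> I. monom_degree (E i) = d}. Poly_Mapping.single (E i) 1) t =
        int (card {i \<in> I. E i = t})"
      using fin by (auto simp: lookup_sum lookup_single when_def sum.If_cases intro!: arg_cong[where f = card])
    with True \<open>total_degree ?P = d\<close> show ?thesis by (simp add: lookup_top_terms lk)
  next
    case False
    then have "Poly_Mapping.lookup (\<Sum>i\<in>{i \<in> I. monom_degree (E i) = d}. Poly_Mapping.single (E i) (1::int)) t = 0"
      unfolding lookup_sum by (intro sum.neutral) (auto simp: lookup_single when_def)
    with False \<open>total_degree ?P = d\<close> show ?thesis by (simp add: lookup_top_terms)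
  qed
  then show ?thesis by (rule poly_mapping_eqI)
qed

section \<open>Uniqueness of polynomials with prescribed values on shapes\<close>

lemma base_expansion_unique:
  fixes D :: nat
  assumes "\<And>j. j < n \<Longrightarrow> a j < D" "\<And>j. j < n \<Longrightarrow> b j < D"
    and "(\<Sum>j<n. a j * D ^ j) = (\<Sum>j<n. b j * D ^ j)" "i < n"
  shows "a i = b i"
  using assms
proof (induction n arbitrary: a b i)
  case 0
  then show ?case by simp
next
  case (Suc n)
  have D: "D > 0" using Suc.prems(1)[of 0] by simp
  have shift: "(\<Sum>j<Suc n. f j * D ^ j) = f 0 + D * (\<Sum>j<n. f (Suc j) * D ^ j)" for f :: "nat \<Rightarrow> nat"
    unfolding sum.lessThan_Suc_shift by (simp add: sum_distrib_left mult.left_commute)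
  have eq: "a 0 + D * (\<Sum>j<n. a (Suc j) * D ^ j) = b 0 + D * (\<Sum>j<n. b (Suc j) * D ^ j)"
    using Suc.prems(3) unfolding shift .
  have "a 0 < D" "b 0 < D" using Suc.prems(1,2) by auto
  with arg_cong[OF eq, of "\<lambda>x. x mod D"] have 0: "a 0 = b 0" by simp
  with eq D have tl: "(\<Sum>j<n. a (Suc j) * D ^ j) = (\<Sum>j<n. b (Suc j) * D ^ j)" by simp
  show ?case
  proof (cases i)
    case 0
    with \<open>a 0 = b 0\<close> show ?thesis by simp
  next
    case (Suc j)
    then show ?thesis
      using Suc.IH[of "\<lambda>j. a (Suc j)" "\<lambda>j. b (Suc j)" j] Suc.prems(1,2,4) tl by simp
  qed
qed

text \<open>
  Kronecker substitution: for \<open>D\<close> larger than all exponents, \<open>v\<^sub>j \<mapsto> N\<^bsup>D^j\<^esup>\<close> turns distinct monomials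
  into distinct powers of \<open>N\<close>. The variables are numbered so that \<open>q\<^sub>m, \<dots>, q\<^sub>1\<close> come first, which
  makes the values of the \<open>q\<^sub>i\<close> weakly decreasing.
\<close>

definition indet_enum :: "nat \<Rightarrow> nat \<Rightarrow> indet" where
  "indet_enum m j = (if j < m then QVar (m - j) else PVar (j - m))"

text \<open>\<open>D\<close> is left open in the hypothesis because it has to exceed the exponents
  of \<open>F\<close>. For such a \<open>D\<close> the values form a polynomial in \<open>N\<close>
  alone with the same coefficients, and it has infinitely many roots.\<close>

lemma pq_poly_eq_0:
  assumes F: "F \<in> pq_polys m"
    and ev: "\<And>N D. N \<ge> k \<Longrightarrow> N \<ge> 1 \<Longrightarrow> D \<ge> 1 \<Longrightarrow>
      eval_pq (\<lambda>i. N ^ D ^ (m + i)) (\<lambda>i. N ^ D ^ (m - i)) F = 0"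
  shows "F = 0"
proof (rule ccontr)
  assume "F \<noteq> 0"
  \<comment> \<open>The numbering has \<open>2 * m + 1\<close> places: position \<open>m\<close>
    holds the dummy \<open>PVar 0\<close>, so that \<open>PVar i\<close> sits at
    \<open>m + i\<close> and \<open>QVar i\<close> at \<open>m - i\<close>.\<close>
  let ?K = "Poly_Mapping.keys F" and ?v = "indet_enum m" and ?n = "Suc (2 * m)"
  obtain t0 where t0: "t0 \<in> ?K" using \<open>F \<noteq> 0\<close> by (metis equals0I keys_eq_empty)
  have inj_v: "inj_on ?v {..<?n}"
    by (auto simp: inj_on_def indet_enum_def split: if_splits)
  have vars: "PVar ` {1..m} \<union> QVar ` {1..m} \<subseteq> ?v ` {..<?n}"
  proof
    fix x assume "x \<in> PVar ` {1..m} \<union> QVar ` {1..m}"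
    then consider i where "i \<in> {1..m}" "x = PVar i" | i where "i \<in> {1..m}" "x = QVar i" by blast
    then show "x \<in> ?v ` {..<?n}"
    proof cases
      case 1
      then show ?thesis by (intro image_eqI[of _ _ "m + i"]) (auto simp: indet_enum_def)
    next
      case 2
      then show ?thesis by (intro image_eqI[of _ _ "m - i"]) (auto simp: indet_enum_def)
    qed
  qed
  have keys: "Poly_Mapping.keys t \<subseteq> ?v ` {..<?n}" if "t \<in> ?K" for t
    using F that unfolding pq_polys_def by (intro order.trans[OF _ vars]) blast
  \<comment> \<open>The sum of all degrees is a convenient strict bound, after adding one, for every
    single exponent in \<open>F\<close>.\<close>
  define D where "D = Suc (\<Sum>t\<in>?K. monom_degree t)"
  have D1: "D \<ge> 1" by (simp add: D_def)
  have lt: "Poly_Mapping.lookup t x < D" if t: "t \<in> ?K" for t x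
  proof -
    have "Poly_Mapping.lookup t x \<le> monom_degree t"
    proof (cases "x \<in> Poly_Mapping.keys t")
      case True
      then show ?thesis unfolding monom_degree_def by (intro member_le_sum) auto
    next
      case False
      then show ?thesis by (simp add: in_keys_iff)
    qed
    also have "\<dots> \<le> (\<Sum>t\<in>?K. monom_degree t)" using t by (intro member_le_sum) auto
    finally show ?thesis by (simp add: D_def)
  qed
  define w where "w t = (\<Sum>j<?n. Poly_Mapping.lookup t (?v j) * D ^ j)" for t
  have inj_w: "inj_on w ?K"
  proof (rule inj_onI)
    fix s t assume st: "s \<in> ?K" "t \<in> ?K" "w s = w t"
    have "Poly_Mapping.lookup s (?v j) = Poly_Mapping.lookup t (?v j)" if "j < ?n" for j
      by (rule base_expansion_unique[of ?n "\<lambda>j. Poly_Mapping.lookup s (?v j)" D "\<lambda>j. Poly_Mapping.lookup t (?v j)" j,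
            OF lt[OF st(1)] lt[OF st(2)] st(3)[unfolded w_def] that])
    then have "Poly_Mapping.lookup s x = Poly_Mapping.lookup t x" if "x \<in> ?v ` {..<?n}" for x
      using that by (elim imageE) simp
    moreover have "Poly_Mapping.lookup s x = Poly_Mapping.lookup t x" if "x \<notin> ?v ` {..<?n}" for x
      using that keys[OF st(1)] keys[OF st(2)] by (metis in_keys_iff subsetD)
    ultimately show "s = t" by (intro poly_mapping_eqI) blast
  qed
  define Q :: "complex Polynomial.poly" where
    "Q = (\<Sum>t\<in>?K. Polynomial.monom (of_int (Poly_Mapping.lookup F t)) (w t))"
  have "poly Q (of_nat N) = 0" if N: "N \<ge> k" "N \<ge> 1" for N
  proof -
    let ?f = "\<lambda>v. (case v of PVar i \<Rightarrow> of_nat (N ^ D ^ (m + i)) | QVar i \<Rightarrow> of_nat (N ^ D ^ (m - i))) :: complex"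
    have fv: "?f (?v j) = of_nat N ^ D ^ j" for j
      by (simp add: indet_enum_def)
    have "monom_eval ?f t = of_nat N ^ w t" if "t \<in> ?K" for t
    proof -
      have "monom_eval ?f t = (\<Prod>x\<in>?v ` {..<?n}. ?f x ^ Poly_Mapping.lookup t x)"
        by (rule monom_eval_superset[OF _ keys[OF that]]) simp
      also have "\<dots> = (\<Prod>j<?n. ?f (?v j) ^ Poly_Mapping.lookup t (?v j))"
        by (rule prod.reindex_cong[OF inj_v refl refl])
      also have "\<dots> = (\<Prod>j<?n. of_nat N ^ (Poly_Mapping.lookup t (?v j) * D ^ j))"
        unfolding fv by (simp only: power_mult[symmetric] mult.commute)
      also have "\<dots> = of_nat N ^ w t" unfolding w_def by (rule power_sum[symmetric])
      finally show ?thesis .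
    qed
    then have "(\<Sum>t\<in>?K. of_int (Poly_Mapping.lookup F t) * monom_eval ?f t) =
        (\<Sum>t\<in>?K. of_int (Poly_Mapping.lookup F t) * of_nat N ^ w t)"
      by (intro sum.cong refl arg_cong2[where f = "(*)"])
    also have "\<dots> = poly Q (of_nat N)" by (simp add: Q_def poly_sum poly_monom)
    finally have "poly Q (of_nat N) = eval_pq (\<lambda>i. N ^ D ^ (m + i)) (\<lambda>i. N ^ D ^ (m - i)) F"
      by (simp only: eval_pq_def subst_eq)
    then show ?thesis using ev[OF N D1] by simp
  qed
  then have "of_nat ` {max k 1..} \<subseteq> {x. poly Q x = 0}" by auto
  moreover have "infinite (of_nat ` {max k 1..} :: complex set)"
    by (subst finite_image_iff) (auto simp: inj_on_def infinite_Ici)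
  ultimately have "Q = 0" using poly_roots_finite finite_subset by blast
  \<comment> \<open>As \<open>w\<close> is injective on the support, no other monomial contributes
    to this power.\<close>
  moreover have "coeff Q (w t0) = of_int (Poly_Mapping.lookup F t0)"
  proof -
    have "coeff Q (w t0) = (\<Sum>t\<in>?K. if t = t0 then of_int (Poly_Mapping.lookup F t) else 0)"
      unfolding Q_def coeff_sum coeff_monom
      using inj_w t0 by (intro sum.cong refl) (auto dest: inj_onD)
    then show ?thesis using t0 by simp
  qed
  ultimately show False using t0 by (simp add: in_keys_iff)
qed

text \<open>The points of the Kronecker substitution are admissible shapes: the values of q decrease
  with the index because the exponent \<open>m - i\<close> does.\<close>

lemma is_stanley_poly_unique:
  assumes m: "m \<ge> 1" and F: "is_stanley_poly m k F" and G: "is_stanley_poly m k G"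
  shows "F = G"
proof -
  have "F - G = 0"
  proof (rule pq_poly_eq_0)
    show "F - G \<in> pq_polys m"
      using F G keys_diff[of F G] unfolding is_stanley_poly_def pq_polys_def by blast
    fix N D :: nat assume N: "N \<ge> k" "N \<ge> 1" and D: "D \<ge> 1"
    let ?p = "\<lambda>i. N ^ D ^ (m + i)" and ?q = "\<lambda>i. N ^ D ^ (m - i)"
    have 1: "\<forall>i\<in>{1..m}. ?p i \<ge> 1 \<and> ?q i \<ge> 1" using N by simp
    have 2: "\<forall>i\<in>{1..m}. \<forall>j\<in>{1..m}. i \<le> j \<longrightarrow> ?q j \<le> ?q i"
      using N D by (auto intro!: power_increasing)
    \<comment> \<open>The first block, which exists as \<open>m \<ge> 1\<close>, alone has at least
      \<open>N \<ge> k\<close> rows.\<close>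
    have 3: "k \<le> (\<Sum>i=1..m. ?p i * ?q i)"
    proof -
      have "k \<le> N ^ 1" using N by simp
      also have "N ^ 1 \<le> ?p 1" using N D by (intro power_increasing) auto
      also have "?p 1 \<le> ?p 1 * ?q 1" using N by simp
      also have "\<dots> \<le> (\<Sum>i=1..m. ?p i * ?q i)"
        using m by (intro member_le_sum[of 1 "{1..m}" "\<lambda>i. ?p i * ?q i"]) auto
      finally show ?thesis .
    qed
    have "eval_pq ?p ?q H = norm_char (shape m ?p ?q) {#k#}" if H: "is_stanley_poly m k H" for H
      using H[unfolded is_stanley_poly_def, THEN conjunct2, THEN spec[of _ ?p], THEN spec[of _ ?q]]
        1 2 3 by (elim impE)
    from this[OF F] this[OF G] have "eval_pq ?p ?q F = eval_pq ?p ?q G" by simp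
    then show "eval_pq ?p ?q (F - G) = 0"
      by (simp add: eval_pq_def subst_diff)
  qed
  then show ?thesis by simp
qed

section \<open>The symmetrizer on a conjugacy class\<close>

context young_filling
begin

text \<open>
  If \<open>a b\<close> is conjugate to a permutation \<open>\<tau>\<close> that fixes all points outside \<open>K\<close>, then so do the
  conjugates of \<open>a\<close> and \<open>b\<close>: a point \<open>y\<close> with \<open>a (b y) = y\<close> satisfies \<open>b y = y\<close>, because \<open>b\<close> keeps
  the column and \<open>inv a\<close> the row.
\<close>

lemma symmetrizer_conjugate:
  assumes K: "K \<subseteq> A" and \<tau>: "\<tau> permutes K" and g: "g permutes A"
  shows "symmetrizer (inv g \<circ> \<tau> \<circ> g) =
    (\<Sum>\<alpha> | \<alpha> permutes K \<and> (\<forall>x. r (inv g (\<alpha> x)) = r (inv g x)) \<and> (\<forall>x. c (inv g (\<alpha> (\<tau> x))) = c (inv g x)).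
       of_int (sign (\<alpha> \<circ> \<tau>)))"
  unfolding symmetrizer_def
\<comment> \<open>\<open>\<alpha>\<close> is the conjugate of \<open>inv a\<close>. Then
  \<open>\<alpha> \<circ> \<tau>\<close> is the conjugate of \<open>b\<close>, which explains both
  the column condition on \<open>\<alpha> \<circ> \<tau>\<close> and its sign.\<close>
proof (rule sum.reindex_bij_witness[where
      i = "\<lambda>\<alpha>. (inv g \<circ> inv \<alpha> \<circ> g, inv g \<circ> \<alpha> \<circ> \<tau> \<circ> g)" and j = "\<lambda>(a, b). g \<circ> inv a \<circ> inv g"], goal_cases)
  note [simp] = permutes_inv_comp_left[OF g] permutes_inv_comp_right[OF g]
  have \<tau>A: "\<tau> permutes A" using \<tau> K by (rule permutes_subset)
  have ig: "inv g permutes A" using g by (rule permutes_inv)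
  {
    case (1 ab)
    then obtain a b where ab: "ab = (a, b)" "a \<in> row_perms" "b \<in> col_perms" "a \<circ> b = inv g \<circ> \<tau> \<circ> g" by blast
    note ap = row_permsD(1)[OF ab(2)]
    have "inv (g \<circ> inv a \<circ> inv g) = g \<circ> a \<circ> inv g"
      using ap by (intro inv_unique_comp) (simp_all add: fun_eq_iff)
    moreover have "inv a (inv g (\<tau> (g x))) = b x" for x
      using fun_cong[OF ab(4), of x] ap by simp (metis permutes_inv_comp_left)
    ultimately show ?case by (simp add: ab(1) fun_eq_iff)
  next
    case (2 ab)
    then obtain a b where ab: "ab = (a, b)" "a \<in> row_perms" "b \<in> col_perms" "a \<circ> b = inv g \<circ> \<tau> \<circ> g" by blast
    note ap = row_permsD(1)[OF ab(2)]
    have eq: "a (b x) = inv g (\<tau> (g x))" for x using fun_cong[OF ab(4), of x] by simp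
    have bx: "b x = inv a (inv g (\<tau> (g x)))" for x using eq[of x] ap by (metis permutes_inv_comp_left)
    let ?\<alpha> = "g \<circ> inv a \<circ> inv g"
    have "?\<alpha> permutes A" using g ap by (intro permutes_compose permutes_inv)
    moreover have "?\<alpha> x = x" if x: "x \<in> A - K" for x
    proof -
      let ?y = "inv g x"
      have yA: "?y \<in> A" using x permutes_in_image[OF ig] by blast
      have by0: "b ?y = inv a ?y" using bx[of ?y] x \<tau> by (simp add: permutes_not_in)
      have "b ?y \<in> A" using yA permutes_in_image[OF col_permsD(1)[OF ab(3)]] by blast
      moreover have "r (b ?y) = r ?y" unfolding by0 by (rule row_permsD(2)[OF row_perms_inv[OF ab(2)]])
      ultimately have "b ?y = ?y" using inj yA col_permsD(2)[OF ab(3)] by blast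
      then show ?thesis using by0 by simp
    qed
    ultimately have "?\<alpha> permutes K" by (rule permutes_superset)
    moreover have "r (inv g (?\<alpha> x)) = r (inv g x)" for x
      using row_permsD(2)[OF row_perms_inv[OF ab(2)]] by simp
    moreover have "c (inv g (?\<alpha> (\<tau> x))) = c (inv g x)" for x
      using col_permsD(2)[OF ab(3), of "inv g x"] bx[of "inv g x"] by simp
    ultimately show ?case by (simp add: ab(1))
  next
    case (3 \<alpha>)
    then have \<alpha>: "\<alpha> permutes A" using K permutes_subset by blast
    then have "inv (inv g \<circ> inv \<alpha> \<circ> g) = inv g \<circ> \<alpha> \<circ> g"
      by (intro inv_unique_comp) (simp_all add: fun_eq_iff)
    then show ?case by (simp add: fun_eq_iff)
  next
    case (4 \<alpha>)
    then have \<alpha>: "\<alpha> permutes A" using K permutes_subset by blast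
    have "inv g \<circ> inv \<alpha> \<circ> g permutes A" "inv g \<circ> \<alpha> \<circ> \<tau> \<circ> g permutes A"
      using g \<alpha> \<tau>A by (simp_all add: permutes_compose permutes_inv)
    moreover have "r (inv g (inv \<alpha> (g x))) = r x" for x
    proof -
      have "r (inv g (\<alpha> (inv \<alpha> (g x)))) = r (inv g (inv \<alpha> (g x)))" using 4 by blast
      then show ?thesis using \<alpha> by simp
    qed
    moreover have "c (inv g (\<alpha> (\<tau> (g x)))) = c x" for x
    proof -
      have "c (inv g (\<alpha> (\<tau> (g x)))) = c (inv g (g x))" using 4 by blast
      then show ?thesis by simp
    qed
    ultimately have "inv g \<circ> inv \<alpha> \<circ> g \<in> row_perms" "inv g \<circ> \<alpha> \<circ> \<tau> \<circ> g \<in> col_perms"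
      by (simp_all add: row_perms_def col_perms_def)
    moreover have "(inv g \<circ> inv \<alpha> \<circ> g) \<circ> (inv g \<circ> \<alpha> \<circ> \<tau> \<circ> g) = inv g \<circ> \<tau> \<circ> g"
      using \<alpha> by (simp add: fun_eq_iff)
    ultimately show ?case by simp
  next
    case (5 ab)
    then obtain a b where ab: "ab = (a, b)" "a \<in> row_perms" "b \<in> col_perms" "a \<circ> b = inv g \<circ> \<tau> \<circ> g" by blast
    note ap = row_permsD(1)[OF ab(2)]
    have P: "permutation p" if "p permutes A" for p using that fin permutation_permutes by blast
    have "inv a (inv g (\<tau> x)) = b (inv g x)" for x
      using fun_cong[OF ab(4), of "inv g x"] ap by simp (metis permutes_inv_comp_left)
    then have "g \<circ> inv a \<circ> inv g \<circ> \<tau> = g \<circ> b \<circ> inv g" by (simp add: fun_eq_iff)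
    moreover have "sign (g \<circ> b \<circ> inv g) = sign b"
      using P[OF g] P[OF ig] P[OF col_permsD(1)[OF ab(3)]]
      by (simp add: sign_compose permutation_compose sign_inverse)
    ultimately show ?case by (simp add: ab(1))
  }
qed

end

text \<open>The extensions form a coset: fix one, \<open>g0\<close>, and compose it with the
  permutations of \<open>A - K\<close>.\<close>

lemma card_permutations_extending:
  assumes fin: "finite A" and K: "K \<subseteq> A" and h: "h \<in> K \<rightarrow>\<^sub>E A" "inj_on h K"
  shows "card {g. g permutes A \<and> restrict g K = h} = fact (card (A - K))"
proof -
  have "h ` K \<subseteq> A" using h(1) by (auto simp: PiE_def)
  then obtain g0 where g0: "g0 permutes A" "\<forall>x\<in>K. g0 x = h x"
    using extend_injection_to_permutation[OF fin K h(2)] by blast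
  have "bij_betw (\<lambda>f. g0 \<circ> f) {f. f permutes A - K} {g. g permutes A \<and> restrict g K = h}"
  proof (rule bij_betw_byWitness[where f' = "\<lambda>f. inv g0 \<circ> f"])
    show "\<forall>f\<in>{f. f permutes A - K}. inv g0 \<circ> (g0 \<circ> f) = f"
      using g0(1) by (simp add: fun_eq_iff)
    show "\<forall>f\<in>{g. g permutes A \<and> restrict g K = h}. g0 \<circ> (inv g0 \<circ> f) = f"
      using g0(1) by (simp add: fun_eq_iff)
    show "(\<lambda>f. g0 \<circ> f) ` {f. f permutes A - K} \<subseteq> {g. g permutes A \<and> restrict g K = h}"
    proof clarify
      fix f assume f: "f permutes A - K"
      have "f permutes A" using f by (rule permutes_subset) simp
      moreover have "restrict (g0 \<circ> f) K = h"
      proof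
        fix x show "restrict (g0 \<circ> f) K x = h x"
          using g0(2) permutes_not_in[OF f, of x] PiE_arb[OF h(1), of x] by (cases "x \<in> K") simp_all
      qed
      ultimately show "g0 \<circ> f permutes A \<and> restrict (g0 \<circ> f) K = h"
        using g0(1) permutes_compose by blast
    qed
    show "(\<lambda>f. inv g0 \<circ> f) ` {g. g permutes A \<and> restrict g K = h} \<subseteq> {f. f permutes A - K}"
    proof clarify
      fix f assume f: "f permutes A" "h = restrict f K"
      show "inv g0 \<circ> f permutes A - K"
      proof (rule permutes_superset)
        show "inv g0 \<circ> f permutes A" using f(1) permutes_inv[OF g0(1)] by (rule permutes_compose)
        fix x assume "x \<in> A - (A - K)"
        then have "g0 x = f x" using g0(2) f(2) by simp
        then show "(inv g0 \<circ> f) x = x" using g0(1) by (metis comp_apply permutes_inv_comp_left)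
      qed
    qed
  qed
  then have "card {g. g permutes A \<and> restrict g K = h} = card {f. f permutes A - K}"
    by (rule bij_betw_same_card[symmetric])
  then show ?thesis using fin card_permutations[OF refl, of "A - K"] by simp
qed

text \<open>The factor counts the extensions of one injection. For \<open>K = {1..k}\<close> it is
  the (n - k)! that completes the falling factorial of \<open>norm_char\<close> to n!.\<close>

lemma sum_permutations_restrict:
  fixes \<Phi> :: "_ \<Rightarrow> complex"
  assumes fin: "finite A" and K: "K \<subseteq> A"
  shows "(\<Sum>g | g permutes A. \<Phi> (restrict g K)) = fact (card (A - K)) * (\<Sum>h | h \<in> K \<rightarrow>\<^sub>E A \<and> inj_on h K. \<Phi> h)"
proof -
  let ?G = "{g. g permutes A}" and ?H = "{h. h \<in> K \<rightarrow>\<^sub>E A \<and> inj_on h K}"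
  have finK: "finite K" using K fin by (rule finite_subset)
  have finH: "finite ?H" using finite_PiE[OF finK, of "\<lambda>_. A"] fin by simp
  have img: "(\<lambda>g. restrict g K) ` ?G \<subseteq> ?H"
  proof clarify
    fix g assume g: "g permutes A"
    show "restrict g K \<in> K \<rightarrow>\<^sub>E A \<and> inj_on (restrict g K) K"
      using K permutes_in_image[OF g] permutes_inj_on[OF g, of K] by (auto simp: inj_on_def)
  qed
  have "(\<Sum>g\<in>?G. \<Phi> (restrict g K)) = (\<Sum>h\<in>?H. \<Sum>g\<in>{g \<in> ?G. restrict g K = h}. \<Phi> (restrict g K))"
    by (rule sum.group[OF finite_permutations[OF fin] finH img, symmetric])
  also have "\<dots> = (\<Sum>h\<in>?H. fact (card (A - K)) * \<Phi> h)"
  proof (rule sum.cong[OF refl])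
    fix h assume "h \<in> ?H"
    then have h: "h \<in> K \<rightarrow>\<^sub>E A" "inj_on h K" by auto
    have "(\<Sum>g\<in>{g \<in> ?G. restrict g K = h}. \<Phi> (restrict g K)) = (\<Sum>g\<in>{g \<in> ?G. restrict g K = h}. \<Phi> h)"
      by (rule sum.cong) auto
    also have "\<dots> = of_nat (card {g. g permutes A \<and> restrict g K = h}) * \<Phi> h" by simp
    finally show "(\<Sum>g\<in>{g \<in> ?G. restrict g K = h}. \<Phi> (restrict g K)) = fact (card (A - K)) * \<Phi> h"
      by (simp add: card_permutations_extending[OF fin K h])
  qed
  finally show ?thesis by (simp add: sum_distrib_left)
qed

text \<open>The index set of the sum in \<open>symmetrizer_conjugate\<close>, with
  \<open>inv g\<close> replaced by an arbitrary map \<open>h\<close>: rows are constant on the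
  cycles of \<open>\<alpha>\<close>, columns on those of
  \<open>\<alpha> \<circ> \<tau>\<close>.\<close>

definition invariant_factors :: "'a set \<Rightarrow> ('b \<Rightarrow> nat) \<Rightarrow> ('b \<Rightarrow> nat) \<Rightarrow> ('a \<Rightarrow> 'a) \<Rightarrow> ('a \<Rightarrow> 'b) \<Rightarrow> ('a \<Rightarrow> 'a) set" where
  "invariant_factors K r c \<tau> h =
     {\<alpha>. \<alpha> permutes K \<and> (\<forall>x. r (h (\<alpha> x)) = r (h x)) \<and> (\<forall>x. c (h (\<alpha> (\<tau> x))) = c (h x))}"

lemma invariant_factors_restrict:
  assumes "\<tau> permutes K"
  shows "invariant_factors K r c \<tau> (restrict h K) = invariant_factors K r c \<tau> h"
proof -
  have "(r (restrict h K (\<alpha> x)) = r (restrict h K x)) = (r (h (\<alpha> x)) = r (h x))"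
    "(c (restrict h K (\<alpha> (\<tau> x))) = c (restrict h K x)) = (c (h (\<alpha> (\<tau> x))) = c (h x))"
    if "\<alpha> permutes K" for \<alpha> x
    using that assms permutes_in_image[OF that] permutes_in_image[OF assms]
    by (cases "x \<in> K"; simp add: permutes_not_in)+
  then show ?thesis unfolding invariant_factors_def by blast
qed

text \<open>Composition with a transposition of two points with the same image under \<open>h\<close> reverses the sign.\<close>

lemma sum_sign_invariant_factors_eq_0:
  assumes fin: "finite K" and \<tau>: "\<tau> permutes K" and xy: "x \<in> K" "y \<in> K" "x \<noteq> y" "h x = h y"
  shows "(\<Sum>\<alpha>\<in>invariant_factors K r c \<tau> h. of_int (sign (\<alpha> \<circ> \<tau>))) = (0 :: complex)"
proof -
  let ?t = "Transposition.transpose x y" and ?I = "invariant_factors K r c \<tau> h"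
  let ?s = "\<lambda>\<alpha>. of_int (sign (\<alpha> \<circ> \<tau>)) :: complex"
  have t: "?t permutes K" using xy by (intro permutes_swap_id)
  have ht: "h (?t z) = h z" for z using xy(4) by (simp add: Transposition.transpose_def)
  have tt: "?t \<circ> (?t \<circ> \<alpha>) = \<alpha>" for \<alpha> by (simp add: fun_eq_iff)
  have closed: "?t \<circ> \<alpha> \<in> ?I" if "\<alpha> \<in> ?I" for \<alpha>
    using that permutes_compose[OF _ t, of \<alpha>] ht by (simp add: invariant_factors_def)
  have "sum ?s ?I = (\<Sum>\<alpha>\<in>?I. ?s (?t \<circ> \<alpha>))"
    by (rule sum.reindex_bij_witness[where i = "\<lambda>\<alpha>. ?t \<circ> \<alpha>" and j = "\<lambda>\<alpha>. ?t \<circ> \<alpha>"])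
      (simp_all only: closed tt)
  also have "\<dots> = (\<Sum>\<alpha>\<in>?I. - ?s \<alpha>)"
  proof (rule sum.cong[OF refl])
    fix \<alpha> assume "\<alpha> \<in> ?I"
    then have "\<alpha> \<circ> \<tau> permutes K" using \<tau> permutes_compose by (auto simp: invariant_factors_def)
    then have "permutation (\<alpha> \<circ> \<tau>)" using fin permutation_permutes by blast
    then have "sign (?t \<circ> (\<alpha> \<circ> \<tau>)) = - sign (\<alpha> \<circ> \<tau>)"
      using xy(3) by (simp add: sign_compose permutation_swap_id sign_swap_id)
    then show "?s (?t \<circ> \<alpha>) = - ?s \<alpha>" by (simp add: comp_assoc)
  qed
  finally have "sum ?s ?I = - sum ?s ?I" by (simp add: sum_negf)
  then show ?thesis by simp
qed

context young_filling
begin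

text \<open>The summand depends on \<open>inv g\<close> only through its values on \<open>K\<close>,
  so the sum over the group becomes one over maps \<open>h\<close>; exchanging it with the sum over
  \<open>\<alpha>\<close> leaves a count of maps for each \<open>\<alpha>\<close>.\<close>

lemma symmetrizer_class_sum:
  assumes K: "K \<subseteq> A" and \<tau>: "\<tau> permutes K"
  shows "(\<Sum>g | g permutes A. symmetrizer (inv g \<circ> \<tau> \<circ> g)) =
    fact (card (A - K)) * (\<Sum>\<alpha> | \<alpha> permutes K. of_int (sign (\<alpha> \<circ> \<tau>)) *
      of_nat (card {h \<in> K \<rightarrow>\<^sub>E A. \<alpha> \<in> invariant_factors K r c \<tau> h}))"
proof -
  let ?I = "invariant_factors K r c \<tau>"
  have finK: "finite K" using K fin by (rule finite_subset)
  have finH: "finite (K \<rightarrow>\<^sub>E A)" using finite_PiE[OF finK, of "\<lambda>_. A"] fin by simp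
  define \<Phi> where "\<Phi> h = (\<Sum>\<alpha>\<in>?I h. of_int (sign (\<alpha> \<circ> \<tau>)) :: complex)" for h
  have "(\<Sum>g | g permutes A. symmetrizer (inv g \<circ> \<tau> \<circ> g)) = (\<Sum>g | g permutes A. \<Phi> (inv g))"
    unfolding \<Phi>_def invariant_factors_def using symmetrizer_conjugate[OF K \<tau>] by (intro sum.cong refl) simp
  also have "\<dots> = (\<Sum>g | g permutes A. \<Phi> g)" by (rule sum_permutations_inverse[symmetric])
  also have "\<dots> = (\<Sum>g | g permutes A. \<Phi> (restrict g K))"
    unfolding \<Phi>_def invariant_factors_restrict[OF \<tau>] ..
  also have "\<dots> = fact (card (A - K)) * (\<Sum>h | h \<in> K \<rightarrow>\<^sub>E A \<and> inj_on h K. \<Phi> h)"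
    by (rule sum_permutations_restrict[OF fin K])
  \<comment> \<open>Non-injective maps enter at no cost, since their signed sums vanish.\<close>
  also have "(\<Sum>h | h \<in> K \<rightarrow>\<^sub>E A \<and> inj_on h K. \<Phi> h) = (\<Sum>h\<in>K \<rightarrow>\<^sub>E A. \<Phi> h)"
  proof (rule sum.mono_neutral_left[OF finH], blast, rule ballI)
    fix h assume "h \<in> (K \<rightarrow>\<^sub>E A) - {h. h \<in> K \<rightarrow>\<^sub>E A \<and> inj_on h K}"
    then have "\<not> inj_on h K" by blast
    then obtain x y where "x \<in> K" "y \<in> K" "x \<noteq> y" "h x = h y" unfolding inj_on_def by blast
    then show "\<Phi> h = 0" unfolding \<Phi>_def by (rule sum_sign_invariant_factors_eq_0[OF finK \<tau>])
  qed
  also have "\<dots> = (\<Sum>h\<in>K \<rightarrow>\<^sub>E A. \<Sum>\<alpha>\<in>{\<alpha> \<in> {\<alpha>. \<alpha> permutes K}. \<alpha> \<in> ?I h}. of_int (sign (\<alpha> \<circ> \<tau>)))"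
    unfolding \<Phi>_def by (intro sum.cong refl) (auto simp: invariant_factors_def)
  also have "\<dots> = (\<Sum>\<alpha> | \<alpha> permutes K. \<Sum>h\<in>{h \<in> K \<rightarrow>\<^sub>E A. \<alpha> \<in> ?I h}. of_int (sign (\<alpha> \<circ> \<tau>)))"
    by (rule sum.swap_restrict[OF finH finite_permutations[OF finK]])
  also have "\<dots> = (\<Sum>\<alpha> | \<alpha> permutes K. of_int (sign (\<alpha> \<circ> \<tau>)) * of_nat (card {h \<in> K \<rightarrow>\<^sub>E A. \<alpha> \<in> ?I h}))"
    by (simp add: mult.commute)
  finally show ?thesis .
qed

end

section \<open>Counting labellings\<close>

definition max_colour :: "'a set set \<Rightarrow> ('a set \<Rightarrow> nat) \<Rightarrow> 'a set \<Rightarrow> nat" where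
  "max_colour C \<psi> u = Max (\<psi> ` {w \<in> C. w \<inter> u \<noteq> {}})"

text \<open>Each cycle of \<open>\<alpha>\<close> that meets \<open>u\<close> is the orbit of a
  point of \<open>u\<close>, so the maximum over cycles turns into one over points: attained in the
  first claim, an upper bound in the second.\<close>

lemma max_colour_cycles:
  assumes fin: "finite K" and \<alpha>: "\<alpha> permutes K" and \<gamma>: "\<gamma> permutes K" and u: "u \<in> cycles_on K \<gamma>"
  shows "\<exists>x\<in>u. x \<in> K \<and> max_colour (cycles_on K \<alpha>) \<psi> u = \<psi> (orbit \<alpha> x)"
    and "x \<in> u \<Longrightarrow> \<psi> (orbit \<alpha> x) \<le> max_colour (cycles_on K \<alpha>) \<psi> u"
proof -
  let ?W = "{w \<in> cycles_on K \<alpha>. w \<inter> u \<noteq> {}}"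
  have finW: "finite ?W" using fin by (simp add: cycles_on_def)
  obtain z where z: "z \<in> K" "u = orbit \<gamma> z" using u by (auto simp: cycles_on_def)
  have uK: "u \<subseteq> K" using permutes_orbit_subset[OF \<gamma> z(1)] z(2) by simp
  have W: "orbit \<alpha> y \<in> ?W" if "y \<in> u" for y
    using that uK self_in_orbit[OF fin \<alpha>, of y] by (auto simp: cycles_on_def)
  have "z \<in> u" using self_in_orbit[OF fin \<gamma>] z(2) by simp
  then have "?W \<noteq> {}" using W by blast
  then have "max_colour (cycles_on K \<alpha>) \<psi> u \<in> \<psi> ` ?W"
    unfolding max_colour_def using finW by (intro Max_in) auto
  then obtain w where w: "w \<in> cycles_on K \<alpha>" "w \<inter> u \<noteq> {}" "max_colour (cycles_on K \<alpha>) \<psi> u = \<psi> w" by blast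
  then obtain x where x: "x \<in> w" "x \<in> u" by blast
  obtain y where "w = orbit \<alpha> y" using w(1) by (auto simp: cycles_on_def)
  then have "w = orbit \<alpha> x" using orbit_eq[OF fin \<alpha>, of x y] x(1) by simp
  then show "\<exists>x\<in>u. x \<in> K \<and> max_colour (cycles_on K \<alpha>) \<psi> u = \<psi> (orbit \<alpha> x)"
    using x uK w(3) by blast
  show "x \<in> u \<Longrightarrow> \<psi> (orbit \<alpha> x) \<le> max_colour (cycles_on K \<alpha>) \<psi> u" for x
    unfolding max_colour_def using finW W[of x] by (intro Max_ge) auto
qed

text \<open>
  In this lemma \<open>L\<close> lists the colours of the rows, so that \<open>map q L\<close> is the shape; the column that
  \<open>h\<close> assigns to a cycle of \<open>\<gamma>\<close> is bounded by the shortest row that \<open>h\<close> assigns to one of its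
  elements, which is the one of the largest colour.
\<close>

lemma bij_betw_row_col_labellings:
  fixes q :: "nat \<Rightarrow> nat" and L :: "nat list"
  defines "\<omega> \<equiv> map q L"
  assumes fin: "finite K" and \<alpha>: "\<alpha> permutes K" and \<tau>: "\<tau> permutes K"
    and L: "set L \<subseteq> {1..m}" and q: "\<And>i j. i \<in> {1..m} \<Longrightarrow> j \<in> {1..m} \<Longrightarrow> i \<le> j \<Longrightarrow> q j \<le> q i"
  shows "bij_betw (\<lambda>(f, e). \<lambda>x\<in>K. tableau_entry \<omega> (f (orbit \<alpha> x)) (e (orbit (\<alpha> \<circ> \<tau>) x)))
    (SIGMA f:cycles_on K \<alpha> \<rightarrow>\<^sub>E {..<length L}.
       \<Pi>\<^sub>E u\<in>cycles_on K (\<alpha> \<circ> \<tau>). {..<q (max_colour (cycles_on K \<alpha>) (\<lambda>w. L ! f w) u)})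
    {h \<in> K \<rightarrow>\<^sub>E {1..sum_list \<omega>}. \<alpha> \<in> invariant_factors K (entry_row \<omega>) (entry_col \<omega>) \<tau> h}"
    (is "bij_betw ?\<theta> ?S ?H")
proof -
  let ?\<gamma> = "\<alpha> \<circ> \<tau>" and ?Ca = "cycles_on K \<alpha>" and ?Cg = "cycles_on K (\<alpha> \<circ> \<tau>)"
  let ?\<nu> = "\<lambda>f. max_colour ?Ca (\<lambda>w. L ! f w)"
  have \<gamma>: "?\<gamma> permutes K" using \<alpha> \<tau> permutes_compose by blast
  have Ca: "orbit \<alpha> x \<in> ?Ca" and Cg: "orbit ?\<gamma> x \<in> ?Cg" if "x \<in> K" for x
    using that by (auto simp: cycles_on_def)
  have nth: "\<omega> ! i = q (L ! i)" if "i < length L" for i using that by (simp add: \<omega>_def)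
  have len: "length \<omega> = length L" by (simp add: \<omega>_def)
  have box: "f (orbit \<alpha> x) < length \<omega>" "e (orbit ?\<gamma> x) < \<omega> ! f (orbit \<alpha> x)"
    if fe: "f \<in> ?Ca \<rightarrow>\<^sub>E {..<length L}" "e \<in> (\<Pi>\<^sub>E u\<in>?Cg. {..<q (?\<nu> f u)})" and x: "x \<in> K" for f e x
  proof -
    have fl: "f (orbit \<alpha> y) < length L" if "y \<in> K" for y using PiE_mem[OF fe(1) Ca[OF that]] by simp
    show "f (orbit \<alpha> x) < length \<omega>" using fl[OF x] by (simp add: len)
    obtain y where y: "y \<in> K" "?\<nu> f (orbit ?\<gamma> x) = L ! f (orbit \<alpha> y)"
      using max_colour_cycles(1)[OF fin \<alpha> \<gamma> Cg[OF x], of "\<lambda>w. L ! f w"] by blast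
    have "L ! f (orbit \<alpha> x) \<le> ?\<nu> f (orbit ?\<gamma> x)"
      using max_colour_cycles(2)[OF fin \<alpha> \<gamma> Cg[OF x] self_in_orbit[OF fin \<gamma>], of "\<lambda>w. L ! f w"] .
    moreover have "L ! f (orbit \<alpha> z) \<in> {1..m}" if "z \<in> K" for z
      using fl[OF that] L nth_mem by blast
    ultimately have "q (?\<nu> f (orbit ?\<gamma> x)) \<le> q (L ! f (orbit \<alpha> x))"
      using q x y by simp
    then show "e (orbit ?\<gamma> x) < \<omega> ! f (orbit \<alpha> x)"
      using PiE_mem[OF fe(2) Cg[OF x]] nth[OF fl[OF x]] by simp
  qed
  have row: "entry_row \<omega> (?\<theta> (f, e) x) = f (orbit \<alpha> x)" and col: "entry_col \<omega> (?\<theta> (f, e) x) = e (orbit ?\<gamma> x)"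
    and mem: "?\<theta> (f, e) x \<in> {1..sum_list \<omega>}"
    if fe: "f \<in> ?Ca \<rightarrow>\<^sub>E {..<length L}" "e \<in> (\<Pi>\<^sub>E u\<in>?Cg. {..<q (?\<nu> f u)})" and x: "x \<in> K" for f e x
    using entry_row_col[OF box[OF fe x]] x by simp_all
  show ?thesis
  proof (rule bij_betw_imageI)
    show "inj_on ?\<theta> ?S"
    proof (rule inj_onI)
      fix s s' assume "s \<in> ?S" "s' \<in> ?S" and eq': "?\<theta> s = ?\<theta> s'"
      then obtain f e f' e' where s: "s = (f, e)" "s' = (f', e')"
        and f: "f \<in> ?Ca \<rightarrow>\<^sub>E {..<length L}" and e: "e \<in> (\<Pi>\<^sub>E u\<in>?Cg. {..<q (?\<nu> f u)})"
        and f': "f' \<in> ?Ca \<rightarrow>\<^sub>E {..<length L}" and e': "e' \<in> (\<Pi>\<^sub>E u\<in>?Cg. {..<q (?\<nu> f' u)})"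
        by blast
      have eq: "?\<theta> (f, e) = ?\<theta> (f', e')" using eq' unfolding s .
      have orb: "f (orbit \<alpha> x) = f' (orbit \<alpha> x)" "e (orbit ?\<gamma> x) = e' (orbit ?\<gamma> x)" if "x \<in> K" for x
        using row[OF f e that] row[OF f' e' that] col[OF f e that] col[OF f' e' that] unfolding eq by simp_all
      have "f w = f' w" if "w \<in> ?Ca" for w using that orb(1) by (auto simp: cycles_on_def)
      then have "f = f'" by (rule PiE_ext[OF f f'])
      moreover have "e u = e' u" for u
      proof (cases "u \<in> ?Cg")
        case True
        then show ?thesis using orb(2) by (auto simp: cycles_on_def)
      next
        case False
        show ?thesis using PiE_arb[OF e False] PiE_arb[OF e' False] by simp
      qed
      ultimately show "s = s'" by (auto simp: s)
    qed
    show "?\<theta> ` ?S = ?H"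
    proof (intro equalityI subsetI)
      fix h assume "h \<in> ?\<theta> ` ?S"
      then obtain f e where f: "f \<in> ?Ca \<rightarrow>\<^sub>E {..<length L}" and e: "e \<in> (\<Pi>\<^sub>E u\<in>?Cg. {..<q (?\<nu> f u)})"
        and h: "h = ?\<theta> (f, e)" by blast
      have "h \<in> K \<rightarrow>\<^sub>E {1..sum_list \<omega>}" unfolding h using mem[OF f e] by (intro PiE_I) simp_all
      moreover have "entry_row \<omega> (h (\<alpha> x)) = entry_row \<omega> (h x)" for x
      proof (cases "x \<in> K")
        case True
        then have "\<alpha> x \<in> K" using permutes_in_image[OF \<alpha>] by blast
        show ?thesis unfolding h row[OF f e True] row[OF f e \<open>\<alpha> x \<in> K\<close>] orbit_apply[OF fin \<alpha>] ..
      next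
        case False
        then show ?thesis using permutes_not_in[OF \<alpha>] by simp
      qed
      moreover have "entry_col \<omega> (h (\<alpha> (\<tau> x))) = entry_col \<omega> (h x)" for x
      proof (cases "x \<in> K")
        case True
        then have gx: "?\<gamma> x \<in> K" using permutes_in_image[OF \<gamma>] by blast
        have "entry_col \<omega> (h (?\<gamma> x)) = entry_col \<omega> (h x)"
          unfolding h col[OF f e True] col[OF f e gx] orbit_apply[OF fin \<gamma>] ..
        then show ?thesis by simp
      next
        case False
        then show ?thesis using permutes_not_in[OF \<gamma> False] by simp
      qed
      ultimately show "h \<in> ?H" using \<alpha> by (simp add: invariant_factors_def)
    next
      fix h assume "h \<in> ?H"
      then have h: "h \<in> K \<rightarrow>\<^sub>E {1..sum_list \<omega>}"
        and hr: "\<And>x. entry_row \<omega> (h (\<alpha> x)) = entry_row \<omega> (h x)"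
        and hc: "\<And>x. entry_col \<omega> (h (?\<gamma> x)) = entry_col \<omega> (h x)"
        by (auto simp: invariant_factors_def)
      \<comment> \<open>By \<open>hr\<close> and \<open>hc\<close> the chosen representative of a
        cycle does not affect the value.\<close>
      define f where "f = (\<lambda>w\<in>?Ca. entry_row \<omega> (h (SOME x. x \<in> w)))"
      define e where "e = (\<lambda>u\<in>?Cg. entry_col \<omega> (h (SOME x. x \<in> u)))"
      have fx: "f (orbit \<alpha> x) = entry_row \<omega> (h x)" if "x \<in> K" for x
      proof -
        have "(SOME y. y \<in> orbit \<alpha> x) \<in> orbit \<alpha> x" using self_in_orbit[OF fin \<alpha>] by (rule someI)
        then have "entry_row \<omega> (h (SOME y. y \<in> orbit \<alpha> x)) = entry_row \<omega> (h x)"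
          by (rule orbit_invariant[where f = "\<lambda>x. entry_row \<omega> (h x)", OF hr])
        then show ?thesis using Ca[OF that] by (simp add: f_def)
      qed
      have ex: "e (orbit ?\<gamma> x) = entry_col \<omega> (h x)" if "x \<in> K" for x
      proof -
        have "(SOME y. y \<in> orbit ?\<gamma> x) \<in> orbit ?\<gamma> x" using self_in_orbit[OF fin \<gamma>] by (rule someI)
        then have "entry_col \<omega> (h (SOME y. y \<in> orbit ?\<gamma> x)) = entry_col \<omega> (h x)"
          by (rule orbit_invariant[where f = "\<lambda>x. entry_col \<omega> (h x)", OF hc])
        then show ?thesis unfolding e_def using Cg[OF that] by (simp only: restrict_apply' )
      qed
      have bx: "entry_row \<omega> (h x) < length L" "entry_col \<omega> (h x) < \<omega> ! entry_row \<omega> (h x)"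
        "tableau_entry \<omega> (entry_row \<omega> (h x)) (entry_col \<omega> (h x)) = h x" if "x \<in> K" for x
        using entry_in_box[OF PiE_mem[OF h that]] by (simp_all add: len)
      have "f \<in> ?Ca \<rightarrow>\<^sub>E {..<length L}"
      proof (rule PiE_I)
        fix w assume "w \<in> ?Ca"
        then obtain x where "x \<in> K" "w = orbit \<alpha> x" by (auto simp: cycles_on_def)
        then show "f w \<in> {..<length L}" using fx bx by simp
      qed (simp add: f_def)
      moreover have "e \<in> (\<Pi>\<^sub>E u\<in>?Cg. {..<q (?\<nu> f u)})"
      proof (rule PiE_I)
        fix u assume u: "u \<in> ?Cg"
        \<comment> \<open>At a point where the largest colour is attained, the row length is exactly
          the required bound.\<close>
        obtain x where x: "x \<in> u" "x \<in> K" "?\<nu> f u = L ! f (orbit \<alpha> x)"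
          using max_colour_cycles(1)[OF fin \<alpha> \<gamma> u, of "\<lambda>w. L ! f w"] by blast
        obtain z where z: "u = orbit ?\<gamma> z" using u by (auto simp: cycles_on_def)
        have "u = orbit ?\<gamma> x" using orbit_eq[OF fin \<gamma>, of x z] x(1) z by simp
        then have "e u = entry_col \<omega> (h x)" using ex[OF x(2)] by simp
        then show "e u \<in> {..<q (?\<nu> f u)}"
          using bx(1,2)[OF x(2)] nth fx[OF x(2)] x(3) by simp
      qed (simp add: e_def)
      moreover have "h = ?\<theta> (f, e)"
      proof
        fix x show "h x = ?\<theta> (f, e) x"
        proof (cases "x \<in> K")
          case True
          then show ?thesis using bx(3)[OF True] fx[OF True] ex[OF True] by simp
        next
          case False
          then show ?thesis using PiE_arb[OF h False] by simp
        qed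
      qed
      ultimately show "h \<in> ?\<theta> ` ?S" by blast
    qed
  qed
qed

text \<open>Row labellings are grouped by the colouring that they induce. The number of column
  labellings depends on the colouring only, and each colouring arises by choosing one row of the
  given colour for every cycle.\<close>

lemma card_row_col_labellings:
  fixes q :: "nat \<Rightarrow> nat" and L :: "nat list"
  defines "\<omega> \<equiv> map q L"
  assumes fin: "finite K" and \<alpha>: "\<alpha> permutes K" and \<tau>: "\<tau> permutes K"
    and L: "set L \<subseteq> {1..m}" and q: "\<And>i j. i \<in> {1..m} \<Longrightarrow> j \<in> {1..m} \<Longrightarrow> i \<le> j \<Longrightarrow> q j \<le> q i"
  shows "card {h \<in> K \<rightarrow>\<^sub>E {1..sum_list \<omega>}. \<alpha> \<in> invariant_factors K (entry_row \<omega>) (entry_col \<omega>) \<tau> h} =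
    (\<Sum>\<psi>\<in>cycles_on K \<alpha> \<rightarrow>\<^sub>E {1..m}. (\<Prod>w\<in>cycles_on K \<alpha>. card {i. i < length L \<and> L ! i = \<psi> w}) *
       (\<Prod>u\<in>cycles_on K (\<alpha> \<circ> \<tau>). q (max_colour (cycles_on K \<alpha>) \<psi> u)))"
proof -
  let ?Ca = "cycles_on K \<alpha>" and ?Cg = "cycles_on K (\<alpha> \<circ> \<tau>)"
  let ?F = "?Ca \<rightarrow>\<^sub>E {..<length L}" and ?P = "?Ca \<rightarrow>\<^sub>E {1..m}"
  let ?\<psi> = "\<lambda>f. \<lambda>w\<in>?Ca. L ! f w"
  let ?G = "\<lambda>\<psi>. \<Prod>u\<in>?Cg. q (max_colour ?Ca \<psi> u)"
  have finC: "finite ?Ca" "finite ?Cg" using fin by (auto simp: cycles_on_def)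
  have finF: "finite ?F" "finite ?P" using finC by (simp_all add: finite_PiE)
  have img: "?\<psi> ` ?F \<subseteq> ?P"
  proof clarify
    fix f assume f: "f \<in> ?F"
    have "L ! f w \<in> {1..m}" if "w \<in> ?Ca" for w
      using PiE_mem[OF f that] L nth_mem by (metis lessThan_iff subsetD)
    then show "?\<psi> f \<in> ?P" by (intro PiE_I) simp_all
  qed
  \<comment> \<open>The maximum reads colours of cycles only, so the extensional colouring may
    replace the plain composition.\<close>
  have mc: "max_colour ?Ca (\<lambda>w. L ! f w) u = max_colour ?Ca (?\<psi> f) u" for f u
    unfolding max_colour_def by (rule arg_cong[where f = Max], rule image_cong) simp_all
  have "card {h \<in> K \<rightarrow>\<^sub>E {1..sum_list \<omega>}. \<alpha> \<in> invariant_factors K (entry_row \<omega>) (entry_col \<omega>) \<tau> h} =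
      card (SIGMA f:?F. \<Pi>\<^sub>E u\<in>?Cg. {..<q (max_colour ?Ca (\<lambda>w. L ! f w) u)})"
    unfolding \<omega>_def by (rule bij_betw_same_card[OF bij_betw_row_col_labellings[OF fin \<alpha> \<tau> L q], symmetric])
  also have "\<dots> = (\<Sum>f\<in>?F. ?G (?\<psi> f))"
    using finF(1) finC by (subst card_SigmaI) (simp_all add: finite_PiE card_PiE mc)
  also have "\<dots> = (\<Sum>\<psi>\<in>?P. \<Sum>f\<in>{f \<in> ?F. ?\<psi> f = \<psi>}. ?G (?\<psi> f))"
    by (rule sum.group[OF finF img, symmetric])
  also have "\<dots> = (\<Sum>\<psi>\<in>?P. (\<Prod>w\<in>?Ca. card {i. i < length L \<and> L ! i = \<psi> w}) * ?G \<psi>)"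
  proof (rule sum.cong[OF refl])
    fix \<psi> assume \<psi>: "\<psi> \<in> ?P"
    have fibre: "{f \<in> ?F. ?\<psi> f = \<psi>} = (\<Pi>\<^sub>E w\<in>?Ca. {i. i < length L \<and> L ! i = \<psi> w})"
    proof (intro equalityI subsetI)
      fix f assume "f \<in> {f \<in> ?F. ?\<psi> f = \<psi>}"
      then have f: "f \<in> ?F" "?\<psi> f = \<psi>" by auto
      have "L ! f w = \<psi> w" if "w \<in> ?Ca" for w using fun_cong[OF f(2), of w] that by simp
      then show "f \<in> (\<Pi>\<^sub>E w\<in>?Ca. {i. i < length L \<and> L ! i = \<psi> w})"
        using PiE_mem[OF f(1)] PiE_arb[OF f(1)] by (intro PiE_I) simp_all
    next
      fix f assume f: "f \<in> (\<Pi>\<^sub>E w\<in>?Ca. {i. i < length L \<and> L ! i = \<psi> w})"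
      have "f \<in> ?F" using PiE_mem[OF f] PiE_arb[OF f] by (intro PiE_I) simp_all
      moreover have "?\<psi> f = \<psi>"
      proof
        fix w show "?\<psi> f w = \<psi> w"
          using PiE_mem[OF f, of w] PiE_arb[OF \<psi>, of w] by (cases "w \<in> ?Ca") simp_all
      qed
      ultimately show "f \<in> {f \<in> ?F. ?\<psi> f = \<psi>}" by simp
    qed
    have "(\<Sum>f\<in>{f \<in> ?F. ?\<psi> f = \<psi>}. ?G (?\<psi> f)) = (\<Sum>f\<in>{f \<in> ?F. ?\<psi> f = \<psi>}. ?G \<psi>)"
      by (rule sum.cong) auto
    also have "\<dots> = card {f \<in> ?F. ?\<psi> f = \<psi>} * ?G \<psi>" by simp
    also have "card {f \<in> ?F. ?\<psi> f = \<psi>} = (\<Prod>w\<in>?Ca. card {i. i < length L \<and> L ! i = \<psi> w})"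
      unfolding fibre by (rule card_PiE[OF finC(1)])
    finally show "(\<Sum>f\<in>{f \<in> ?F. ?\<psi> f = \<psi>}. ?G (?\<psi> f)) =
        (\<Prod>w\<in>?Ca. card {i. i < length L \<and> L ! i = \<psi> w}) * ?G \<psi>" .
  qed
  finally show ?thesis .
qed

section \<open>Shapes as images of the list \<open>shape m p id\<close> of block numbers\<close>

lemma map_shape: "map f (shape m p q) = shape m p (f \<circ> q)"
  by (simp add: shape_def map_concat comp_def map_replicate_const)

lemma shape_Suc: "shape (Suc m) p q = shape m p q @ replicate (p (Suc m)) (q (Suc m))"
  by (simp add: shape_def)

lemma set_shape: "set (shape m p q) \<subseteq> q ` {1..m}"
  by (induction m) (auto simp: shape_Suc shape_def[of 0])

lemma sorted_shape: "sorted (shape m p id)"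
proof (induction m)
  case 0
  then show ?case by (simp add: shape_def)
next
  case (Suc m)
  have "x \<le> Suc m" if "x \<in> set (shape m p id)" for x using set_shape[of m p id] that by auto
  with Suc show ?case by (auto simp: shape_Suc sorted_append id_def)
qed

lemma sum_list_shape: "sum_list (shape m p q) = (\<Sum>i=1..m. p i * q i)"
  by (induction m) (simp_all add: shape_Suc shape_def[of 0] sum_list_replicate)

lemma count_shape:
  "card {i. i < length (shape m p id) \<and> shape m p id ! i = j} = (if j \<in> {1..m} then p j else 0)"
proof -
  have "length (filter (\<lambda>x. x = j) (shape m p id)) = (if j \<in> {1..m} then p j else 0)"
    by (induction m) (auto simp: shape_Suc shape_def[of 0] filter_replicate)
  then show ?thesis by (simp add: length_filter_conv_card)
qed

section \<open>The character formula\<close>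

text \<open>Names the permutation hidden in \<open>irr_char\<close>. The conjugacy is stated for
  \<open>inv \<pi>\<close> because \<open>character_quotient\<close> evaluates the symmetrizer
  there.\<close>

lemma irr_char_near_cycle:
  assumes \<omega>: "sorted_wrt (\<ge>) \<omega>" and k: "1 \<le> k" "k \<le> sum_list \<omega>"
  shows "\<exists>\<pi>. \<pi> permutes {1..sum_list \<omega>} \<and>
    irr_char \<omega> ({#k#} + replicate_mset (sum_list \<omega> - k) 1) = trace_on (specht_module \<omega>) (left_mult \<pi>) \<and>
    (\<exists>h. h permutes {1..sum_list \<omega>} \<and> inv \<pi> \<circ> h = h \<circ> long_cycle k)"
proof -
  let ?A = "{1..sum_list \<omega>}" and ?\<rho> = "{#k#} + replicate_mset (sum_list \<omega> - k) 1"
  let ?P = "\<lambda>g. g permutes ?A \<and> cycle_type_on ?A g = ?\<rho>"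
  define \<pi> where "\<pi> = (SOME g. ?P g)"
  have "long_cycle k permutes ?A"
    by (rule permutes_subset[OF long_cycle_permutes]) (use k in simp)
  then have "?P (long_cycle k)" using cycle_type_long_cycle[OF k] by blast
  then have \<pi>: "?P \<pi>" unfolding \<pi>_def by (rule someI[of ?P])
  then have "cycle_type_on ?A (inv \<pi>) = ?\<rho>" using cycle_type_inv[of \<pi> ?A] by simp
  then obtain h where "h permutes ?A" "inv \<pi> \<circ> h = h \<circ> long_cycle k"
    using conjugate_to_long_cycle[OF permutes_inv k] \<pi> by blast
  moreover have "irr_char \<omega> ?\<rho> = trace_on (specht_module \<omega>) (left_mult \<pi>)"
    unfolding irr_char_def \<pi>_def ..
  ultimately show ?thesis using \<pi> by blast
qed

lemma long_cycle_1: "long_cycle 1 = id"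
  by (simp add: long_cycle_def)

text \<open>The case \<open>k = 1\<close> of the preceding choice: a conjugate of
  \<open>long_cycle 1 = id\<close> is the identity.\<close>

lemma irr_char_identity:
  assumes \<omega>: "sorted_wrt (\<ge>) \<omega>" and n: "1 \<le> sum_list \<omega>"
  shows "irr_char \<omega> (replicate_mset (sum_list \<omega>) 1) = trace_on (specht_module \<omega>) (left_mult id)"
proof -
  obtain n' where n': "sum_list \<omega> = Suc n'" using n by (cases "sum_list \<omega>") auto
  obtain \<pi> h where \<pi>: "\<pi> permutes {1..sum_list \<omega>}"
    and irr: "irr_char \<omega> ({#1#} + replicate_mset (sum_list \<omega> - 1) 1) = trace_on (specht_module \<omega>) (left_mult \<pi>)"
    and h: "h permutes {1..sum_list \<omega>}" "inv \<pi> \<circ> h = h \<circ> long_cycle 1"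
    using irr_char_near_cycle[OF \<omega> order.refl n] by blast
  have "inv \<pi> x = x" for x
    using fun_cong[OF h(2), of "inv h x"] h(1) by (simp only: long_cycle_1 comp_id comp_apply permutes_inv_comp_right[OF h(1)])
  then have "\<pi> x = x" for x using permutes_inv_comp_right[OF \<pi>, of x] by simp
  then have "\<pi> = id" by (simp add: fun_eq_iff)
  moreover have "{#1#} + replicate_mset (sum_list \<omega> - 1) 1 = replicate_mset (sum_list \<omega>) (1::nat)"
    by (simp add: n')
  ultimately show ?thesis using irr by simp
qed

lemma falling_factorial_mult_fact:
  "k \<le> n \<Longrightarrow> (\<Prod>i<k. of_nat (n - i)) * fact (n - k) = (fact n :: complex)"
proof (induction k)
  case 0
  then show ?case by simp
next
  case (Suc k)
  have "n - k = Suc (n - Suc k)" using Suc.prems by simp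
  then have "fact (n - k) = of_nat (n - k) * (fact (n - Suc k) :: complex)" by (metis fact_Suc)
  then show ?case using Suc by (simp add: mult.assoc)
qed

text \<open>The Stanley--Feray character formula, with the labellings not yet counted.\<close>

lemma norm_char_eq_sum:
  assumes \<omega>: "sorted_wrt (\<ge>) \<omega>" and k: "1 \<le> k" "k \<le> sum_list \<omega>"
  shows "norm_char \<omega> {#k#} = (\<Sum>\<alpha> | \<alpha> permutes {1..k}. of_int (sign (\<alpha> \<circ> long_cycle k)) *
    of_nat (card {h \<in> {1..k} \<rightarrow>\<^sub>E {1..sum_list \<omega>}.
      \<alpha> \<in> invariant_factors {1..k} (entry_row \<omega>) (entry_col \<omega>) (long_cycle k) h}))"
proof -
  let ?n = "sum_list \<omega>"
  let ?A = "{1..?n}" and ?\<tau> = "long_cycle k" and ?y = "young_symmetrizer \<omega>"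
  interpret young_filling ?A "entry_row \<omega>" "entry_col \<omega>" using \<omega> by (rule tableau_filling)
  note sym = tableau_symmetrizer[OF \<omega>]
  obtain \<pi> h where \<pi>: "\<pi> permutes ?A"
    and irr: "irr_char \<omega> ({#k#} + replicate_mset (?n - k) 1) = trace_on (specht_module \<omega>) (left_mult \<pi>)"
    and h: "h permutes ?A" "inv \<pi> \<circ> h = h \<circ> ?\<tau>"
    using irr_char_near_cycle[OF \<omega> k] by blast
  have \<tau>A: "?\<tau> permutes ?A" using k by (intro permutes_subset[OF long_cycle_permutes]) simp
  \<comment> \<open>The sum is a class function, so the unknown \<open>inv \<pi>\<close> may be
    replaced by its conjugate, the long cycle.\<close>
  have "(\<Sum>g | g permutes ?A. ?y (inv g \<circ> inv \<pi> \<circ> g)) = (\<Sum>g | g permutes ?A. ?y (inv (h \<circ> g) \<circ> inv \<pi> \<circ> (h \<circ> g)))"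
    by (rule setum_permutations_compose_left[OF h(1)])
  also have "\<dots> = (\<Sum>g | g permutes ?A. ?y (inv g \<circ> ?\<tau> \<circ> g))"
  proof (rule sum.cong[OF refl])
    fix g assume "g \<in> {g. g permutes ?A}"
    then have "inv (h \<circ> g) = inv g \<circ> inv h" using h(1) by (intro permutes_inv_of_comp) auto
    moreover have "inv \<pi> (h x) = h (?\<tau> x)" for x using fun_cong[OF h(2), of x] by simp
    ultimately have "inv (h \<circ> g) \<circ> inv \<pi> \<circ> (h \<circ> g) = inv g \<circ> ?\<tau> \<circ> g"
      using h(1) by (simp add: fun_eq_iff)
    then show "?y (inv (h \<circ> g) \<circ> inv \<pi> \<circ> (h \<circ> g)) = ?y (inv g \<circ> ?\<tau> \<circ> g)" by (rule arg_cong)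
  qed
  also have "\<dots> = fact (card (?A - {1..k})) * (\<Sum>\<alpha> | \<alpha> permutes {1..k}. of_int (sign (\<alpha> \<circ> ?\<tau>)) *
      of_nat (card {h \<in> {1..k} \<rightarrow>\<^sub>E ?A. \<alpha> \<in> invariant_factors {1..k} (entry_row \<omega>) (entry_col \<omega>) ?\<tau> h}))"
    (is "_ = _ * ?R")
    unfolding sym[symmetric] using k by (intro symmetrizer_class_sum long_cycle_permutes) auto
  also have "card (?A - {1..k}) = ?n - k" using k by (simp add: card_Diff_subset)
  finally have cls: "(\<Sum>g | g permutes ?A. ?y (inv g \<circ> inv \<pi> \<circ> g)) = fact (?n - k) * ?R" .
  have "norm_char \<omega> {#k#} = (\<Prod>i<k. of_nat (?n - i)) *
      (trace_on (specht_module \<omega>) (left_mult \<pi>) / trace_on (specht_module \<omega>) (left_mult id))"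
    using irr irr_char_identity[OF \<omega>] k by (simp add: norm_char_def)
  also have "\<dots> = (\<Prod>i<k. of_nat (?n - i)) * (fact (?n - k) * ?R / of_nat (fact ?n))"
    by (simp only: character_quotient[OF \<omega> \<pi>] cls)
  also have "\<dots> = ((\<Prod>i<k. of_nat (?n - i)) * fact (?n - k)) * ?R / fact ?n"
    by (simp only: of_nat_fact times_divide_eq_right mult.assoc)
  also have "\<dots> = ?R"
    unfolding falling_factorial_mult_fact[OF k(2)] by simp
  finally show ?thesis .
qed

section \<open>Coloured monomials and their degrees\<close>

definition colour_exponent :: "nat \<Rightarrow> nat \<Rightarrow> coloured_perm \<Rightarrow> indet \<Rightarrow>\<^sub>0 nat" where
  "colour_exponent m k c = (\<Sum>i=1..m. Poly_Mapping.single (PVar i) (colour_count k c i)) +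
     (\<Sum>i=1..m. Poly_Mapping.single (QVar i) (colour_count k (coloured_mult k c (long_cycle k)) i))"

lemma colour_monom_mult:
  "colour_monom m k PVar c * colour_monom m k QVar (coloured_mult k c (long_cycle k)) =
     Poly_Mapping.single (colour_exponent m k c) 1"
  by (simp only: colour_monom_def colour_exponent_def var_power prod_single mult_single prod.neutral_const mult_1)

lemma coloured_mult_long_cycle:
  "coloured_mult k (\<alpha>, \<psi>) (long_cycle k) =
     (\<alpha> \<circ> long_cycle k, \<lambda>u\<in>cycles_on {1..k} (\<alpha> \<circ> long_cycle k). max_colour (cycles_on {1..k} \<alpha>) \<psi> u)"
  by (simp add: coloured_mult_def max_colour_def)

lemma prod_colour_count:
  fixes x :: "nat \<Rightarrow> 'b::comm_monoid_mult"
  assumes "\<And>w. w \<in> cycles_on {1..k} \<alpha> \<Longrightarrow> \<psi> w \<in> {1..m}"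
  shows "(\<Prod>i=1..m. x i ^ colour_count k (\<alpha>, \<psi>) i) = (\<Prod>w\<in>cycles_on {1..k} \<alpha>. x (\<psi> w))"
proof -
  let ?C = "cycles_on {1..k} \<alpha>"
  have "(\<Prod>w\<in>?C. x (\<psi> w)) = (\<Prod>i\<in>{1..m}. \<Prod>w\<in>{w \<in> ?C. \<psi> w = i}. x (\<psi> w))"
    using assms by (intro prod.group[symmetric]) (auto simp: cycles_on_def)
  also have "\<dots> = (\<Prod>i=1..m. x i ^ colour_count k (\<alpha>, \<psi>) i)"
    by (intro prod.cong refl) (simp add: colour_count_def)
  finally show ?thesis by simp
qed

lemma sum_colour_count:
  assumes "\<And>w. w \<in> cycles_on {1..k} \<alpha> \<Longrightarrow> \<psi> w \<in> {1..m}"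
  shows "(\<Sum>i=1..m. colour_count k (\<alpha>, \<psi>) i) = card (cycles_on {1..k} \<alpha>)"
proof -
  let ?C = "cycles_on {1..k} \<alpha>"
  have "(\<Sum>w\<in>?C. 1::nat) = (\<Sum>i\<in>{1..m}. \<Sum>w\<in>{w \<in> ?C. \<psi> w = i}. 1)"
    using assms by (intro sum.group[symmetric]) (auto simp: cycles_on_def)
  then show ?thesis by (simp add: colour_count_def)
qed

context
  fixes m k :: nat and \<alpha> :: "nat \<Rightarrow> nat" and \<psi> :: "nat set \<Rightarrow> nat"
  assumes \<alpha>: "\<alpha> permutes {1..k}" and \<psi>: "\<psi> \<in> cycles_on {1..k} \<alpha> \<rightarrow>\<^sub>E {1..m}"
begin

lemma comp_long_cycle_permutes: "\<alpha> \<circ> long_cycle k permutes {1..k}"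
  using permutes_compose[OF long_cycle_permutes \<alpha>] .

lemma max_colour_range:
  assumes u: "u \<in> cycles_on {1..k} (\<alpha> \<circ> long_cycle k)"
  shows "max_colour (cycles_on {1..k} \<alpha>) \<psi> u \<in> {1..m}"
proof -
  obtain x where "x \<in> {1..k}" "max_colour (cycles_on {1..k} \<alpha>) \<psi> u = \<psi> (orbit \<alpha> x)"
    using max_colour_cycles(1)[OF finite_atLeastAtMost \<alpha> comp_long_cycle_permutes u] by blast
  then show ?thesis using PiE_mem[OF \<psi>, of "orbit \<alpha> x"] by (simp add: cycles_on_def)
qed

lemma monom_eval_colour_exponent:
  "monom_eval f (colour_exponent m k (\<alpha>, \<psi>)) =
     (\<Prod>w\<in>cycles_on {1..k} \<alpha>. f (PVar (\<psi> w))) *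
     (\<Prod>u\<in>cycles_on {1..k} (\<alpha> \<circ> long_cycle k). f (QVar (max_colour (cycles_on {1..k} \<alpha>) \<psi> u)))"
proof -
  have "monom_eval f (colour_exponent m k (\<alpha>, \<psi>)) =
      (\<Prod>i=1..m. f (PVar i) ^ colour_count k (\<alpha>, \<psi>) i) *
      (\<Prod>i=1..m. f (QVar i) ^ colour_count k (coloured_mult k (\<alpha>, \<psi>) (long_cycle k)) i)"
    by (simp only: colour_exponent_def monom_eval_add monom_eval_sum monom_eval_single)
  also have "(\<Prod>i=1..m. f (PVar i) ^ colour_count k (\<alpha>, \<psi>) i) = (\<Prod>w\<in>cycles_on {1..k} \<alpha>. f (PVar (\<psi> w)))"
    using PiE_mem[OF \<psi>] by (rule prod_colour_count)
  also have "(\<Prod>i=1..m. f (QVar i) ^ colour_count k (coloured_mult k (\<alpha>, \<psi>) (long_cycle k)) i) =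
      (\<Prod>u\<in>cycles_on {1..k} (\<alpha> \<circ> long_cycle k). f (QVar (max_colour (cycles_on {1..k} \<alpha>) \<psi> u)))"
    unfolding coloured_mult_long_cycle
    using max_colour_range by (subst prod_colour_count) (auto intro!: prod.cong)
  finally show ?thesis .
qed

lemma monom_degree_colour_exponent:
  "monom_degree (colour_exponent m k (\<alpha>, \<psi>)) =
     card (cycles_on {1..k} \<alpha>) + card (cycles_on {1..k} (\<alpha> \<circ> long_cycle k))"
proof -
  have "monom_degree (colour_exponent m k (\<alpha>, \<psi>)) =
      (\<Sum>i=1..m. colour_count k (\<alpha>, \<psi>) i) +
      (\<Sum>i=1..m. colour_count k (coloured_mult k (\<alpha>, \<psi>) (long_cycle k)) i)"
    by (simp only: colour_exponent_def monom_degree_add monom_degree_sum monom_degree_single)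
  also have "(\<Sum>i=1..m. colour_count k (\<alpha>, \<psi>) i) = card (cycles_on {1..k} \<alpha>)"
    using PiE_mem[OF \<psi>] by (rule sum_colour_count)
  also have "(\<Sum>i=1..m. colour_count k (coloured_mult k (\<alpha>, \<psi>) (long_cycle k)) i) =
      card (cycles_on {1..k} (\<alpha> \<circ> long_cycle k))"
    unfolding coloured_mult_long_cycle using max_colour_range by (intro sum_colour_count) simp
  finally show ?thesis .
qed

text \<open>The quotient of the two permutations is the long cycle, which is transitive on
  \<open>{1..k}\<close>, so \<open>cycles_add_cycles_le\<close> applies.\<close>

lemma monom_degree_colour_exponent_le:
  "monom_degree (colour_exponent m k (\<alpha>, \<psi>)) \<le> k + 1"
proof -
  have "inv \<alpha> \<circ> (\<alpha> \<circ> long_cycle k) = long_cycle k"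
    using \<alpha> by (simp add: fun_eq_iff)
  then have "orbit (inv \<alpha> \<circ> (\<alpha> \<circ> long_cycle k)) x = {1..k}" if "x \<in> {1..k}" for x
    using orbit_long_cycle[OF that] by (simp only:)
  from cycles_add_cycles_le[OF finite_atLeastAtMost \<alpha> comp_long_cycle_permutes this]
  show ?thesis by (simp add: monom_degree_colour_exponent)
qed

end

lemma keys_sum_single: "Poly_Mapping.keys (\<Sum>i\<in>I. Poly_Mapping.single (v i) (n i :: nat)) \<subseteq> v ` I"
proof
  fix x assume "x \<in> Poly_Mapping.keys (\<Sum>i\<in>I. Poly_Mapping.single (v i) (n i))"
  then have "(\<Sum>i\<in>I. Poly_Mapping.lookup (Poly_Mapping.single (v i) (n i)) x) \<noteq> 0"
    by (simp add: in_keys_iff lookup_sum)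
  then obtain i where "i \<in> I" "Poly_Mapping.lookup (Poly_Mapping.single (v i) (n i)) x \<noteq> 0"
    by (rule sum.not_neutral_contains_not_neutral)
  then show "x \<in> v ` I" by (auto simp: lookup_single when_def split: if_splits)
qed

lemma keys_colour_exponent: "Poly_Mapping.keys (colour_exponent m k c) \<subseteq> PVar ` {1..m} \<union> QVar ` {1..m}"
  unfolding colour_exponent_def
  by (rule order.trans[OF keys_add], rule Un_mono; rule keys_sum_single)

text \<open>The character formula as a polynomial; the sign comes from the column permutation in the
  symmetrizer, which is conjugate to \<open>\<alpha> \<circ> long_cycle k\<close>.\<close>

definition stanley_feray :: "nat \<Rightarrow> nat \<Rightarrow> pq_poly" where
  "stanley_feray m k = (\<Sum>c\<in>coloured_perms m k.
     Poly_Mapping.single (colour_exponent m k c) (sign (fst c \<circ> long_cycle k)))"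

lemma coloured_perms_Sigma:
  "coloured_perms m k = (SIGMA \<alpha>:{\<alpha>. \<alpha> permutes {1..k}}. cycles_on {1..k} \<alpha> \<rightarrow>\<^sub>E {1..m})"
  by (auto simp: coloured_perms_def)

lemma finite_coloured_perms: "finite (coloured_perms m k)"
  unfolding coloured_perms_Sigma
  by (intro finite_SigmaI finite_PiE finite_permutations) (simp_all add: cycles_on_def)

lemma stanley_feray_is_stanley_poly:
  assumes k: "k \<ge> 1"
  shows "is_stanley_poly m k (stanley_feray m k)"
  unfolding is_stanley_poly_def
proof (intro conjI allI impI)
  show "stanley_feray m k \<in> pq_polys m"
    unfolding pq_polys_def
  proof (intro CollectI ballI)
    fix t assume "t \<in> Poly_Mapping.keys (stanley_feray m k)"
    then have "t \<in> (\<Union>c\<in>coloured_perms m k.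
        Poly_Mapping.keys (Poly_Mapping.single (colour_exponent m k c) (sign (fst c \<circ> long_cycle k))))"
      unfolding stanley_feray_def using keys_sum by (rule subsetD[rotated])
    then obtain c where "t = colour_exponent m k c" by (auto split: if_splits)
    then show "Poly_Mapping.keys t \<subseteq> PVar ` {1..m} \<union> QVar ` {1..m}"
      using keys_colour_exponent by simp
  qed
next
  fix p q :: "nat \<Rightarrow> nat"
  assume pos: "\<forall>i\<in>{1..m}. 1 \<le> p i \<and> 1 \<le> q i"
    and mono: "\<forall>i\<in>{1..m}. \<forall>j\<in>{1..m}. i \<le> j \<longrightarrow> q j \<le> q i"
    and n: "k \<le> (\<Sum>i=1..m. p i * q i)"
  let ?K = "{1..k}" and ?\<tau> = "long_cycle k"
  define L where "L = shape m p id"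
  have L: "set L \<subseteq> {1..m}" using set_shape[of m p id] by (simp add: L_def)
  have sh: "shape m p q = map q L" by (simp add: L_def map_shape)
  \<comment> \<open>\<open>L\<close> lists block numbers in increasing order, and \<open>q\<close>
    is weakly decreasing on them.\<close>
  have "sorted_wrt (\<ge>) (map q L)"
    unfolding sorted_wrt_map
    by (rule sorted_wrt_mono_rel[OF _ sorted_shape[of m p, folded L_def]]) (use L mono in blast)
  then have \<omega>: "sorted_wrt (\<ge>) (shape m p q)" by (simp add: sh)
  have kn: "k \<le> sum_list (shape m p q)" using n by (simp add: sum_list_shape)
  have q: "q j \<le> q i" if "i \<in> {1..m}" "j \<in> {1..m}" "i \<le> j" for i j using mono that by blast
  let ?f = "\<lambda>v. (case v of PVar i \<Rightarrow> of_nat (p i) | QVar i \<Rightarrow> of_nat (q i)) :: complex"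
  have "eval_pq p q (stanley_feray m k) =
      (\<Sum>(\<alpha>, \<psi>)\<in>coloured_perms m k. of_int (sign (\<alpha> \<circ> ?\<tau>)) * monom_eval ?f (colour_exponent m k (\<alpha>, \<psi>)))"
    unfolding eval_pq_def stanley_feray_def subst_sum subst_single by (intro sum.cong refl) auto
  also have "\<dots> = (\<Sum>\<alpha> | \<alpha> permutes ?K. \<Sum>\<psi>\<in>cycles_on ?K \<alpha> \<rightarrow>\<^sub>E {1..m}.
      of_int (sign (\<alpha> \<circ> ?\<tau>)) * monom_eval ?f (colour_exponent m k (\<alpha>, \<psi>)))"
    unfolding coloured_perms_Sigma
    by (rule sum.Sigma[symmetric]) (auto intro!: finite_permutations finite_PiE simp: cycles_on_def)
  also have "\<dots> = (\<Sum>\<alpha> | \<alpha> permutes ?K. of_int (sign (\<alpha> \<circ> ?\<tau>)) *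
    of_nat (card {h \<in> ?K \<rightarrow>\<^sub>E {1..sum_list (shape m p q)}.
      \<alpha> \<in> invariant_factors ?K (entry_row (shape m p q)) (entry_col (shape m p q)) ?\<tau> h}))"
  proof (rule sum.cong[OF refl])
    fix \<alpha> assume "\<alpha> \<in> {\<alpha>. \<alpha> permutes ?K}"
    then have \<alpha>: "\<alpha> permutes ?K" by simp
    let ?C = "cycles_on ?K \<alpha>"
    have count: "card {h \<in> ?K \<rightarrow>\<^sub>E {1..sum_list (shape m p q)}.
        \<alpha> \<in> invariant_factors ?K (entry_row (shape m p q)) (entry_col (shape m p q)) ?\<tau> h} =
      (\<Sum>\<psi>\<in>?C \<rightarrow>\<^sub>E {1..m}. (\<Prod>w\<in>?C. card {i. i < length L \<and> L ! i = \<psi> w}) *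
        (\<Prod>u\<in>cycles_on ?K (\<alpha> \<circ> ?\<tau>). q (max_colour ?C \<psi> u)))"
      unfolding sh by (rule card_row_col_labellings[OF finite_atLeastAtMost \<alpha> long_cycle_permutes L]) (rule q)
    have "of_nat (card {h \<in> ?K \<rightarrow>\<^sub>E {1..sum_list (shape m p q)}.
        \<alpha> \<in> invariant_factors ?K (entry_row (shape m p q)) (entry_col (shape m p q)) ?\<tau> h}) =
      (\<Sum>\<psi>\<in>?C \<rightarrow>\<^sub>E {1..m}. (\<Prod>w\<in>?C. of_nat (card {i. i < length L \<and> L ! i = \<psi> w})) *
        (\<Prod>u\<in>cycles_on ?K (\<alpha> \<circ> ?\<tau>). of_nat (q (max_colour ?C \<psi> u))) :: complex)"
      unfolding count by (simp only: of_nat_sum of_nat_mult of_nat_prod)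
    also have "\<dots> = (\<Sum>\<psi>\<in>?C \<rightarrow>\<^sub>E {1..m}. monom_eval ?f (colour_exponent m k (\<alpha>, \<psi>)))"
    proof (rule sum.cong[OF refl])
      fix \<psi> assume \<psi>: "\<psi> \<in> ?C \<rightarrow>\<^sub>E {1..m}"
      have "card {i. i < length L \<and> L ! i = \<psi> w} = p (\<psi> w)" if "w \<in> ?C" for w
        using PiE_mem[OF \<psi> that] unfolding L_def count_shape by simp
      then show "(\<Prod>w\<in>?C. of_nat (card {i. i < length L \<and> L ! i = \<psi> w})) *
          (\<Prod>u\<in>cycles_on ?K (\<alpha> \<circ> ?\<tau>). of_nat (q (max_colour ?C \<psi> u))) =
          monom_eval ?f (colour_exponent m k (\<alpha>, \<psi>))"
        unfolding monom_eval_colour_exponent[OF \<alpha> \<psi>] by simp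
    qed
    finally show "(\<Sum>\<psi>\<in>?C \<rightarrow>\<^sub>E {1..m}. of_int (sign (\<alpha> \<circ> ?\<tau>)) * monom_eval ?f (colour_exponent m k (\<alpha>, \<psi>))) =
      of_int (sign (\<alpha> \<circ> ?\<tau>)) * of_nat (card {h \<in> ?K \<rightarrow>\<^sub>E {1..sum_list (shape m p q)}.
        \<alpha> \<in> invariant_factors ?K (entry_row (shape m p q)) (entry_col (shape m p q)) ?\<tau> h})"
      by (simp only: sum_distrib_left)
  qed
  also have "\<dots> = norm_char (shape m p q) {#k#}"
    by (rule norm_char_eq_sum[OF \<omega> k kn, symmetric])
  finally show "eval_pq p q (stanley_feray m k) = norm_char (shape m p q) {#k#}" .
qed

lemma stanley_F_eq:
  assumes "m \<ge> 1" "k \<ge> 1"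
  shows "stanley_F m k = stanley_feray m k"
  unfolding stanley_F_def
proof (rule the_equality)
  show st: "is_stanley_poly m k (stanley_feray m k)"
    by (rule stanley_feray_is_stanley_poly[OF assms(2)])
  show "F = stanley_feray m k" if "is_stanley_poly m k F" for F
    by (rule is_stanley_poly_unique[OF assms(1) that st])
qed

lemma minus_one_power_mult_neg_q_stanley_feray:
  "(- 1) ^ k * neg_q (stanley_feray m k) =
     (\<Sum>c\<in>coloured_perms m k. Poly_Mapping.single (colour_exponent m k c) 1)"
proof -
  have "neg_q (stanley_feray m k) =
      (\<Sum>c\<in>coloured_perms m k. Poly_Mapping.single (colour_exponent m k c) ((- 1) ^ k))"
    unfolding stanley_feray_def neg_q_sum neg_q_single
  proof (rule sum.cong[OF refl])
    fix c assume "c \<in> coloured_perms m k"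
    then obtain \<alpha> \<psi> where c: "c = (\<alpha>, \<psi>)" and \<alpha>: "\<alpha> permutes {1..k}"
      and \<psi>: "\<psi> \<in> cycles_on {1..k} \<alpha> \<rightarrow>\<^sub>E {1..m}"
      by (auto simp: coloured_perms_def)
    \<comment> \<open>Each cycle of \<open>\<alpha> \<circ> long_cycle k\<close> contributes one
      variable \<open>QVar\<close>, hence one factor -1; the variables \<open>PVar\<close>
      contribute 1.\<close>
    have "sign (fst c \<circ> long_cycle k) * monom_eval q_sign (colour_exponent m k c) =
        sign (\<alpha> \<circ> long_cycle k) * (- 1) ^ card (cycles_on {1..k} (\<alpha> \<circ> long_cycle k))"
      unfolding c monom_eval_colour_exponent[OF \<alpha> \<psi>] by (simp add: q_sign_def)
    also have "\<dots> = (- 1) ^ k"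
      using sign_times_cycles[OF finite_atLeastAtMost comp_long_cycle_permutes[OF \<alpha> \<psi>]] by simp
    finally show "Poly_Mapping.single (colour_exponent m k c)
        (sign (fst c \<circ> long_cycle k) * monom_eval q_sign (colour_exponent m k c)) =
      Poly_Mapping.single (colour_exponent m k c) ((- 1) ^ k)" by (rule arg_cong)
  qed
  then show ?thesis
    by (cases "even k") (simp_all add: single_uminus sum_negf)
qed

lemma top_terms_neg_q_stanley_F:
  assumes m: "m \<ge> 1" and k: "k \<ge> 1"
  shows "top_terms ((- 1) ^ k * neg_q (stanley_F m k)) = top_fact_coeff m k"
proof -
  let ?E = "colour_exponent m k" and ?CP = "coloured_perms m k"
  have deg: "monom_degree (?E (\<alpha>, \<psi>)) = card (cycles_on {1..k} \<alpha>) + card (cycles_on {1..k} (\<alpha> \<circ> long_cycle k))"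
    if "(\<alpha>, \<psi>) \<in> ?CP" for \<alpha> \<psi>
    using that monom_degree_colour_exponent by (simp add: coloured_perms_def)
  have "top_terms ((- 1) ^ k * neg_q (stanley_F m k)) = top_terms (\<Sum>c\<in>?CP. Poly_Mapping.single (?E c) 1)"
    by (simp only: stanley_F_eq[OF m k] minus_one_power_mult_neg_q_stanley_feray)
  also have "\<dots> = (\<Sum>c\<in>{c \<in> ?CP. monom_degree (?E c) = k + 1}. Poly_Mapping.single (?E c) 1)"
  proof (rule top_terms_sum_monomials[OF finite_coloured_perms])
    fix c assume "c \<in> ?CP"
    then show "monom_degree (?E c) \<le> k + 1"
      using monom_degree_colour_exponent_le by (auto simp: coloured_perms_def)
  next
    \<comment> \<open>The identity with all cycles coloured 1 attains the bound: \<open>k\<close>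
      fixed points and the one cycle of \<open>long_cycle k\<close>.\<close>
    define \<psi> where "\<psi> = (\<lambda>w\<in>cycles_on {1..k} id. 1::nat)"
    have c: "(id, \<psi>) \<in> ?CP" using m by (simp add: coloured_perms_def permutes_id \<psi>_def)
    have "orbit id x = {x}" for x :: nat by (simp add: orbit_eq_singleton_iff)
    then have "cycles_on {1..k} id = (\<lambda>x. {x}) ` {1..k}" by (simp add: cycles_on_def)
    then have "card (cycles_on {1..k} id) = k" by (simp add: card_image)
    moreover have "cycles_on {1..k} (long_cycle k) = {{1..k}}"
      using orbit_long_cycle[of _ k] k by (auto simp: cycles_on_def image_constant_conv)
    ultimately have "monom_degree (?E (id, \<psi>)) = k + 1" unfolding deg[OF c] by simp
    then show "\<exists>c\<in>?CP. monom_degree (?E c) = k + 1" using c by blast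
  qed
  also have "\<dots> = top_fact_coeff m k"
    unfolding top_fact_coeff_def colour_monom_mult
    by (rule sum.cong) (use deg in auto)
  finally show ?thesis .
qed

theorem mainTheorem1:
  fixes m :: nat
  assumes "m \<ge> 1"
  shows "- G_series_neg m = - 1 + fps_const (\<Sum>i=1..m. var (PVar i)) * fps_X + TopFact m \<and>
    (\<forall>k\<ge>1. top_terms ((- 1) ^ k * neg_q (stanley_F m k)) = top_fact_coeff m k)"
proof (intro conjI allI impI)
  fix k :: nat assume "k \<ge> 1"
  then show "top_terms ((- 1) ^ k * neg_q (stanley_F m k)) = top_fact_coeff m k"
    by (rule top_terms_neg_q_stanley_F[OF assms])
next
  let ?P = "\<Sum>i=1..m. var (PVar i)"
  have nth_neg: "fps_nth (G_series_neg m) n = (- 1) ^ n * neg_q (fps_nth (G_series m) n)" for n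
    by (simp add: G_series_neg_def fps_compose_uminus')
  have single_neg: "neg_q (1 :: pq_poly) = 1"
    using neg_q_single[of 0 1] by (simp add: monom_eval_0 del: single_one flip: single_one)
  have P_neg: "neg_q ?P = ?P"
    unfolding neg_q_sum var_def neg_q_single by (simp add: monom_eval_single q_sign_def)
  show "- G_series_neg m = - 1 + fps_const ?P * fps_X + TopFact m"
  proof (rule fps_ext)
    fix n
    consider "n = 0" | "n = 1" | k where "n = Suc k" "k \<ge> 1"
      by (metis One_nat_def Suc_le_mono le0 not0_implies_Suc)
    then show "fps_nth (- G_series_neg m) n = fps_nth (- 1 + fps_const ?P * fps_X + TopFact m) n"
    proof cases
      case 1
      then show ?thesis by (simp add: nth_neg G_series_def single_neg TopFact_def)
    next
      case 2
      then show ?thesis by (simp add: nth_neg G_series_def stanley_G_def P_neg[unfolded One_nat_def] TopFact_def)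
    next
      case 3
      \<comment> \<open>Since \<open>n = k + 1\<close>, the outer minus and the factor
        \<open>(- 1) ^ n\<close> combine to \<open>(- 1) ^ k\<close>.\<close>
      have "fps_nth (- G_series_neg m) n = (- 1) ^ k * neg_q (top_terms (stanley_F m k))"
        using 3 by (simp add: nth_neg G_series_def stanley_G_def)
      also have "\<dots> = top_fact_coeff m k"
        unfolding neg_q_top_terms top_terms_sign[symmetric] by (rule top_terms_neg_q_stanley_F[OF assms 3(2)])
      finally show ?thesis using 3 by (simp add: TopFact_def)
    qed
  qed
qed

end
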